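(* There exist absolute constants $C_1,c>0$ such that the following holds. Let $T>0$ and let $b:[0,T]\times\mathbb R\to\mathbb R$ satisfy $b\in L^1(0,T;L^1_{\mathrm{loc}}(\mathbb R))$ and $\frac{\partial b}{\partial x}\in L^1(0,T;\mathrm{BMO}(\mathbb R))$, i.e. $\int_0^T\big\|\frac{\partial}{\partial x}b(t,\cdot)\big\|_\ast\,dt<\infty$. Then there exists a unique flow $\phi(t,x)$ satisfying $$\frac{\partial}{\partial t}\phi(t,x)=b(t,\phi(t,x))\quad\forall (t,x)\in[0,T]\times\mathbb R,\qquad \phi(0,x)=x\quad\forall x\in\mathbb R.$$ Moreover, for each $t\in[0,T]$, $\big|\frac{\partial}{\partial x}\phi(t,\cdot)\big|$ is an $A_\infty(\mathbb R)$-weight, and $$\Big\|\log\Big|\frac{\partial}{\partial x}\phi(t,\cdot)\Big|\Big\|_{\mathrm{BMO}(\mathbb R)}\le C_1\left(\int_0^t\Big\|\frac{\partial}{\partial x}b(s,\cdot)\Big\|_{\mathrm{BMO}(\mathbb R)}ds\right)\exp\left(c\int_0^t\Big\|\frac{\partial}{\partial x}b(s,\cdot)\Big\|_{\mathrm{BMO}(\mathbb R)}ds\right).$$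
   Context: For $f\in L^1_{\mathrm{loc}}(\mathbb R)$ and a bounded interval $I$, $f_I=|I|^{-1}\int_I f\,dx$. $\|f\|_{\mathrm{BMO}(\mathbb R)}=\sup_I |I|^{-1}\int_I|f-f_I|\,dx$ over bounded intervals $I$, and $f\in\mathrm{BMO}(\mathbb R)$ iff this is finite. $\|f\|_\ast=\|f\|_{\mathrm{BMO}(\mathbb R)}+\int_{[-1,1]}|f|\,dx$. A nonnegative locally integrable $w$ is an $A_\infty(\mathbb R)$-weight if $[w]_{A_\infty(\mathbb R)}=\sup_I\big(|I|^{-1}\int_I w\,dx\big)\exp\big(-|I|^{-1}\int_I\log w\,dx\big)<\infty$, the supremum being over bounded intervals $I\subset\mathbb R$ (and $w>0$ a.e.). $b\in L^1(0,T;L^1_{\mathrm{loc}}(\mathbb R))$ means $b$ is measurable and $\int_0^T\int_K|b(t,x)|\,dx\,dt<\infty$ for every compact $K\subset\mathbb R$. $\frac{\partial b}{\partial x}$ is the distributional spatial derivative; for a.e. $t$, $b(t,\cdot)$ is identified with its continuous representative. The flow equation is understood in integrated form: for every $x\in\mathbb R$, $t\mapsto b(t,\phi(t,x))$ is integrable on $(0,T)$ and $\phi(t,x)=x+\int_0^t b(r,\phi(r,x))\,dr$ for all $t\in[0,T]$. $\frac{\partial}{\partial x}\phi(t,\cdot)$ is the weak (distributional) derivative of $\phi(t,\cdot)$, which is part of the claim to be a locally integrable function. *)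

theory Defs
  imports "HOL-Analysis.Analysis"
begin

definition locally_integrable :: "(real \<Rightarrow> real) \<Rightarrow> bool" where
  "locally_integrable f \<longleftrightarrow> (\<forall>K. compact K \<longrightarrow> set_integrable lebesgue K f)"

text \<open>A nondegenerate bounded interval is represented by its endpoints \<open>p < q\<close>;
  whether the endpoints belong to it is immaterial for the averages below.\<close>

definition mean :: "real \<Rightarrow> real \<Rightarrow> (real \<Rightarrow> real) \<Rightarrow> real" where
  "mean p q f = (LINT x:{p..q}|lebesgue. f x) / (q - p)"

text \<open>The seminorm is meaningful only for locally integrable functions, since the Bochner
  integral of a non-integrable function is 0 by convention; membership in \<open>BMO\<close> therefore
  asks for local integrability separately.\<close>

definition bmo_norm :: "(real \<Rightarrow> real) \<Rightarrow> ennreal" where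
  "bmo_norm f =
     (SUP (p, q) \<in> {(p, q). p < q}. ennreal (mean p q (\<lambda>x. \<bar>f x - mean p q f\<bar>)))"

definition BMO :: "(real \<Rightarrow> real) set" where
  "BMO = {f. locally_integrable f \<and> bmo_norm f < \<infinity>}"

definition bmo_star_norm :: "(real \<Rightarrow> real) \<Rightarrow> ennreal" where
  "bmo_star_norm f = bmo_norm f + (\<integral>\<^sup>+x\<in>{-1..1}. ennreal \<bar>f x\<bar> \<partial>lebesgue)"

text \<open>For a locally integrable \<open>w \<ge> 0\<close> the positive part of \<open>ln w\<close> is locally integrable, so
  if \<open>ln w\<close> is not integrable on an interval its mean there is \<open>-\<infinity>\<close> and the
  exponential factor is \<open>\<infinity>\<close>.\<close>

definition Ainf_const :: "(real \<Rightarrow> real) \<Rightarrow> ennreal" where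
  "Ainf_const w =
     (SUP (p, q) \<in> {(p, q). p < q}.
        ennreal (mean p q w) *
        (if set_integrable lebesgue {p..q} (\<lambda>x. ln (w x))
         then ennreal (exp (- mean p q (\<lambda>x. ln (w x)))) else \<infinity>))"

definition Ainf_weight :: "(real \<Rightarrow> real) \<Rightarrow> bool" where
  "Ainf_weight w \<longleftrightarrow>
     locally_integrable w \<and> (\<forall>x. 0 \<le> w x) \<and> (AE x in lebesgue. 0 < w x) \<and> Ainf_const w < \<infinity>"

definition test_function :: "(real \<Rightarrow> real) \<Rightarrow> bool" where
  "test_function \<eta> \<longleftrightarrow>
     (\<forall>n x. (deriv ^^ n) \<eta> field_differentiable at x) \<and> compact (closure {x. \<eta> x \<noteq> 0})"

definition has_distributional_deriv :: "(real \<Rightarrow> real) \<Rightarrow> (real \<Rightarrow> real) \<Rightarrow> bool" where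
  "has_distributional_deriv f g \<longleftrightarrow>
     locally_integrable f \<and> locally_integrable g \<and>
     (\<forall>\<eta>. test_function \<eta> \<longrightarrow>
        (LINT x|lebesgue. f x * deriv \<eta> x) = - (LINT x|lebesgue. g x * \<eta> x))"

definition L1_L1loc :: "real \<Rightarrow> (real \<Rightarrow> real \<Rightarrow> real) set" where
  "L1_L1loc T = {b.
     (\<lambda>(t, x). b t x) \<in> borel_measurable (lebesgue_on ({0..T} \<times> UNIV)) \<and>
     (\<forall>K. compact K \<longrightarrow>
        (\<integral>\<^sup>+t\<in>{0..T}. (\<integral>\<^sup>+x\<in>K. ennreal \<bar>b t x\<bar> \<partial>lebesgue) \<partial>lebesgue) < \<infinity>)}"

definition L1_BMO :: "real \<Rightarrow> (real \<Rightarrow> real \<Rightarrow> real) set" where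
  "L1_BMO T = {B.
     (\<lambda>(t, x). B t x) \<in> borel_measurable (lebesgue_on ({0..T} \<times> UNIV)) \<and>
     (AE t in lebesgue_on {0..T}. B t \<in> BMO) \<and>
     (\<integral>\<^sup>+t\<in>{0..T}. bmo_star_norm (B t) \<partial>lebesgue) < \<infinity>}"

text \<open>A continuous representative is unique when it exists.\<close>

definition cont_rep :: "(real \<Rightarrow> real) \<Rightarrow> real \<Rightarrow> real" where
  "cont_rep f = (THE g. continuous_on UNIV g \<and> (AE x in lebesgue. f x = g x))"

text \<open>The flow equation in integrated form. The velocity field is an equivalence class modulo
  null sets and is evaluated through the continuous representative of almost every time slice;
  the remaining times do not affect the integral.\<close>

definition is_flow :: "real \<Rightarrow> (real \<Rightarrow> real \<Rightarrow> real) \<Rightarrow> (real \<Rightarrow> real \<Rightarrow> real) \<Rightarrow> bool" where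
  "is_flow T b \<phi> \<longleftrightarrow>
     (\<forall>x. \<phi> 0 x = x \<and>
          set_integrable lebesgue {0..T} (\<lambda>t. cont_rep (b t) (\<phi> t x)) \<and>
          (\<forall>t\<in>{0..T}. \<phi> t x = x + (LINT r:{0..t}|lebesgue. cont_rep (b r) (\<phi> r x))))"

text \<open>The integral of the seminorms over \<open>[0,t]\<close> as a real number; it is finite for
  \<open>B \<in> L1_BMO T\<close> and \<open>t \<le> T\<close>.\<close>

definition bmo_integral :: "(real \<Rightarrow> real \<Rightarrow> real) \<Rightarrow> real \<Rightarrow> real" where
  "bmo_integral B t = enn2real (\<integral>\<^sup>+s\<in>{0..t}. bmo_norm (B s) \<partial>lebesgue)"

end

theory Submission
  imports Defs
begin

text \<open>Fix a partition of an interval into cells carrying weights \<open>l\<^sub>i\<close> and let \<open>m\<^sub>i(t)\<close> be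
  the relative lengths of the images of the cells under the flow. The derivative in \<open>t\<close> of the
  relative entropy \<open>\<Sum>\<^sub>i l\<^sub>i ln (l\<^sub>i / m\<^sub>i(t))\<close> is a weighted sum of differences between the means
  of \<open>\<partial>b/\<partial>x\<close> over an image cell and over the whole image interval. By the duality between
  entropy and exponential integrability, John--Nirenberg bounds it by \<open>9 \<parallel>\<partial>b/\<partial>x\<parallel> (entropy + 5)\<close>,
  which controls the entropy uniformly in the partition, forwards and backwards in time. The same
  duality with all weight on one cell is a log-Lipschitz estimate for \<open>b\<close>, from which Osgood's
  argument gives existence and uniqueness.
  Refining dyadic partitions, bounded entropy and the inequality between Hellinger distance and
  entropy make the difference quotients of the flow converge in \<open>L\<^sup>1\<close>; the limit is the spatial
  derivative, and Fatou's lemma carries the bounds over to its logarithm.\<close>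

section \<open>Calculus along absolutely continuous curves\<close>

text \<open>The field is only log-Lipschitz in space, so the flow cannot be differentiated in
  \<open>x\<close> a priori, and composing a BMO function with the flow would already require the
  regularity that is to be shown. Increments of the flow avoid both: the logarithm of an increment
  has as its exact time derivative the mean of the spatial derivative of \<open>b\<close> over the
  moving interval, and the estimate closes because the bound for the rate of the entropy contains
  nothing but the entropy itself. Two weightings are needed. With the lengths at time 0 as weights
  one controls the logarithm of the distortion, which gives the BMO bound and the positivity of the
  density; with the image lengths as weights one controls an L log L quantity, which rules out a
  singular part of the flow. The 9 is the scale \<open>9 * N\<close> of the exponential moment; that
  moment is at most 6, Young's inequality subtracts 1, and 9 * 5 = 45 is doubled to 90 on passing
  from the logarithm of the mean to the mean of the logarithm.\<close>

lemma integrable_chain_rule: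
  fixes f X G G' :: "real \<Rightarrow> real"
  assumes ab: "a \<le> b"
    and f: "f absolutely_integrable_on {a..b}"
    and X: "\<And>t. t \<in> {a..b} \<Longrightarrow> X t = X a + integral {a..t} f"
    and G: "\<And>t. t \<in> {a..b} \<Longrightarrow> (G has_real_derivative G' (X t)) (at (X t))"
    and G': "continuous_on (X ` {a..b}) G'"
  shows "(\<lambda>s. G' (X s) * f s) absolutely_integrable_on {a..b}"
    and "G (X b) - G (X a) = integral {a..b} (\<lambda>s. G' (X s) * f s)"
proof -
  have fi: "f integrable_on {a..b}" using f by (rule absolutely_integrable_on_def[THEN iffD1, THEN conjunct1])
  have contX: "continuous_on {a..b} X"
  proof -
    have "continuous_on {a..b} (\<lambda>t. X a + integral {a..t} f)"
      by (intro continuous_intros indefinite_integral_continuous_1 fi)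
    then show ?thesis using X by (metis (no_types, lifting) continuous_on_cong)
  qed
  have contGX: "continuous_on {a..b} (\<lambda>s. G' (X s))"
    using continuous_on_compose2[OF G' contX] by auto
  show ai: "(\<lambda>s. G' (X s) * f s) absolutely_integrable_on {a..b}"
  proof -
    have "bounded ((\<lambda>s. G' (X s)) ` {a..b})"
      by (simp add: compact_continuous_image compact_imp_bounded contGX)
    moreover have "(\<lambda>s. G' (X s)) \<in> borel_measurable (lebesgue_on {a..b})"
      using contGX by (simp add: continuous_imp_measurable_on_sets_lebesgue)
    ultimately show ?thesis
      using absolutely_integrable_bounded_measurable_product_real[OF _ _ _ f] by simp
  qed
  define H where "H = (\<lambda>s. G' (X s) * f s)"
  have Hi: "H integrable_on {a..b}" using ai H_def absolutely_integrable_on_def by blast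
  have absf: "(\<lambda>s. \<bar>f s\<bar>) integrable_on {a..b}" using f absolutely_integrable_on_def by (metis (mono_tags, lifting) integrable_eq real_norm_def)
  have sub: "g integrable_on {s..t}" if "g integrable_on {a..b}" "a \<le> s" "t \<le> b" for g :: "real \<Rightarrow> real" and s t
    using that integrable_on_subinterval by (metis atLeastatMost_subset_iff)
  have comb: "integral {a..s} g + integral {s..t} g = integral {a..t} g"
    if "g integrable_on {a..b}" "a \<le> s" "s \<le> t" "t \<le> b" for g :: "real \<Rightarrow> real" and s t
    using that by (intro Henstock_Kurzweil_Integration.integral_combine sub[OF that(1)]) auto
  \<comment> \<open>The error is measured against \<open>e\<close> times the integral of
    \<open>|f|\<close>, a bound that is additive in the interval. It therefore suffices to check it
    on short intervals, and bisection (\<open>Bolzano\<close>) takes the place of differentiation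
    almost everywhere.\<close>
  have main: "\<bar>(G (X b) - integral {a..b} H) - (G (X a) - integral {a..a} H)\<bar> \<le> e * integral {a..b} (\<lambda>s. \<bar>f s\<bar>)" if e: "e > 0" for e
  proof -
    define P where "P = (\<lambda>s t. a \<le> s \<longrightarrow> s \<le> t \<longrightarrow> t \<le> b \<longrightarrow> \<bar>(G (X t) - integral {a..t} H) - (G (X s) - integral {a..s} H)\<bar> \<le> e * integral {s..t} (\<lambda>s. \<bar>f s\<bar>))"
    have "P a b"
    proof (induction rule: Bolzano[OF ab])
      case (1 s t u)
      show ?case unfolding P_def
      proof (intro impI)
        assume h: "a \<le> s" "s \<le> u" "u \<le> b"
        have "integral {s..t} (\<lambda>s. \<bar>f s\<bar>) + integral {t..u} (\<lambda>s. \<bar>f s\<bar>) = integral {s..u} (\<lambda>s. \<bar>f s\<bar>)"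
          using h 1 by (intro Henstock_Kurzweil_Integration.integral_combine sub[OF absf]) auto
        moreover have "\<bar>(G (X t) - integral {a..t} H) - (G (X s) - integral {a..s} H)\<bar> \<le> e * integral {s..t} (\<lambda>s. \<bar>f s\<bar>)"
          "\<bar>(G (X u) - integral {a..u} H) - (G (X t) - integral {a..t} H)\<bar> \<le> e * integral {t..u} (\<lambda>s. \<bar>f s\<bar>)"
          using 1 h unfolding P_def by auto
        ultimately show "\<bar>(G (X u) - integral {a..u} H) - (G (X s) - integral {a..s} H)\<bar> \<le> e * integral {s..u} (\<lambda>s. \<bar>f s\<bar>)"
          by (smt (verit, best) distrib_left)
      qed
    next
      case (2 x)
      then obtain d where d: "d > 0" "\<And>y. y \<in> {a..b} \<Longrightarrow> \<bar>y - x\<bar> < d \<Longrightarrow> \<bar>G' (X y) - G' (X x)\<bar> < e/2"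
        using contGX e unfolding continuous_on_iff dist_real_def by (metis atLeastAtMost_iff half_gt_zero)
      have "P s t" if st: "s \<le> x" "x \<le> t" "t - s < d" for s t
        unfolding P_def
      proof (intro impI)
        assume h: "a \<le> s" "s \<le> t" "t \<le> b"
        have close: "\<bar>G' (X y) - G' (X z)\<bar> \<le> e" if "y \<in> {s..t}" "z \<in> {s..t}" for y z
        proof -
          have "\<bar>G' (X y) - G' (X x)\<bar> < e/2" "\<bar>G' (X z) - G' (X x)\<bar> < e/2"
            using that st h d(2)[of y] d(2)[of z] by auto
          then show ?thesis by linarith
        qed
        \<comment> \<open>\<open>X\<close> need not be monotone: the mean value theorem is applied
          between the values \<open>X s\<close> and \<open>X t\<close>, and connectedness of the
          image pulls the intermediate value back to a time \<open>r\<close>.\<close>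
        have "\<exists>r\<in>{s..t}. G (X t) - G (X s) = (X t - X s) * G' (X r)"
        proof -
          have img: "\<exists>r\<in>{s..t}. y = X r" if "min (X s) (X t) \<le> y" "y \<le> max (X s) (X t)" for y
          proof -
            have c: "continuous_on {s..t} X" using contX h continuous_on_subset by (metis atLeastatMost_subset_iff)
            have "connected (X ` {s..t})" using c by (simp add: connected_continuous_image)
            moreover have "X s \<in> X ` {s..t}" "X t \<in> X ` {s..t}" using h by auto
            ultimately have "y \<in> X ` {s..t}"
              using that unfolding connected_iff_interval by (metis max_def min_def)
            then show ?thesis by auto
          qed
          have gd: "(G has_real_derivative G' y) (at y)" if "min (X s) (X t) \<le> y" "y \<le> max (X s) (X t)" for y
            using img[OF that] G h by auto
          consider "X s < X t" | "X t < X s" | "X s = X t" by linarith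
          then show ?thesis
          proof cases
            case 1
            then obtain y where y: "X s < y" "y < X t" "G (X t) - G (X s) = (X t - X s) * G' y"
              using MVT2[OF 1, of G G'] gd by auto
            then show ?thesis using img[of y] by auto
          next
            case 2
            then obtain y where y: "X t < y" "y < X s" "G (X s) - G (X t) = (X s - X t) * G' y"
              using MVT2[OF 2, of G G'] gd by auto
            then obtain r where "r \<in> {s..t}" "y = X r" using img[of y] by auto
            then show ?thesis using y by (intro bexI[of _ r]) (auto simp: algebra_simps)
          next
            case 3
            then show ?thesis using h by auto
          qed
        qed
        then obtain r where r: "r \<in> {s..t}" "G (X t) - G (X s) = (X t - X s) * G' (X r)" by auto
        have "X t - X s = integral {s..t} f" using comb[OF fi h] X[of s] X[of t] h by auto
        then have "(G (X t) - integral {a..t} H) - (G (X s) - integral {a..s} H) = integral {s..t} f * G' (X r) - integral {s..t} H"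
          using r comb[OF Hi h] by (auto simp: algebra_simps)
        also have "\<dots> = integral {s..t} (\<lambda>u. f u * G' (X r) - H u)"
          using h sub fi Hi by (subst integral_diff) (auto intro: integrable_on_mult_left)
        finally have eq: "(G (X t) - integral {a..t} H) - (G (X s) - integral {a..s} H) = integral {s..t} (\<lambda>u. f u * G' (X r) - H u)" .
        have "norm (integral {s..t} (\<lambda>u. f u * G' (X r) - H u)) \<le> integral {s..t} (\<lambda>u. e * \<bar>f u\<bar>)"
        proof (rule integral_norm_bound_integral)
          show "(\<lambda>u. f u * G' (X r) - H u) integrable_on {s..t}"
            using h sub fi Hi by (intro integrable_diff integrable_on_mult_left) auto
          show "(\<lambda>u. e * \<bar>f u\<bar>) integrable_on {s..t}"
            using h sub absf by (intro integrable_on_mult_right) auto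
          fix u assume u: "u \<in> {s..t}"
          have "f u * G' (X r) - H u = (G' (X r) - G' (X u)) * f u" by (simp add: H_def algebra_simps)
          then show "norm (f u * G' (X r) - H u) \<le> e * \<bar>f u\<bar>"
            using close[OF r(1) u] by (simp add: abs_mult mult_right_mono)
        qed
        then show "\<bar>(G (X t) - integral {a..t} H) - (G (X s) - integral {a..s} H)\<bar> \<le> e * integral {s..t} (\<lambda>s. \<bar>f s\<bar>)"
          unfolding eq by simp
      qed
      then show ?case using d(1) by auto
    qed
    then show ?thesis unfolding P_def using ab by auto
  qed
  define J where "J = integral {a..b} (\<lambda>s. \<bar>f s\<bar>)"
  have J: "J \<ge> 0" unfolding J_def by (intro integral_nonneg absf) auto
  have "\<bar>(G (X b) - integral {a..b} H) - G (X a)\<bar> \<le> 0 + e" if "e > 0" for e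
  proof -
    have "\<bar>(G (X b) - integral {a..b} H) - G (X a)\<bar> \<le> (e/(J+1)) * J"
      using main[of "e/(J+1)"] that J unfolding J_def[symmetric] by auto
    also have "\<dots> \<le> e" using J that by (simp add: field_simps)
    finally show ?thesis by simp
  qed
  then have "\<bar>(G (X b) - integral {a..b} H) - G (X a)\<bar> \<le> 0" by (rule field_le_epsilon)
  then show "G (X b) - G (X a) = integral {a..b} (\<lambda>s. G' (X s) * f s)" by (auto simp: H_def)
qed

lemma integral_initial_segment:
  fixes f :: "real \<Rightarrow> real"
  assumes "f integrable_on {a..b}" "a \<le> s" "s \<le> t" "t \<le> b"
  shows "integral {a..t} f - integral {a..s} f = integral {s..t} f"
proof -
  have "f integrable_on {a..t}" using assms integrable_on_subinterval by (metis atLeastatMost_subset_iff order_refl)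
  from Henstock_Kurzweil_Integration.integral_combine[OF assms(2,3) this] show ?thesis by simp
qed

text \<open>The common form of all Osgood and Gronwall arguments below: \<open>G\<close> is chosen
  so that \<open>1 / |G'|\<close> matches the bound on the speed of \<open>X\<close>. The conclusion
  is symmetric in time.\<close>

lemma chain_rule_variation:
  fixes f X G G' c :: "real \<Rightarrow> real"
  assumes f: "f absolutely_integrable_on {a..b}"
    and X: "\<And>t. t \<in> {a..b} \<Longrightarrow> X t = X a + integral {a..t} f"
    and G: "\<And>t. t \<in> {a..b} \<Longrightarrow> (G has_real_derivative G' (X t)) (at (X t))"
    and G': "continuous_on (X ` {a..b}) G'"
    and c: "c absolutely_integrable_on {a..b}"
    and le: "\<And>t. t \<in> {a..b} \<Longrightarrow> \<bar>G' (X t) * f t\<bar> \<le> c t"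
    and st: "a \<le> s" "s \<le> t" "t \<le> b"
  shows "\<bar>G (X t) - G (X s)\<bar> \<le> integral {s..t} c"
proof -
  have sub: "{s..t} \<subseteq> {a..b}" using st by auto
  have f': "f absolutely_integrable_on {s..t}" using f sub absolutely_integrable_on_subinterval by blast
  have c': "c absolutely_integrable_on {s..t}" using c sub absolutely_integrable_on_subinterval by blast
  have fi: "f integrable_on {a..b}" using f absolutely_integrable_on_def by blast
  have X': "X u = X s + integral {s..u} f" if "u \<in> {s..t}" for u
    using X[of u] X[of s] that st integral_initial_segment[OF fi, of s u] by auto
  note ch = integrable_chain_rule[of s t f X G G', OF st(2) f' X' G continuous_on_subset[OF G']]
  have "G (X t) - G (X s) = integral {s..t} (\<lambda>s. G' (X s) * f s)"
    using sub by (intro ch) auto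
  moreover have "(\<lambda>s. G' (X s) * f s) absolutely_integrable_on {s..t}"
    using sub by (intro ch) auto
  then have "norm (integral {s..t} (\<lambda>s. G' (X s) * f s)) \<le> integral {s..t} c"
    using c' le sub by (intro integral_norm_bound_integral) (auto simp: absolutely_integrable_on_def)
  ultimately show ?thesis by simp
qed

section \<open>Osgood's argument near zero and at infinity\<close>

lemma entropy_modulus_mono:
  fixes r s K :: real
  assumes "0 < r" "r \<le> s" "s \<le> K"
  shows "r * (1 + ln (K / r)) \<le> s * (1 + ln (K / s))"
proof -
  have s: "0 < s" "0 < K" using assms by auto
  have "ln (K / r) = ln (K / s) + ln (s / r)"
    using assms s by (simp add: ln_div)
  moreover have "ln (s / r) \<le> s / r - 1" using assms s by (intro ln_le_minus_one) auto
  then have "r * ln (s / r) \<le> s - r" using assms by (simp add: field_simps)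
  moreover have "0 \<le> (s - r) * ln (K / s)" using assms s by (intro mult_nonneg_nonneg) auto
  ultimately show ?thesis by (simp add: algebra_simps)
qed

text \<open>The derivative of \<open>s * (1 + ln (K / s^2))\<close> is
  \<open>ln (K / s^2) - 1\<close>, which is nonnegative as long as \<open>K / s^2\<close> is at
  least Euler's number; 3 is a convenient upper bound for it.\<close>

lemma log_lipschitz_modulus_mono:
  fixes r s K :: real
  assumes "0 \<le> r" "r \<le> s" "3 * s^2 \<le> K"
  shows "r * (1 + ln (K / r^2)) \<le> s * (1 + ln (K / s^2))"
proof (cases "r = 0")
  case True
  have "0 \<le> s * (1 + ln (K / s^2))"
  proof (cases "s = 0")
    case False
    then have "s > 0" using assms True by auto
    moreover have "K / s^2 \<ge> 3" using assms \<open>s > 0\<close> by (simp add: field_simps)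
    then have "ln (K / s^2) \<ge> 0" by (intro ln_ge_zero) auto
    ultimately show ?thesis by auto
  qed auto
  then show ?thesis using True by simp
next
  case False
  then have r: "0 < r" "0 < s" using assms by auto
  then have K: "0 < K" using assms(3) by (smt (verit) zero_less_power)
  have "ln (K / r^2) = ln (K / s^2) + 2 * ln (s / r)"
    using r K by (simp add: ln_div ln_realpow)
  moreover have "ln (s / r) \<le> s / r - 1" using r by (intro ln_le_minus_one) auto
  then have "r * ln (s / r) \<le> s - r" using r by (simp add: field_simps)
  moreover have "(s - r) * 1 \<le> (s - r) * ln (K / s^2)"
  proof (rule mult_left_mono)
    have "K / s^2 \<ge> 3" using assms r by (simp add: field_simps)
    moreover have "exp 1 < (3::real)" by (rule e_less_272[THEN order.strict_trans]) simp
    ultimately have "exp 1 \<le> K / s^2" by simp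
    then show "1 \<le> ln (K / s^2)" using ln_ge_iff r K by auto
  qed (use assms in auto)
  ultimately show ?thesis by (simp add: algebra_simps)
qed

text \<open>As \<open>e \<rightarrow> 0\<close> the function \<open>ln (1 + ln (K / (D\<^sup>2 + e)))\<close> stays bounded where \<open>D \<noteq> 0\<close> and diverges
  where \<open>D = 0\<close>, while its variation is at most \<open>2 \<integral>a\<close> for every \<open>e\<close>.\<close>

lemma osgood_unique_zero:
  fixes D h a :: "real \<Rightarrow> real"
  assumes h: "h absolutely_integrable_on {0..T}" and a: "a absolutely_integrable_on {0..T}"
    and D: "\<And>t. t \<in> {0..T} \<Longrightarrow> D t = D 0 + integral {0..t} h"
    and le: "\<And>t. t \<in> {0..T} \<Longrightarrow> \<bar>h t\<bar> \<le> a t * (\<bar>D t\<bar> * (1 + ln (K / (D t)^2)))"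
    and a0: "\<And>t. t \<in> {0..T} \<Longrightarrow> 0 \<le> a t"
    and K: "\<And>t. t \<in> {0..T} \<Longrightarrow> (D t)^2 + 1 \<le> K"
    and s: "s \<in> {0..T}" "D s = 0" and t: "t \<in> {0..T}"
  shows "D t = 0"
proof (rule ccontr)
  assume nz: "D t \<noteq> 0"
  define M where "M = 2 * integral {0..T} a"
  define L where "L = ln (1 + ln (K / (D t)^2))"
  \<comment> \<open>With this \<open>e\<close> the value \<open>G 0\<close> of the function below
    exceeds \<open>M + L\<close>, where \<open>M\<close> bounds the variation of \<open>G\<close>
    along \<open>D\<close> and \<open>L\<close> bounds \<open>G (D t)\<close>; the cap at 1 keeps
    \<open>y^2 + e\<close> below \<open>K\<close> on the range of \<open>D\<close>.\<close>
  define e where "e = min 1 (K * exp (- exp (M + L)))"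
  have K1: "K \<ge> 1" using K[OF s(1)] s(2) by simp
  have e: "0 < e" "e \<le> 1" using K1 unfolding e_def by auto
  define G where "G = (\<lambda>y. ln (1 + ln (K / (y^2 + e))))"
  define G' where "G' = (\<lambda>y. - (2 * y / ((y^2 + e) * (1 + ln (K / (y^2 + e))))))"
  have ai: "(\<lambda>t. 2 * a t) absolutely_integrable_on {0..T}" using a by auto
  have aint: "a integrable_on {0..T}" using a absolutely_integrable_on_def by blast
  have pos: "0 < y^2 + e" "0 \<le> ln (K / (y^2 + e))" if "y^2 + 1 \<le> K" for y :: real
  proof -
    show p: "0 < y^2 + e" using e by (simp add: add_nonneg_pos)
    have "1 \<le> K / (y^2 + e)" using p that e by (simp add: field_simps)
    then show "0 \<le> ln (K / (y^2 + e))" by simp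
  qed
  have dG: "(G has_real_derivative G' y) (at y)" if "y^2 + 1 \<le> K" for y
  proof -
    have L: "0 < 1 + ln (K / (y^2 + e))" using pos(2)[OF that] by linarith
    have q: "0 < K / (y^2 + e)" using pos(1)[OF that] K1 by simp
    have "((\<lambda>y. K / (y^2 + e)) has_real_derivative - (K * (2 * y)) / (y^2 + e)^2) (at y)"
      using pos(1)[OF that] by (auto intro!: derivative_eq_intros simp: power2_eq_square)
    from DERIV_add[OF DERIV_const[of 1] DERIV_chain2[OF DERIV_ln[OF q] this]]
    have "((\<lambda>y. 1 + ln (K / (y^2 + e))) has_real_derivative inverse (K / (y^2 + e)) * (- (K * (2 * y)) / (y^2 + e)^2)) (at y)"
      by (simp only: add_0)
    moreover have "inverse (K / (y^2 + e)) * (- (K * (2 * y)) / (y^2 + e)^2) = - (2 * y / (y^2 + e))"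
      using pos(1)[OF that] K1 by (simp add: power2_eq_square[of "y^2 + e"])
    ultimately have "((\<lambda>y. 1 + ln (K / (y^2 + e))) has_real_derivative - (2 * y / (y^2 + e))) (at y)"
      by simp
    from DERIV_chain2[OF DERIV_ln[OF L] this] show ?thesis unfolding G_def G'_def
      by (simp add: divide_simps mult.commute)
  qed
  have cG: "continuous_on (D ` {0..T}) G'"
    unfolding G'_def
  proof (intro continuous_intros ballI)
    fix y assume "y \<in> D ` {0..T}"
    then have "y^2 + 1 \<le> K" using K by auto
    note p = pos[OF this]
    show "y\<^sup>2 + e \<noteq> 0" "K / (y\<^sup>2 + e) \<noteq> 0" using p K1 by auto
    show "(y\<^sup>2 + e) * (1 + ln (K / (y\<^sup>2 + e))) \<noteq> 0" using p by auto
  qed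
  have bound: "\<bar>G' (D u) * h u\<bar> \<le> 2 * a u" if u: "u \<in> {0..T}" for u
  proof (cases "D u = 0")
    case True then show ?thesis using a0[OF u] by (simp add: G'_def)
  next
    case False
    define y where "y = D u"
    have yK: "y^2 + 1 \<le> K" using K[OF u] y_def by simp
    note p = pos[OF yK]
    define Q where "Q = (y^2 + e) * (1 + ln (K / (y^2 + e)))"
    have Q: "Q > 0" using p Q_def by simp
    \<comment> \<open>The numerator \<open>2 * y\<close> of \<open>G'\<close> supplies a second
      factor \<open>|y|\<close> to the log-Lipschitz modulus, which turns it into the entropy
      modulus at \<open>y^2\<close>; monotonicity of the latter absorbs the regularisation
      \<open>e\<close>.\<close>
    have "y^2 * (1 + ln (K / y^2)) \<le> Q"
      unfolding Q_def using False yK e by (intro entropy_modulus_mono) (auto simp: y_def)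
    moreover have "\<bar>y\<bar> * (\<bar>y\<bar> * (1 + ln (K / y^2))) = y^2 * (1 + ln (K / y^2))"
      by (simp only: power2_eq_square mult.assoc[symmetric] abs_mult_self_eq)
    ultimately have "\<bar>y\<bar> * (\<bar>y\<bar> * (1 + ln (K / y^2))) \<le> Q" by (simp only:)
    then have "a u * (\<bar>y\<bar> * (\<bar>y\<bar> * (1 + ln (K / y^2)))) \<le> a u * Q"
      using a0[OF u] by (rule mult_left_mono)
    moreover have "\<bar>y\<bar> * \<bar>h u\<bar> \<le> \<bar>y\<bar> * (a u * (\<bar>y\<bar> * (1 + ln (K / y^2))))"
      using le[OF u] by (intro mult_left_mono) (auto simp: y_def)
    ultimately have "\<bar>y\<bar> * \<bar>h u\<bar> \<le> a u * Q" by (simp add: mult.left_commute)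
    then have "2 * \<bar>y\<bar> * \<bar>h u\<bar> / Q \<le> 2 * a u" using Q by (simp add: field_simps)
    moreover have "\<bar>G' (D u) * h u\<bar> = 2 * \<bar>y\<bar> * \<bar>h u\<bar> / Q"
      using Q unfolding G'_def y_def[symmetric] Q_def[symmetric] by (simp add: abs_mult)
    ultimately show ?thesis by simp
  qed
  have var: "\<bar>G (D q) - G (D p)\<bar> \<le> M" if "0 \<le> p" "p \<le> q" "q \<le> T" for p q
  proof -
    have "\<bar>G (D q) - G (D p)\<bar> \<le> integral {p..q} (\<lambda>t. 2 * a t)"
      using chain_rule_variation[of 0 T h D G G', OF h D dG cG ai bound that] K by blast
    also have "\<dots> \<le> integral {0..T} (\<lambda>t. 2 * a t)"
      using that a0 aint integrable_on_subinterval[OF aint, of p q]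
      by (intro integral_subset_le) (auto intro: integrable_on_mult_right)
    also have "\<dots> = M" by (simp add: M_def)
    finally show ?thesis .
  qed
  have "\<bar>G (D s) - G (D t)\<bar> \<le> M"
    using var[of s t] var[of t s] s t by (cases "s \<le> t") (auto simp: abs_minus_commute)
  then have "G 0 \<le> M + G (D t)" using s by auto
  moreover have "G (D t) \<le> L"
  proof -
    have "(D t)^2 > 0" using nz by simp
    moreover have "(D t)^2 + e \<le> K" using K[OF t] e by auto
    moreover from this have p: "0 < (D t)^2 + e" using calculation e by (intro add_pos_pos) auto
    ultimately have "K / ((D t)^2 + e) \<le> K / (D t)^2"
      using e K1 by (intro divide_left_mono mult_pos_pos) auto
    moreover have "0 < K / ((D t)^2 + e)" using p K1 by simp
    ultimately
    have "ln (K / ((D t)^2 + e)) \<le> ln (K / (D t)^2)" "0 \<le> ln (K / ((D t)^2 + e))"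
      using pos(2)[OF K[OF t]] by (auto intro!: ln_mono)
    then show ?thesis unfolding G_def L_def by auto
  qed
  ultimately have "ln (1 + ln (K / e)) \<le> M + L" by (simp add: G_def)
  moreover have "exp (M + L) \<le> ln (K / e)"
  proof -
    have "e \<le> K * exp (- exp (M + L))" by (simp add: e_def)
    then have "exp (exp (M + L)) \<le> K / e" using e by (simp add: field_simps exp_minus)
    then show ?thesis using e K1 by (simp add: ln_ge_iff)
  qed
  ultimately have "ln (1 + exp (M + L)) \<le> M + L"
    by (smt (verit) exp_gt_zero ln_le_cancel_iff)
  then have "1 + exp (M + L) \<le> exp (M + L)"
    by (smt (verit) exp_gt_zero exp_le_cancel_iff exp_ln)
  then show False by simp
qed

text \<open>Osgood's criterion at infinity: \<open>ln (1 + ln (1 + y^2))\<close> varies by a bounded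
  amount along a curve whose speed grows like \<open>|y| ln |y|\<close>, and the double exponential
  inverts it. The 3 comes from \<open>2 * |y| * (1 + |y|) <= 3 * (1 + y^2)\<close>.\<close>

lemma log_growth_bound:
  fixes X h a :: "real \<Rightarrow> real"
  assumes h: "h absolutely_integrable_on {0..T}" and a: "a absolutely_integrable_on {0..T}"
    and X: "\<And>t. t \<in> {0..T} \<Longrightarrow> X t = X 0 + integral {0..t} h"
    and le: "\<And>t. t \<in> {0..T} \<Longrightarrow> \<bar>h t\<bar> \<le> a t * ((1 + \<bar>X t\<bar>) * (1 + ln (1 + (X t)^2)))"
    and a0: "\<And>t. t \<in> {0..T} \<Longrightarrow> 0 \<le> a t"
    and t: "t \<in> {0..T}"
  shows "(X t)^2 \<le> exp (exp (ln (1 + ln (1 + (X 0)^2)) + 3 * integral {0..T} a))"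
proof -
  define G where "G = (\<lambda>y::real. ln (1 + ln (1 + y^2)))"
  define G' where "G' = (\<lambda>y::real. 2 * y / ((1 + y^2) * (1 + ln (1 + y^2))))"
  have ai: "(\<lambda>t. 3 * a t) absolutely_integrable_on {0..T}" using a by auto
  have aint: "a integrable_on {0..T}" using a absolutely_integrable_on_def by blast
  have pos: "0 < 1 + y^2" "0 \<le> ln (1 + y^2)" for y :: real
    by (auto simp: add_pos_nonneg)
  have dG: "(G has_real_derivative G' y) (at y)" for y
  proof -
    have "0 < 1 + ln (1 + y^2)" using pos[of y] by linarith
    then show ?thesis unfolding G_def G'_def using pos[of y]
      by (auto intro!: derivative_eq_intros simp: field_simps power2_eq_square)
  qed
  have cG: "continuous_on (X ` {0..T}) G'"
    unfolding G'_def
  proof (intro continuous_intros ballI)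
    fix y :: real
    note p = pos[of y]
    show "1 + y\<^sup>2 \<noteq> 0" using p by auto
    show "(1 + y\<^sup>2) * (1 + ln (1 + y\<^sup>2)) \<noteq> 0" using p by (smt (verit) mult_eq_0_iff)
  qed
  have bound: "\<bar>G' (X u) * h u\<bar> \<le> 3 * a u" if u: "u \<in> {0..T}" for u
  proof -
    define y where "y = X u"
    define l where "l = 1 + ln (1 + y^2)"
    have l: "l > 0" using pos(2)[of y] unfolding l_def by linarith
    have "2 * \<bar>y\<bar> * (1 + \<bar>y\<bar>) \<le> 3 * (1 + y^2)"
    proof -
      have "2 * \<bar>y\<bar> * \<bar>y\<bar> = 2 * y^2" by (simp add: power2_eq_square)
      moreover have "2 * \<bar>y\<bar> \<le> 1 + y^2" using zero_le_power2[of "\<bar>y\<bar> - 1"] by (simp add: power2_diff)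
      ultimately show ?thesis using zero_le_power2[of y] by (simp add: algebra_simps)
    qed
    then have "a u * l * (2 * \<bar>y\<bar> * (1 + \<bar>y\<bar>)) \<le> a u * l * (3 * (1 + y^2))"
      using a0[OF u] l by (intro mult_left_mono) auto
    moreover have "2 * \<bar>y\<bar> * \<bar>h u\<bar> \<le> 2 * \<bar>y\<bar> * (a u * ((1 + \<bar>y\<bar>) * l))"
      using le[OF u] by (intro mult_left_mono) (auto simp: y_def l_def)
    ultimately have "2 * \<bar>y\<bar> * \<bar>h u\<bar> \<le> 3 * a u * ((1 + y^2) * l)" by (simp add: algebra_simps)
    then have "2 * \<bar>y\<bar> * \<bar>h u\<bar> / ((1 + y^2) * l) \<le> 3 * a u" using l pos(1)[of y] by (simp add: pos_divide_le_eq)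
    moreover have "\<bar>G' (X u) * h u\<bar> = 2 * \<bar>y\<bar> * \<bar>h u\<bar> / ((1 + y^2) * l)"
      using l pos(1)[of y] unfolding G'_def y_def[symmetric] l_def[symmetric] by (simp add: abs_mult)
    ultimately show ?thesis by simp
  qed
  have "\<bar>G (X t) - G (X 0)\<bar> \<le> integral {0..t} (\<lambda>t. 3 * a t)"
    using chain_rule_variation[of 0 T h X G G', OF h X dG cG ai bound, of 0 t] t by auto
  also have "\<dots> \<le> integral {0..T} (\<lambda>t. 3 * a t)"
    using t a0 aint integrable_on_subinterval[OF aint, of 0 t]
    by (intro integral_subset_le) (auto intro: integrable_on_mult_right)
  finally have "G (X t) \<le> G (X 0) + 3 * integral {0..T} a" by simp
  then have "exp (G (X t)) \<le> exp (G (X 0) + 3 * integral {0..T} a)" by simp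
  moreover have "exp (G (X t)) = 1 + ln (1 + (X t)^2)"
    unfolding G_def using pos(2)[of "X t"] by (intro exp_ln) linarith
  ultimately have "1 + ln (1 + (X t)^2) \<le> exp (G (X 0) + 3 * integral {0..T} a)" by simp
  then have "ln (1 + (X t)^2) \<le> exp (G (X 0) + 3 * integral {0..T} a)" by simp
  then have "1 + (X t)^2 \<le> exp (exp (G (X 0) + 3 * integral {0..T} a))"
    using pos(1)[of "X t"] by (metis exp_le_cancel_iff exp_ln)
  then show ?thesis by (simp add: G_def)
qed

section \<open>The John--Nirenberg inequality and its entropy dual\<close>

text \<open>The dyadic martingale of difference quotients of \<open>v\<close>. It is built from
  increments alone, so it serves both the velocity, whose derivative is given, and the flow, whose
  derivative is still to be found.\<close>

fun dyadic_slope :: "nat \<Rightarrow> (real \<Rightarrow> real) \<Rightarrow> real \<Rightarrow> real \<Rightarrow> real \<Rightarrow> real" where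
  "dyadic_slope 0 v p q x = (v q - v p) / (q - p)"
| "dyadic_slope (Suc n) v p q x =
     (if x < (p + q) / 2 then dyadic_slope n v p ((p + q) / 2) x else dyadic_slope n v ((p + q) / 2) q x)"

text \<open>The integral of \<open>G\<close> applied to the slopes of level \<open>n\<close>, by
  recursion, so that exponential moments are finite sums and John--Nirenberg becomes an induction on
  the depth.\<close>

fun dyadic_sum :: "nat \<Rightarrow> (real \<Rightarrow> real) \<Rightarrow> (real \<Rightarrow> real) \<Rightarrow> real \<Rightarrow> real \<Rightarrow> real" where
  "dyadic_sum 0 G v p q = (q - p) * G ((v q - v p) / (q - p))"
| "dyadic_sum (Suc n) G v p q = dyadic_sum n G v p ((p + q) / 2) + dyadic_sum n G v ((p + q) / 2) q"

lemma dyadic_slope_measurable [measurable]: "dyadic_slope n v p q \<in> borel_measurable borel"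
proof (induction n arbitrary: p q)
  case (Suc n)
  note [measurable] = Suc
  have "dyadic_slope (Suc n) v p q = (\<lambda>x. if x < (p + q) / 2 then dyadic_slope n v p ((p + q) / 2) x else dyadic_slope n v ((p + q) / 2) q x)"
    by auto
  then show ?case by simp
qed (simp add: borel_measurable_const cong: measurable_cong)

lemma finite_range_dyadic_slope: "finite (range (dyadic_slope n v p q))"
proof (induction n arbitrary: p q)
  case 0
  have "range (dyadic_slope 0 v p q) \<subseteq> {(v q - v p) / (q - p)}" by auto
  then show ?case using finite_subset by blast
next
  case (Suc n)
  have "range (dyadic_slope (Suc n) v p q) \<subseteq> range (dyadic_slope n v p ((p + q) / 2)) \<union> range (dyadic_slope n v ((p + q) / 2) q)"
    by (auto split: if_splits)
  then show ?case using Suc finite_subset by blast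
qed

lemma absolutely_integrable_bounded_borel:
  fixes h :: "real \<Rightarrow> real"
  assumes "h \<in> borel_measurable borel" "finite (range h)"
  shows "h absolutely_integrable_on {p..q}"
proof -
  obtain M where M: "\<And>x. \<bar>h x\<bar> \<le> M" using assms(2)
    by (metis finite_imp_bounded bounded_iff rangeI real_norm_def)
  show ?thesis
  proof (rule measurable_bounded_by_integrable_imp_absolutely_integrable)
    show "h \<in> borel_measurable (lebesgue_on {p..q})"
      using assms(1) by (metis borel_measurable_if_D measurable_completion measurable_lborel2 measurable_restrict_space1)
    show "(\<lambda>x. M) integrable_on {p..q}" by (rule integrable_const_ivl)
  qed (use M in auto)
qed

lemma dyadic_slope_absolutely_integrable:
  fixes G :: "real \<Rightarrow> real"
  assumes "G \<in> borel_measurable borel"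
  shows "(\<lambda>x. G (dyadic_slope n v p q x)) absolutely_integrable_on {a..b}"
proof (rule absolutely_integrable_bounded_borel)
  show "finite (range (\<lambda>x. G (dyadic_slope n v p q x)))"
    using finite_range_dyadic_slope[of n v p q] by (metis finite_imageI image_image)
qed (use assms in measurable)

lemma has_integral_dyadic_slope:
  assumes "p \<le> q"
  shows "((\<lambda>x. G (dyadic_slope n v p q x)) has_integral dyadic_sum n G v p q) {p..q}"
  using assms
proof (induction n arbitrary: p q)
  case 0
  then show ?case using has_integral_const_real[of "G ((v q - v p) / (q - p))" p q] by (simp add: mult.commute)
next
  case (Suc n)
  let ?m = "(p + q) / 2"
  have m: "p \<le> ?m" "?m \<le> q" using Suc.prems by auto
  have "((\<lambda>x. G (dyadic_slope (Suc n) v p q x)) has_integral dyadic_sum n G v p ?m) {p..?m}"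
    by (rule has_integral_spike_finite[OF _ _ Suc.IH[OF m(1)], of "{?m}"]) auto
  moreover have "((\<lambda>x. G (dyadic_slope (Suc n) v p q x)) has_integral dyadic_sum n G v ?m q) {?m..q}"
    by (rule has_integral_spike_finite[OF _ _ Suc.IH[OF m(2)], of "{}"]) auto
  ultimately show ?case using has_integral_combine[OF m] by simp
qed

lemma dyadic_sum_mono:
  assumes "\<And>y. G y \<le> H y" "p \<le> q"
  shows "dyadic_sum n G v p q \<le> dyadic_sum n H v p q"
  using has_integral_le[OF has_integral_dyadic_slope[OF assms(2)] has_integral_dyadic_slope[OF assms(2)]] assms(1) by blast

lemma dyadic_sum_cmult: "dyadic_sum n (\<lambda>y. k * G y) v p q = k * dyadic_sum n G v p q"
  by (induction n arbitrary: p q) (auto simp: algebra_simps)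

lemma dyadic_sum_id: "p < q \<Longrightarrow> dyadic_sum n (\<lambda>y. y) v p q = v q - v p"
  by (induction n arbitrary: p q) auto

lemma dyadic_sum_nonneg:
  assumes "\<And>y. 0 \<le> G y" "p \<le> q" shows "0 \<le> dyadic_sum n G v p q"
  using has_integral_nonneg[OF has_integral_dyadic_slope[OF assms(2)]] assms(1) by blast

lemma dyadic_sum_jensen_abs:
  "p < q \<Longrightarrow> \<bar>(v q - v p) / (q - p) - c\<bar> * (q - p) \<le> dyadic_sum n (\<lambda>y. \<bar>y - c\<bar>) v p q"
proof (induction n arbitrary: p q)
  case (Suc n)
  let ?m = "(p + q) / 2"
  have m: "p < ?m" "?m < q" using Suc.prems by auto
  have e: "\<bar>(v y - v x) / (y - x) - c\<bar> * (y - x) = \<bar>v y - v x - c * (y - x)\<bar>" if "x < y" for x y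
  proof -
    have "\<bar>(v y - v x) / (y - x) - c\<bar> * (y - x) = \<bar>((v y - v x) / (y - x) - c) * (y - x)\<bar>"
      using that by (simp add: abs_mult)
    also have "((v y - v x) / (y - x) - c) * (y - x) = v y - v x - c * (y - x)"
      unfolding left_diff_distrib[of "(v y - v x) / (y - x)"] using that by simp
    finally show ?thesis .
  qed
  have "\<bar>v ?m - v p - c * (?m - p)\<bar> \<le> dyadic_sum n (\<lambda>y. \<bar>y - c\<bar>) v p ?m"
    "\<bar>v q - v ?m - c * (q - ?m)\<bar> \<le> dyadic_sum n (\<lambda>y. \<bar>y - c\<bar>) v ?m q"
    using Suc.IH[OF m(1)] Suc.IH[OF m(2)] e[OF m(1)] e[OF m(2)] by (simp_all only:)
  moreover have "v q - v p - c * (q - p) = (v ?m - v p - c * (?m - p)) + (v q - v ?m - c * (q - ?m))"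
    by (simp add: field_simps)
  ultimately show ?case unfolding e[OF Suc.prems] dyadic_sum.simps
    using abs_triangle_ineq[of "v ?m - v p - c * (?m - p)" "v q - v ?m - c * (q - ?m)"] by simp
qed auto

text \<open>The primitive of the slopes is the piecewise linear interpolant of \<open>v\<close>,
  exact at the grid points. Hence the error arises in the single cell that contains
  \<open>x\<close>: one \<open>e\<close> from the interpolant and one from \<open>v\<close>.\<close>

lemma interpolation_error:
  assumes "p < q" "x \<in> {p..q}"
    and "\<And>y z. y \<in> {p..q} \<Longrightarrow> z \<in> {p..q} \<Longrightarrow> \<bar>y - z\<bar> \<le> (q - p) / 2 ^ n \<Longrightarrow> \<bar>v y - v z\<bar> \<le> e"
  shows "\<bar>integral {p..x} (dyadic_slope n v p q) - (v x - v p)\<bar> \<le> 2 * e"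
  using assms
proof (induction n arbitrary: p q)
  case 0
  have le: "\<bar>v q - v p\<bar> \<le> e" "\<bar>v x - v p\<bar> \<le> e" using 0 by auto
  have "integral {p..x} (dyadic_slope 0 v p q) = (x - p) / (q - p) * (v q - v p)"
    using 0 by (subst integral_cong[of _ _ "\<lambda>x. (v q - v p) / (q - p)"]) auto
  also have "\<bar>\<dots>\<bar> \<le> 1 * \<bar>v q - v p\<bar>"
    unfolding abs_mult using 0 by (intro mult_right_mono) (auto simp: field_simps)
  finally have "\<bar>integral {p..x} (dyadic_slope 0 v p q)\<bar> \<le> \<bar>v q - v p\<bar>" by simp
  then show ?case using le abs_triangle_ineq4[of "integral {p..x} (dyadic_slope 0 v p q)" "v x - v p"] by linarith
next
  case (Suc n)
  let ?m = "(p + q) / 2"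
  have m: "p < ?m" "?m < q" using Suc.prems by auto
  have len: "(?m - p) / 2 ^ n = (q - p) / (2 * 2 ^ n)" "(q - ?m) / 2 ^ n = (q - p) / (2 * 2 ^ n)"
    by (simp_all add: field_simps)
  have osc: "\<bar>v y - v z\<bar> \<le> e" if "y \<in> {p..q}" "z \<in> {p..q}" "\<bar>y - z\<bar> \<le> (q - p) / (2 * 2 ^ n)" for y z
    using Suc.prems(3) that by simp
  show ?case
  proof (cases "x \<le> ?m")
    case True
    have "integral {p..x} (dyadic_slope (Suc n) v p q) = integral {p..x} (dyadic_slope n v p ?m)"
      by (rule integral_spike[of "{?m}"]) (use True in auto)
    moreover have "\<bar>integral {p..x} (dyadic_slope n v p ?m) - (v x - v p)\<bar> \<le> 2 * e"
      using m True Suc.prems by (intro Suc.IH osc) (auto simp: len)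
    ultimately show ?thesis by (simp only:)
  next
    case False
    have "dyadic_slope (Suc n) v p q integrable_on {p..x}"
      by (rule set_lebesgue_integral_eq_integral(1)[OF dyadic_slope_absolutely_integrable[where G = "\<lambda>x. x", OF measurable_ident_sets[OF refl]]])
    then have "integral {p..x} (dyadic_slope (Suc n) v p q) = integral {p..?m} (dyadic_slope (Suc n) v p q) + integral {?m..x} (dyadic_slope (Suc n) v p q)"
      using False m by (intro Henstock_Kurzweil_Integration.integral_combine[symmetric]) auto
    moreover have "integral {p..?m} (dyadic_slope (Suc n) v p q) = integral {p..?m} (dyadic_slope n v p ?m)"
      by (rule integral_spike[of "{?m}"]) auto
    moreover have "integral {p..?m} (dyadic_slope n v p ?m) = v ?m - v p"
      using has_integral_dyadic_slope[of p ?m "\<lambda>y. y" n v] m dyadic_sum_id[OF m(1)] by (auto simp: integral_unique)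
    moreover have "integral {?m..x} (dyadic_slope (Suc n) v p q) = integral {?m..x} (dyadic_slope n v ?m q)"
      by (rule integral_spike[of "{}"]) auto
    moreover have "\<bar>integral {?m..x} (dyadic_slope n v ?m q) - (v x - v ?m)\<bar> \<le> 2 * e"
      using m False Suc.prems by (intro Suc.IH osc) (auto simp: len)
    moreover from calculation
    have "integral {p..x} (dyadic_slope (Suc n) v p q) - (v x - v p) = integral {?m..x} (dyadic_slope n v ?m q) - (v x - v ?m)"
      by linarith
    ultimately show ?thesis by (simp only:)
  qed
qed

lemma interpolation_tendsto:
  assumes "p < q" "x \<in> {p..q}" and cont: "continuous_on {p..q} v"
  shows "(\<lambda>n. integral {p..x} (dyadic_slope n v p q)) \<longlonglongrightarrow> v x - v p"
proof (rule LIMSEQ_I)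
  fix r :: real assume r: "0 < r"
  have "uniformly_continuous_on {p..q} v" using cont by (simp add: compact_uniformly_continuous)
  then obtain d where d: "d > 0" "\<And>y z. y \<in> {p..q} \<Longrightarrow> z \<in> {p..q} \<Longrightarrow> \<bar>y - z\<bar> < d \<Longrightarrow> \<bar>v y - v z\<bar> < r/3"
    using r unfolding uniformly_continuous_on_def dist_real_def by (metis zero_less_divide_iff zero_less_numeral)
  have "(\<lambda>n. (q - p) / 2 ^ n) \<longlonglongrightarrow> 0" by (rule LIMSEQ_divide_realpow_zero) simp
  then obtain k where k: "\<And>n. n \<ge> k \<Longrightarrow> (q - p) / 2 ^ n < d"
    using d(1) assms(1) order_tendstoD(2)[of _ 0 sequentially d] by (auto simp: eventually_sequentially)
  show "\<exists>k. \<forall>n\<ge>k. norm (integral {p..x} (dyadic_slope n v p q) - (v x - v p)) < r"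
  proof (intro exI allI impI)
    fix n assume "n \<ge> k"
    have "\<bar>integral {p..x} (dyadic_slope n v p q) - (v x - v p)\<bar> \<le> 2 * (r/3)"
      using assms(1,2)
    proof (rule interpolation_error)
      fix y z assume "y \<in> {p..q}" "z \<in> {p..q}" "\<bar>y - z\<bar> \<le> (q - p) / 2 ^ n"
      then show "\<bar>v y - v z\<bar> \<le> r/3" using d(2)[of y z] k[OF \<open>n \<ge> k\<close>] by linarith
    qed
    then show "norm (integral {p..x} (dyadic_slope n v p q) - (v x - v p)) < r" using r by simp
  qed
qed

text \<open>A single time, with \<open>v\<close> a primitive of \<open>f\<close> and
  \<open>N\<close> a bound for its seminorm. \<open>N\<close> is strictly positive because it
  divides the exponent; a vanishing seminorm is reached later by shifting \<open>N\<close> and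
  letting the shift tend to 0.\<close>

locale bmo_slice =
  fixes f v :: "real \<Rightarrow> real" and N :: real
  assumes f_int: "\<And>p q. f absolutely_integrable_on {p..q}"
    and v_diff: "\<And>p q. p \<le> q \<Longrightarrow> v q - v p = integral {p..q} f"
    and N_pos: "0 < N"
    and bmo: "\<And>p q. p < q \<Longrightarrow> integral {p..q} (\<lambda>x. \<bar>f x - (v q - v p) / (q - p)\<bar>) \<le> N * (q - p)"
begin

lemma f_diff_integrable: "(\<lambda>x. f x - c) integrable_on {p..q}" "(\<lambda>x. \<bar>f x - c\<bar>) integrable_on {p..q}"
proof -
  have "(\<lambda>x. f x - c) absolutely_integrable_on {p..q}"
    using f_int by (intro set_integral_diff) auto
  then show "(\<lambda>x. f x - c) integrable_on {p..q}" "(\<lambda>x. \<bar>f x - c\<bar>) integrable_on {p..q}"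
    by (auto simp: absolutely_integrable_on_def)
qed

lemma v_diff': "p \<le> q \<Longrightarrow> v q - v p - c * (q - p) = integral {p..q} (\<lambda>x. f x - c)"
proof -
  assume a: "p \<le> q"
  have "f integrable_on {p..q}" using f_int by (simp add: absolutely_integrable_on_def)
  then have "integral {p..q} (\<lambda>x. f x - c) = integral {p..q} f - integral {p..q} (\<lambda>x. c)"
    by (intro integral_diff) auto
  then show ?thesis using v_diff[OF a] a by simp
qed

lemma slope_eq: "p < q \<Longrightarrow> ((v q - v p) / (q - p) - c) * (q - p) = v q - v p - c * (q - p)"
  unfolding left_diff_distrib[of "(v q - v p) / (q - p)"] by simp

lemma abs_slope_eq: "p < q \<Longrightarrow> \<bar>(v q - v p) / (q - p) - c\<bar> * (q - p) = \<bar>v q - v p - c * (q - p)\<bar>"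
  using slope_eq[of p q c] by (metis abs_mult abs_of_pos diff_gt_0_iff_gt)

lemma abs_v_diff_le: "p \<le> q \<Longrightarrow> \<bar>v q - v p - c * (q - p)\<bar> \<le> integral {p..q} (\<lambda>x. \<bar>f x - c\<bar>)"
  using integral_norm_bound_integral[OF f_diff_integrable(1)[of c p q] f_diff_integrable(2)[of c p q]]
  by (simp add: v_diff')

lemma deviation_combine:
  assumes "p \<le> m" "m \<le> q"
  shows "integral {p..m} (\<lambda>x. \<bar>f x - c\<bar>) + integral {m..q} (\<lambda>x. \<bar>f x - c\<bar>) = integral {p..q} (\<lambda>x. \<bar>f x - c\<bar>)"
  using assms f_diff_integrable by (intro Henstock_Kurzweil_Integration.integral_combine) auto

lemma dyadic_sum_deviation_le:
  "p < q \<Longrightarrow> dyadic_sum n (\<lambda>y. \<bar>y - c\<bar>) v p q \<le> integral {p..q} (\<lambda>x. \<bar>f x - c\<bar>)"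
proof (induction n arbitrary: p q)
  case 0
  then show ?case using abs_v_diff_le[of p q c] abs_slope_eq[of p q c] by (simp add: mult.commute)
next
  case (Suc n)
  have m: "p < (p + q) / 2" "(p + q) / 2 < q" using Suc.prems by auto
  show ?case using Suc.IH[OF m(1)] Suc.IH[OF m(2)] deviation_combine[of p "(p + q) / 2" q c] m by simp
qed

text \<open>The deviations of \<open>v\<close> from the chord over the two halves are opposite, so
  each is at most half of the total deviation. This gives \<open>N\<close>, where restricting the
  deviation to one half would give only \<open>2 * N\<close>.\<close>

lemma half_slope_diff:
  assumes "p < q"
  defines "m \<equiv> (p + q) / 2" and "c \<equiv> (v q - v p) / (q - p)"
  shows "\<bar>(v m - v p) / (m - p) - c\<bar> \<le> N" "\<bar>(v q - v m) / (q - m) - c\<bar> \<le> N"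
proof -
  have m: "p < m" "m < q" "m - p = (q - p) / 2" "q - m = (q - p) / 2"
    using assms by (auto simp: field_simps)
  have cc: "c * (q - p) = v q - v p" using assms by (simp add: c_def)
  have s0: "c * (m - p) + c * (q - m) = c * (q - p)" by (simp add: algebra_simps)
  have "\<bar>v m - v p - c * (m - p)\<bar> + \<bar>v q - v m - c * (q - m)\<bar> \<le> N * (q - p)"
    using abs_v_diff_le[of p m c] abs_v_diff_le[of m q c] deviation_combine[of p m q c] bmo[OF assms(1)] m
    unfolding c_def by linarith
  moreover have "v m - v p - c * (m - p) = - (v q - v m - c * (q - m))" using cc s0 by linarith
  then have "\<bar>v m - v p - c * (m - p)\<bar> = \<bar>v q - v m - c * (q - m)\<bar>" by (simp only: abs_minus_cancel)
  moreover have "N * (m - p) = N * (q - p) / 2" "N * (q - m) = N * (q - p) / 2" unfolding m(3,4) by simp_all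
  ultimately have "\<bar>v m - v p - c * (m - p)\<bar> \<le> N * (m - p)" "\<bar>v q - v m - c * (q - m)\<bar> \<le> N * (q - m)"
    by linarith+
  then have "\<bar>(v m - v p) / (m - p) - c\<bar> * (m - p) \<le> N * (m - p)" "\<bar>(v q - v m) / (q - m) - c\<bar> * (q - m) \<le> N * (q - m)"
    unfolding abs_slope_eq[OF m(1)] abs_slope_eq[OF m(2)] .
  then show "\<bar>(v m - v p) / (m - p) - c\<bar> \<le> N" "\<bar>(v q - v m) / (q - m) - c\<bar> \<le> N"
    using m(1,2) by (meson diff_gt_0_iff_gt mult_right_le_imp_le)+
qed

abbreviation "expsum n c p q \<equiv> dyadic_sum n (\<lambda>y. exp (\<bar>y - c\<bar> / (9 * N))) v p q"

lemma exp_third: "exp (1/3 :: real) \<le> 7/5"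
proof -
  have "exp (1/3::real) ^ 3 = exp 1" by (simp add: exp_of_nat_mult[symmetric])
  also have "\<dots> \<le> (7/5)^3" using e_less_272 by (simp add: power3_eq_cube)
  finally show ?thesis by (rule power_le_imp_le_base[where n=2, simplified]) auto
qed

text \<open>One generation of the stopping argument: the descent into dyadic halves stops at the first
  slope that deviates from \<open>c\<close> by more than \<open>2 N\<close>; the stopped intervals are paid for by the
  mean deviation.\<close>

lemma expsum_step:
  assumes K: "\<And>j p q. j < n \<Longrightarrow> p < q \<Longrightarrow> expsum j ((v q - v p) / (q - p)) p q \<le> 6 * (q - p)"
    and "m \<le> n" "p < q" "\<bar>(v q - v p) / (q - p) - c\<bar> \<le> 2 * N"
  shows "expsum m c p q \<le> 7/5 * (q - p) + 21 / (5 * N) * dyadic_sum m (\<lambda>y. \<bar>y - c\<bar>) v p q"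
  using assms(2-)
proof (induction m arbitrary: p q)
  case 0
  have "\<bar>(v q - v p) / (q - p) - c\<bar> / (9 * N) \<le> 2 * N / (9 * N)" using 0 N_pos by (intro divide_right_mono) auto
  also have "2 * N / (9 * N) \<le> 1/3" using N_pos by simp
  finally have "\<bar>(v q - v p) / (q - p) - c\<bar> / (9 * N) \<le> 1/3" .
  then have "exp (\<bar>(v q - v p) / (q - p) - c\<bar> / (9 * N)) \<le> 7/5" using exp_third by (smt (verit) exp_le_cancel_iff)
  then have "(q - p) * exp (\<bar>(v q - v p) / (q - p) - c\<bar> / (9 * N)) \<le> (q - p) * (7/5)"
    using 0 by (intro mult_left_mono) auto
  moreover have "0 \<le> 21 / (5 * N) * ((q - p) * \<bar>(v q - v p) / (q - p) - c\<bar>)" using 0 N_pos by auto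
  ultimately show ?case unfolding dyadic_sum.simps by linarith
next
  case (Suc m)
  let ?m = "(p + q) / 2"
  have mm: "p < ?m" "?m < q" using Suc.prems by auto
  have half: "expsum m c x y \<le> 7/5 * (y - x) + 21 / (5 * N) * dyadic_sum m (\<lambda>y. \<bar>y - c\<bar>) v x y"
    if xy: "x < y" and d: "\<bar>(v y - v x) / (y - x) - (v q - v p) / (q - p)\<bar> \<le> N" for x y
  proof (cases "\<bar>(v y - v x) / (y - x) - c\<bar> \<le> 2 * N")
    case True
    then show ?thesis using Suc xy by auto
  next
    case False
    define s where "s = (v y - v x) / (y - x)"
    \<comment> \<open>The parent interval was not stopped, so its slope is within
      \<open>2 * N\<close> of \<open>c\<close>; halving adds at most \<open>N\<close>.\<close>
    have sc: "\<bar>s - c\<bar> \<le> 3 * N" "2 * N \<le> \<bar>s - c\<bar>" using False d Suc.prems by (auto simp: s_def)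
    have "expsum m c x y \<le> dyadic_sum m (\<lambda>z. 7/5 * exp (\<bar>z - s\<bar> / (9 * N))) v x y"
    proof (rule dyadic_sum_mono)
      fix z
      have "\<bar>z - c\<bar> / (9 * N) \<le> 1/3 + \<bar>z - s\<bar> / (9 * N)"
        using sc N_pos by (simp add: field_simps)
      then have "exp (\<bar>z - c\<bar> / (9 * N)) \<le> exp (1/3) * exp (\<bar>z - s\<bar> / (9 * N))"
        by (simp add: exp_add[symmetric])
      also have "\<dots> \<le> 7/5 * exp (\<bar>z - s\<bar> / (9 * N))" using exp_third by (intro mult_right_mono) auto
      finally show "exp (\<bar>z - c\<bar> / (9 * N)) \<le> 7/5 * exp (\<bar>z - s\<bar> / (9 * N))" .
    qed (use xy in auto)
    also have "\<dots> = 7/5 * expsum m s x y" by (rule dyadic_sum_cmult)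
    also have "\<dots> \<le> 7/5 * (6 * (y - x))" using K[of m x y] Suc.prems xy by (simp add: s_def)
    \<comment> \<open>Since 7/5 * 6 = 42/5, the stopping threshold \<open>2 * N\<close> trades the
      length of the stopped interval for its deviation from \<open>c\<close>.\<close>
    also have "\<dots> = 21 / (5 * N) * (2 * N * (y - x))" using N_pos by simp
    also have "\<dots> \<le> 21 / (5 * N) * (\<bar>s - c\<bar> * (y - x))"
      using sc xy N_pos by (intro mult_left_mono mult_right_mono) auto
    also have "\<dots> \<le> 21 / (5 * N) * dyadic_sum m (\<lambda>y. \<bar>y - c\<bar>) v x y"
      using dyadic_sum_jensen_abs[OF xy, of v c m] N_pos by (intro mult_left_mono) (auto simp: s_def)
    finally show ?thesis by (rule add_increasing[rotated]) (use xy in simp)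
  qed
  have "expsum (Suc m) c p q \<le> (7/5 * (?m - p) + 7/5 * (q - ?m)) + (21 / (5 * N) * dyadic_sum m (\<lambda>y. \<bar>y - c\<bar>) v p ?m + 21 / (5 * N) * dyadic_sum m (\<lambda>y. \<bar>y - c\<bar>) v ?m q)"
    using half[OF mm(1) half_slope_diff(1)[OF Suc.prems(2)]] half[OF mm(2) half_slope_diff(2)[OF Suc.prems(2)]] by simp
  also have "7/5 * (?m - p) + 7/5 * (q - ?m) = 7/5 * (q - p)" by (simp add: field_simps)
  finally show ?case by (simp add: distrib_left)
qed

text \<open>The constants close up: without stopping the integrand is at most
  \<open>exp (1/3) <= 7/5\<close>; stopped intervals fill at most half of \<open>{p..q}\<close> and
  start within \<open>3 * N\<close> of \<open>c\<close>, so by induction the total is at most 7/5 +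
  7/5 * 6 / 2 = 28/5 times the length.\<close>

lemma john_nirenberg:
  "p < q \<Longrightarrow> expsum n ((v q - v p) / (q - p)) p q \<le> 6 * (q - p)"
proof (induction n arbitrary: p q rule: less_induct)
  case (less n)
  let ?c = "(v q - v p) / (q - p)"
  have "expsum n ?c p q \<le> 7/5 * (q - p) + 21 / (5 * N) * dyadic_sum n (\<lambda>y. \<bar>y - ?c\<bar>) v p q"
    using less N_pos by (intro expsum_step[of n]) auto
  also have "\<dots> \<le> 7/5 * (q - p) + 21 / (5 * N) * (N * (q - p))"
    using dyadic_sum_deviation_le[OF less.prems, of n ?c] bmo[OF less.prems] N_pos
    by (intro add_left_mono mult_left_mono) auto
  also have "21 / (5 * N) * (N * (q - p)) = 21/5 * (q - p)" using N_pos by simp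
  also have "7/5 * (q - p) + 21/5 * (q - p) \<le> 6 * (q - p)" using less.prems by argo
  finally show ?case .
qed

end

section \<open>Duality between entropy and exponential moments\<close>

lemma young_exp: "0 \<le> u \<Longrightarrow> u * y \<le> u * ln u - u + exp (y :: real)"
proof (cases "u = 0")
  case False
  assume "0 \<le> u"
  then have u: "0 < u" using False by simp
  have "1 + (y - ln u) \<le> exp (y - ln u)" by (rule exp_ge_add_one_self)
  then have "u * (1 + (y - ln u)) \<le> u * exp (y - ln u)" using u by (intro mult_left_mono) auto
  also have "u * exp (y - ln u) = exp y" using u by (simp add: exp_diff)
  finally show ?thesis by (simp add: algebra_simps)
qed auto

context bmo_slice begin

lemma continuous_v: "continuous_on {p..q} v"
proof -
  have "continuous_on {p..q} (\<lambda>x. v p + integral {p..x} f)"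
    using f_int by (intro continuous_intros indefinite_integral_continuous_1) (auto simp: absolutely_integrable_on_def)
  then show ?thesis by (rule continuous_on_eq) (metis atLeastAtMost_iff v_diff add_diff_cancel_left' add.commute diff_add_cancel)
qed

text \<open>Young's inequality \<open>u y \<le> u ln u - u + exp y\<close> with \<open>u = l\<^sub>i / m\<^sub>i\<close>, where \<open>m\<^sub>i\<close> is the relative
  length of the \<open>i\<close>-th cell, turns the exponential moment of the dyadic slopes into this bound. The
  cells need not be dyadic, since the primitive of the dyadic slopes converges to \<open>v\<close>.\<close>

lemma entropy_duality:
  fixes x l :: "nat \<Rightarrow> real"
  assumes x: "\<And>i. i < n \<Longrightarrow> x i \<le> x (Suc i)" and l: "\<And>i. i < n \<Longrightarrow> 0 \<le> l i" "(\<Sum>i<n. l i) = 1"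
    and lx: "\<And>i. i < n \<Longrightarrow> l i \<noteq> 0 \<Longrightarrow> x i < x (Suc i)"
  defines "c \<equiv> (v (x n) - v (x 0)) / (x n - x 0)"
  shows "(\<Sum>i<n. l i * \<bar>(v (x (Suc i)) - v (x i)) / (x (Suc i) - x i) - c\<bar>)
     \<le> 9 * N * ((\<Sum>i<n. l i * ln (l i * (x n - x 0) / (x (Suc i) - x i))) + 5)"
proof -
  have mono: "x i \<le> x j" if "i \<le> j" "j \<le> n" for i j
    using that
  proof (induction j)
    case (Suc j)
    then show ?case using x[of j] by (cases "i = Suc j") auto
  qed auto
  have "\<exists>i<n. l i \<noteq> 0" using l(2) by (metis lessThan_iff sum.neutral zero_neq_one)
  then obtain i where "i < n" "x i < x (Suc i)" using lx by blast
  then have pq: "x 0 < x n" using mono[of 0 i] mono[of "Suc i" n] by simp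
  define p q L where "p = x 0" and "q = x n" and "L = x n - x 0"
  have L: "L > 0" using pq by (simp add: L_def)
  define S where "S = (\<lambda>k. dyadic_slope k v p q)"
  define E where "E = (\<lambda>k y. exp (\<bar>S k y - c\<bar> / (9 * N)))"
  have Si: "(\<lambda>y. S k y - c) integrable_on {a..b}" "(\<lambda>y. \<bar>S k y - c\<bar>) integrable_on {a..b}"
    "S k integrable_on {a..b}" "E k integrable_on {a..b}" for k a b
    unfolding S_def E_def
    using dyadic_slope_absolutely_integrable[of "\<lambda>y. y - c" a b k v p q]
      dyadic_slope_absolutely_integrable[of "\<lambda>y. \<bar>y - c\<bar>" a b k v p q]
      dyadic_slope_absolutely_integrable[of "\<lambda>y. y" a b k v p q]
      dyadic_slope_absolutely_integrable[of "\<lambda>y. exp (\<bar>y - c\<bar> / (9 * N))" a b k v p q]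
    by (auto simp: absolutely_integrable_on_def)
  have sumE: "(\<Sum>i<j. integral {x i..x (Suc i)} (E k)) = integral {p..x j} (E k)" if "j \<le> n" for j k
    using that
  proof (induction j)
    case (Suc j)
    then show ?case using mono[of 0 j] x[of j] Si(4)
      by (simp add: p_def Henstock_Kurzweil_Integration.integral_combine)
  qed (simp add: p_def)
  have level: "(\<Sum>i<n. l i * \<bar>integral {x i..x (Suc i)} (S k) / (x (Suc i) - x i) - c\<bar>)
     \<le> 9 * N * ((\<Sum>i<n. l i * ln (l i * L / (x (Suc i) - x i))) + 5)" for k
  proof -
    have piece: "l i * \<bar>integral {x i..x (Suc i)} (S k) / (x (Suc i) - x i) - c\<bar> \<le>
        9 * N * (l i * ln (l i * L / (x (Suc i) - x i)) - l i + integral {x i..x (Suc i)} (E k) / L)" if i: "i < n" for i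
    proof (cases "l i = 0")
      case True
      have "0 \<le> integral {x i..x (Suc i)} (E k)" by (intro integral_nonneg Si) (auto simp: E_def)
      then show ?thesis using True N_pos L by simp
    next
      case False
      define d where "d = x (Suc i) - x i"
      have d: "d > 0" using lx[OF i False] by (simp add: d_def)
      define u where "u = l i * L / d"
      have u: "u \<ge> 0" using l(1)[OF i] L d by (simp add: u_def)
      have "integral {x i..x (Suc i)} (\<lambda>y. S k y - c) = integral {x i..x (Suc i)} (S k) - c * d"
        using Si x[OF i] by (subst integral_diff) (auto simp: d_def)
      then have "integral {x i..x (Suc i)} (S k) / d - c = integral {x i..x (Suc i)} (\<lambda>y. S k y - c) / d"
        using d by (simp add: field_simps)
      then have "\<bar>integral {x i..x (Suc i)} (S k) / d - c\<bar> \<le> integral {x i..x (Suc i)} (\<lambda>y. \<bar>S k y - c\<bar>) / d"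
        using d integral_norm_bound_integral[OF Si(1)[of k "x i" "x (Suc i)"] Si(2)[of k "x i" "x (Suc i)"]]
        by (simp add: divide_right_mono)
      then have "l i * \<bar>integral {x i..x (Suc i)} (S k) / d - c\<bar> \<le> l i * (integral {x i..x (Suc i)} (\<lambda>y. \<bar>S k y - c\<bar>) / d)"
        using l(1)[OF i] by (intro mult_left_mono) auto
      also have "\<dots> = 9 * N / L * integral {x i..x (Suc i)} (\<lambda>y. u * (\<bar>S k y - c\<bar> / (9 * N)))"
        using L N_pos d by (simp add: u_def)
      also have "\<dots> \<le> 9 * N / L * integral {x i..x (Suc i)} (\<lambda>y. (u * ln u - u) + E k y)"
      proof (intro mult_left_mono integral_le integrable_on_mult_right integrable_add integrable_on_divide Si)
        show "u * (\<bar>S k y - c\<bar> / (9 * N)) \<le> (u * ln u - u) + E k y" for y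
          unfolding E_def by (rule young_exp[OF u])
      qed (use L N_pos in auto)
      also have "integral {x i..x (Suc i)} (\<lambda>y. (u * ln u - u) + E k y) = (u * ln u - u) * d + integral {x i..x (Suc i)} (E k)"
        using Si x[OF i] by (subst integral_add) (auto simp: d_def)
      also have "9 * N / L * ((u * ln u - u) * d + integral {x i..x (Suc i)} (E k)) =
          9 * N * (l i * ln u - l i + integral {x i..x (Suc i)} (E k) / L)"
        using L N_pos d by (simp add: u_def field_simps)
      finally show ?thesis by (simp add: u_def d_def)
    qed
    have "(\<Sum>i<n. l i * \<bar>integral {x i..x (Suc i)} (S k) / (x (Suc i) - x i) - c\<bar>) \<le>
        (\<Sum>i<n. 9 * N * (l i * ln (l i * L / (x (Suc i) - x i)) - l i + integral {x i..x (Suc i)} (E k) / L))"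
      by (intro sum_mono piece) auto
    \<comment> \<open>The \<open>- 1\<close> is the total weight from the linear term of Young's
      inequality; together with the moment bound 6 it leaves the additive 5.\<close>
    also have "\<dots> = 9 * N * ((\<Sum>i<n. l i * ln (l i * L / (x (Suc i) - x i))) - 1 + integral {p..q} (E k) / L)"
      using l(2) sumE[of n k]
      by (simp add: sum_distrib_left[symmetric] sum.distrib sum_subtractf sum_divide_distrib[symmetric] q_def)
    also have "integral {p..q} (E k) \<le> 6 * L"
      using john_nirenberg[of p q k] has_integral_dyadic_slope[of p q "\<lambda>y. exp (\<bar>y - c\<bar> / (9 * N))" k v] pq
      by (auto simp: p_def q_def L_def c_def E_def S_def integral_unique)
    finally show ?thesis using L N_pos by (simp add: divide_right_mono add.commute)
  qed
  have "(\<lambda>k. \<Sum>i<n. l i * \<bar>integral {x i..x (Suc i)} (S k) / (x (Suc i) - x i) - c\<bar>)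
      \<longlonglongrightarrow> (\<Sum>i<n. l i * \<bar>(v (x (Suc i)) - v (x i)) / (x (Suc i) - x i) - c\<bar>)"
  proof (rule tendsto_sum)
    fix i assume "i \<in> {..<n}"
    then have i: "i < n" by simp
    have mem: "x j \<in> {p..q}" if "j \<le> n" for j using mono[of 0 j] mono[of j n] that by (auto simp: p_def q_def)
    have "integral {x i..x (Suc i)} (S k) = integral {p..x (Suc i)} (S k) - integral {p..x i} (S k)" for k
      using integral_initial_segment[OF Si(3)[of k p "x (Suc i)"], of "x i" "x (Suc i)"] mem[of i] x[OF i] i by auto
    moreover have "(\<lambda>k. integral {p..x (Suc i)} (S k) - integral {p..x i} (S k)) \<longlonglongrightarrow> (v (x (Suc i)) - v p) - (v (x i) - v p)"
      unfolding S_def using mem i pq continuous_v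
      by (intro tendsto_diff interpolation_tendsto) (auto simp: p_def q_def)
    ultimately have lim: "(\<lambda>k. integral {x i..x (Suc i)} (S k)) \<longlonglongrightarrow> v (x (Suc i)) - v (x i)" by simp
    show "(\<lambda>k. l i * \<bar>integral {x i..x (Suc i)} (S k) / (x (Suc i) - x i) - c\<bar>)
      \<longlonglongrightarrow> l i * \<bar>(v (x (Suc i)) - v (x i)) / (x (Suc i) - x i) - c\<bar>"
    proof (cases "l i = 0")
      case False
      then show ?thesis using lx[OF i] by (intro tendsto_intros lim) auto
    qed simp
  qed
  then show ?thesis using level unfolding L_def
    by (meson LIMSEQ_le_const2)
qed

end

section \<open>Fields with spatial derivative in BMO\<close>

text \<open>Removes the positive shift of the seminorm, so that times with \<open>N t = 0\<close>
  are covered. The sign of \<open>H\<close> is left open, hence the absolute value in the choice of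
  \<open>d\<close>.\<close>

lemma le_mult_if_le_shifted:
  fixes N H S :: real
  assumes "\<And>d. 0 < d \<Longrightarrow> S \<le> 9 * (N + d) * H"
  shows "S \<le> 9 * N * H"
proof (rule field_le_epsilon)
  fix e :: real assume e: "0 < e"
  define d where "d = e / (9 * \<bar>H\<bar> + 1)"
  have d: "0 < d" using e by (simp add: d_def add_nonneg_pos)
  have "S \<le> 9 * N * H + d * (9 * H)" using assms[OF d] by (simp add: algebra_simps)
  also have "d * (9 * H) \<le> d * (9 * \<bar>H\<bar> + 1)" using d by (intro mult_left_mono) auto
  also have "\<dots> = e"
  proof -
    have "9 * \<bar>H\<bar> + 1 \<noteq> 0" by linarith
    then show ?thesis unfolding d_def by simp
  qed
  finally show "S \<le> 9 * N * H + e" by simp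
qed

text \<open>The velocity after passing to good representatives: all bounds hold for every time,
  without exceptional sets. The seminorm ignores affine parts of \<open>v t\<close>;
  \<open>a\<close> controls these through the value at 0 and the increment over
  \<open>{-1..1}\<close>.\<close>

locale bmo_field =
  fixes T :: real and v f :: "real \<Rightarrow> real \<Rightarrow> real" and N a :: "real \<Rightarrow> real"
  assumes T: "0 \<le> T"
    and v_measurable: "(\<lambda>(t, x). v t x) \<in> borel_measurable borel"
    and f_int: "\<And>t p q. f t absolutely_integrable_on {p..q}"
    and v_diff: "\<And>t p q. p \<le> q \<Longrightarrow> v t q - v t p = integral {p..q} (f t)"
    and N_nonneg: "\<And>t. 0 \<le> N t"
    and bmo: "\<And>t p q. p < q \<Longrightarrow>
      integral {p..q} (\<lambda>x. \<bar>f t x - (v t q - v t p) / (q - p)\<bar>) \<le> N t * (q - p)"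
    and N_int: "N absolutely_integrable_on {0..T}"
    and a_int: "a absolutely_integrable_on {0..T}"
    and a_bound: "\<And>t. \<bar>v t 0\<bar> \<le> a t" "\<And>t. \<bar>v t 1 - v t (-1)\<bar> \<le> a t"
begin

lemma slice: "0 < e \<Longrightarrow> bmo_slice (f t) (v t) (N t + e)"
proof
  show "0 < e \<Longrightarrow> 0 < N t + e" using N_nonneg[of t] by simp
  fix p q :: real assume "0 < e" "p < q"
  then show "integral {p..q} (\<lambda>x. \<bar>f t x - (v t q - v t p) / (q - p)\<bar>) \<le> (N t + e) * (q - p)"
    using bmo[of p q t] by (smt (verit) mult_right_mono)
qed (use f_int v_diff in auto)

lemma continuous_v: "continuous_on S (v t)"
proof -
  have "continuous_on {x - 1..x + 1} (v t)" for x
    using bmo_slice.continuous_v[OF slice[of 1 t]] by simp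
  then have "isCont (v t) x" for x
    by (rule continuous_on_interior[of "{x - 1..x + 1}"]) auto
  then show ?thesis by (simp add: continuous_at_imp_continuous_on)
qed

lemma duality:
  fixes x l :: "nat \<Rightarrow> real"
  assumes x: "\<And>i. i < n \<Longrightarrow> x i \<le> x (Suc i)" and l: "\<And>i. i < n \<Longrightarrow> 0 \<le> l i" "(\<Sum>i<n. l i) = 1"
    and lx: "\<And>i. i < n \<Longrightarrow> l i \<noteq> 0 \<Longrightarrow> x i < x (Suc i)"
  defines "c t \<equiv> (v t (x n) - v t (x 0)) / (x n - x 0)"
  shows "(\<Sum>i<n. l i * \<bar>(v t (x (Suc i)) - v t (x i)) / (x (Suc i) - x i) - c t\<bar>)
     \<le> 9 * N t * ((\<Sum>i<n. l i * ln (l i * (x n - x 0) / (x (Suc i) - x i))) + 5)" (is "?S \<le> 9 * N t * ?H")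
proof (rule le_mult_if_le_shifted)
  show "?S \<le> 9 * (N t + d) * ?H" if d: "0 < d" for d
    using bmo_slice.entropy_duality[OF slice[OF d], of n x l t] assms by simp
qed

lemma nested_slopes:
  assumes "P \<le> p" "p < q" "q \<le> Q"
  shows "\<bar>(v t q - v t p) / (q - p) - (v t Q - v t P) / (Q - P)\<bar> \<le> 9 * N t * (ln ((Q - P) / (q - p)) + 5)"
proof -
  \<comment> \<open>All weight sits on the middle cell \<open>{p..q}\<close>. The outer cells have
    weight 0 and may be degenerate, which is why the duality demands strict increase only where the
    weight is nonzero.\<close>
  define x where "x = (\<lambda>i::nat. if i = 0 then P else if i = 1 then p else if i = 2 then q else Q)"
  define l where "l = (\<lambda>i::nat. if i = 1 then 1 else (0::real))"
  have "i < 3 \<Longrightarrow> x i \<le> x (Suc i)" "i < 3 \<Longrightarrow> l i \<noteq> 0 \<Longrightarrow> x i < x (Suc i)" for i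
    using assms by (auto simp: x_def l_def split: if_splits)
  moreover have "(\<Sum>i<3. l i) = 1" "l i \<ge> 0" for i by (auto simp: l_def numeral_3_eq_3)
  ultimately show ?thesis
    using duality[of 3 x l t] by (simp add: numeral_3_eq_3 x_def l_def)
qed

definition A where "A t = a t + 9 * N t"

lemma A_nonneg: "0 \<le> A t" "a t \<le> A t" "0 \<le> a t"
  using N_nonneg[of t] a_bound(1)[of t] by (auto simp: A_def)

lemma A_int: "A absolutely_integrable_on {0..T}"
  unfolding A_def using a_int N_int by (intro set_integral_add set_integrable_mult_right) auto

text \<open>The slope over \<open>{-R..R}\<close> is compared with the one over
  \<open>{x..y}\<close> and with the one over \<open>{-1..1}\<close>, which \<open>a\<close>
  controls. Each comparison contributes a 5 to the constant 11.\<close>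

lemma slope_bound:
  assumes R: "1 \<le> R" and xy: "- R \<le> x" "x < y" "y \<le> R"
  shows "\<bar>v t y - v t x\<bar> \<le> (y - x) * (A t * (11 + ln R + ln (2 * R / (y - x))))"
proof -
  define s S s1 where "s = (v t y - v t x) / (y - x)" and "S = (v t R - v t (-R)) / (R - (-R))"
    and "s1 = (v t 1 - v t (-1)) / (1 - (-1))"
  have "\<bar>s - S\<bar> \<le> 9 * N t * (ln (2 * R / (y - x)) + 5)"
    using nested_slopes[of "-R" x y R t] xy by (simp add: s_def S_def)
  moreover have "\<bar>s1 - S\<bar> \<le> 9 * N t * (ln R + 5)"
    using nested_slopes[of "-R" "-1" 1 R t] R by (simp add: s1_def S_def)
  moreover have "\<bar>s1\<bar> \<le> a t" using a_bound(2)[of t] A_nonneg(3)[of t] by (simp add: s1_def)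
  ultimately have "\<bar>s\<bar> \<le> a t + 9 * N t * (ln R + 5) + 9 * N t * (ln (2 * R / (y - x)) + 5)" by linarith
  also have "\<dots> = a t * 1 + 9 * N t * (10 + ln R + ln (2 * R / (y - x)))" by (simp add: algebra_simps)
  also have "\<dots> \<le> a t * (11 + ln R + ln (2 * R / (y - x))) + 9 * N t * (11 + ln R + ln (2 * R / (y - x)))"
  proof (intro add_mono mult_left_mono)
    have "0 \<le> ln R" "0 \<le> ln (2 * R / (y - x))" using R xy by auto
    then show "1 \<le> 11 + ln R + ln (2 * R / (y - x))" by linarith
  qed (use A_nonneg N_nonneg in auto)
  also have "\<dots> = A t * (11 + ln R + ln (2 * R / (y - x)))" by (simp add: A_def algebra_simps)
  finally have "(y - x) * \<bar>s\<bar> \<le> (y - x) * (A t * (11 + ln R + ln (2 * R / (y - x))))"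
    using xy by (intro mult_left_mono) auto
  moreover have "(y - x) * \<bar>s\<bar> = \<bar>v t y - v t x\<bar>" using xy by (simp add: s_def)
  ultimately show ?thesis by simp
qed

text \<open>The modulus is written through the square of the difference, an even function as
  Osgood's argument needs. Differences are at most \<open>2 * R\<close>, and
  \<open>12 * R^2 = 3 * (2 * R)^2\<close> is exactly the \<open>K\<close> for which the modulus is
  monotone on that range.\<close>

lemma log_lipschitz:
  assumes R: "1 \<le> R" and xy: "\<bar>x\<bar> \<le> R" "\<bar>y\<bar> \<le> R"
  shows "\<bar>v t y - v t x\<bar> \<le> A t * (11 + ln R) * (\<bar>y - x\<bar> * (1 + ln (12 * R^2 / (y - x)^2)))"
proof -
  have main: "\<bar>v t y - v t x\<bar> \<le> A t * (11 + ln R) * ((y - x) * (1 + ln (12 * R^2 / (y - x)^2)))"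
    if xy: "- R \<le> x" "x < y" "y \<le> R" for x y
  proof -
    define r where "r = 2 * R / (y - x)"
    have r: "1 \<le> r" using xy by (simp add: r_def)
    have e: "12 * R^2 / (y - x)^2 = 3 * r^2" by (simp add: r_def power_divide power_mult_distrib)
    have "r * 1 \<le> r * (3 * r)" using r by (intro mult_left_mono) auto
    then have "r \<le> 3 * r^2" by (simp add: power2_eq_square)
    then have l: "ln r \<le> ln (12 * R^2 / (y - x)^2)" "0 \<le> ln r" "0 \<le> ln R" using r R unfolding e by auto
    have "11 + ln R + ln r \<le> (11 + ln R) + (11 + ln R) * ln r" using l by (simp add: mult_right_mono algebra_simps)
    also have "\<dots> \<le> (11 + ln R) * (1 + ln (12 * R^2 / (y - x)^2))"
      using l by (simp add: distrib_left mult_left_mono)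
    finally have "A t * (11 + ln R + ln r) \<le> A t * ((11 + ln R) * (1 + ln (12 * R^2 / (y - x)^2)))"
      using A_nonneg by (intro mult_left_mono) auto
    then have "(y - x) * (A t * (11 + ln R + ln r)) \<le> (y - x) * (A t * ((11 + ln R) * (1 + ln (12 * R^2 / (y - x)^2))))"
      by (rule mult_left_mono) (use xy in auto)
    moreover have "(y - x) * (A t * ((11 + ln R) * (1 + ln (12 * R^2 / (y - x)^2)))) =
        A t * (11 + ln R) * ((y - x) * (1 + ln (12 * R^2 / (y - x)^2)))" by (simp only: mult_ac)
    ultimately show ?thesis using slope_bound[OF R xy, of t] unfolding r_def by linarith
  qed
  consider "x < y" | "y < x" | "x = y" by linarith
  then show ?thesis
  proof cases
    case 1 then show ?thesis using main[of x y] xy by auto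
  next
    case 2 then show ?thesis using main[of y x] xy by (auto simp: abs_minus_commute power2_commute)
  qed auto
qed

text \<open>\<open>slope_bound\<close> between 0 and \<open>x\<close>, with \<open>R\<close> the
  larger of 1 and \<open>|x|\<close>. The resulting growth \<open>|x| ln |x|\<close> is slow enough
  for \<open>log_growth_bound\<close>, so curves cannot escape in finite time; the value at 0 raises
  13 to 14.\<close>

lemma growth: "\<bar>v t x\<bar> \<le> 14 * A t * ((1 + \<bar>x\<bar>) * (1 + ln (1 + x^2)))"
proof -
  define g where "g = ln (1 + x^2)"
  have g: "0 \<le> g" by (simp add: g_def)
  have pw: "v_bound \<le> \<bar>x\<bar> * (A t * (11 + ln R + ln (2 * R / \<bar>x\<bar>)))"
    if "v_bound = \<bar>v t x - v t 0\<bar>" "x \<noteq> 0" "\<bar>x\<bar> \<le> R" "1 \<le> R" for R v_bound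
    using slope_bound[of R 0 x t] slope_bound[of R x 0 t] that by (cases "0 < x") (auto simp: abs_minus_commute)
  have "\<bar>v t x - v t 0\<bar> \<le> A t * (13 * (1 + \<bar>x\<bar>) * (1 + g))"
  proof -
    consider "x = 0" | "x \<noteq> 0" "\<bar>x\<bar> \<le> 1" | "1 < \<bar>x\<bar>" by linarith
    then show ?thesis
    proof cases
      case 1 then show ?thesis using g A_nonneg by simp
    next
      case 2
      have "ln (2 / \<bar>x\<bar>) \<le> 2 / \<bar>x\<bar>" using 2 by (intro less_imp_le ln_less_self) auto
      then have "\<bar>x\<bar> * ln (2 / \<bar>x\<bar>) \<le> 2" using 2 by (simp add: field_simps)
      then have "\<bar>x\<bar> * (11 + ln (2 / \<bar>x\<bar>)) \<le> 11 * \<bar>x\<bar> + 2" by (simp add: algebra_simps)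
      also have "\<dots> \<le> 13 * (1 + \<bar>x\<bar>) * 1" by simp
      also have "\<dots> \<le> 13 * (1 + \<bar>x\<bar>) * (1 + g)" using g by (intro mult_left_mono) auto
      finally have "A t * (\<bar>x\<bar> * (11 + ln (2 / \<bar>x\<bar>))) \<le> A t * (13 * (1 + \<bar>x\<bar>) * (1 + g))"
        using A_nonneg by (intro mult_left_mono) auto
      then show ?thesis using pw[OF refl, of 1] 2 by (simp add: mult.left_commute)
    next
      case 3
      have "ln 2 \<le> (1::real)" using ln_2_less_1 by simp
      moreover have "ln \<bar>x\<bar> \<le> g"
      proof -
        have "2 * \<bar>x\<bar> \<le> 1 + x^2" using zero_le_power2[of "\<bar>x\<bar> - 1"] by (simp add: power2_diff)
        then have "\<bar>x\<bar> \<le> 1 + x^2" by linarith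
        then show ?thesis unfolding g_def using 3 by (intro ln_mono) auto
      qed
      ultimately have "11 + ln \<bar>x\<bar> + ln 2 \<le> 12 * (1 + g)" using g by argo
      then have "\<bar>x\<bar> * (11 + ln \<bar>x\<bar> + ln 2) \<le> \<bar>x\<bar> * (12 * (1 + g))" by (intro mult_left_mono) auto
      also have "\<dots> = 12 * \<bar>x\<bar> * (1 + g)" by simp
      also have "\<dots> \<le> 13 * (1 + \<bar>x\<bar>) * (1 + g)" using g by (intro mult_right_mono) auto
      finally have "A t * (\<bar>x\<bar> * (11 + ln \<bar>x\<bar> + ln 2)) \<le> A t * (13 * (1 + \<bar>x\<bar>) * (1 + g))"
        using A_nonneg by (intro mult_left_mono) auto
      moreover have "x \<noteq> 0" using 3 by auto
      ultimately show ?thesis using pw[OF refl, of "\<bar>x\<bar>"] 3 by (simp add: mult.left_commute)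
    qed
  qed
  moreover have "\<bar>v t 0\<bar> \<le> A t * (1 * 1)" using a_bound(1)[of t] A_nonneg(2)[of t] by simp
  moreover have "A t * (1 * 1) \<le> A t * ((1 + \<bar>x\<bar>) * (1 + g))"
    using g A_nonneg by (intro mult_left_mono mult_mono) auto
  ultimately have "\<bar>v t x\<bar> \<le> A t * (13 * (1 + \<bar>x\<bar>) * (1 + g)) + A t * ((1 + \<bar>x\<bar>) * (1 + g))" by linarith
  then show ?thesis by (simp add: g_def algebra_simps)
qed

lemma field_bound:
  assumes "\<bar>y\<bar> \<le> R"
  shows "\<bar>v s y\<bar> \<le> 14 * A s * ((1 + R) * (1 + ln (1 + R^2)))"
proof -
  have "y^2 \<le> R^2" using assms by (simp add: abs_le_square_iff[symmetric])
  then have l: "ln (1 + y^2) \<le> ln (1 + R^2)" by (intro ln_mono) (auto simp: add_pos_nonneg)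
  have "\<bar>v s y\<bar> \<le> 14 * A s * ((1 + \<bar>y\<bar>) * (1 + ln (1 + y^2)))" by (rule growth)
  also have "\<dots> \<le> 14 * A s * ((1 + R) * (1 + ln (1 + R^2)))"
    using assms A_nonneg l by (intro mult_left_mono mult_mono) auto
  finally show ?thesis .
qed

lemma A_cmult_integrable: "(\<lambda>s. c * A s * d) absolutely_integrable_on {0..T}"
  using A_int by (intro set_integrable_mult_left set_integrable_mult_right) auto

lemma bounded_curve_integrable:
  assumes Y: "Y \<in> borel_measurable (lebesgue_on {0..T})" and R: "\<And>s. s \<in> {0..T} \<Longrightarrow> \<bar>Y s\<bar> \<le> R"
  shows "(\<lambda>s. v s (Y s)) absolutely_integrable_on {0..T}"
proof (rule measurable_bounded_by_integrable_imp_absolutely_integrable)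
  have id: "(\<lambda>s::real. s) \<in> borel_measurable (lebesgue_on {0..T})"
    by (intro continuous_imp_measurable_on_sets_lebesgue) auto
  have "(\<lambda>s. (s, Y s)) \<in> borel_measurable (lebesgue_on {0..T})"
    using id Y by (rule borel_measurable_Pair)
  from measurable_compose[OF this v_measurable]
  show "(\<lambda>s. v s (Y s)) \<in> borel_measurable (lebesgue_on {0..T})" by simp
  show "(\<lambda>s. 14 * A s * ((1 + R) * (1 + ln (1 + R^2)))) integrable_on {0..T}"
    using A_cmult_integrable absolutely_integrable_on_def by blast
  show "norm (v s (Y s)) \<le> 14 * A s * ((1 + R) * (1 + ln (1 + R^2)))" if "s \<in> {0..T}" for s
    using field_bound[OF R[OF that]] by simp
qed auto

section \<open>Solution curves, their uniqueness and existence\<close>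

definition solution :: "(real \<Rightarrow> real) \<Rightarrow> bool" where
  "solution X \<longleftrightarrow> (\<lambda>s. v s (X s)) absolutely_integrable_on {0..T} \<and>
     (\<forall>t\<in>{0..T}. X t = X 0 + integral {0..t} (\<lambda>s. v s (X s)))"

lemma solution_integrable: "solution X \<Longrightarrow> (\<lambda>s. v s (X s)) absolutely_integrable_on {0..T}"
  unfolding solution_def by blast

lemma solution_eq: "solution X \<Longrightarrow> t \<in> {0..T} \<Longrightarrow> X t = X 0 + integral {0..t} (\<lambda>s. v s (X s))"
  unfolding solution_def by blast

lemma solution_continuous: "solution X \<Longrightarrow> continuous_on {0..T} X"
proof -
  assume X: "solution X"
  have "continuous_on {0..T} (\<lambda>t. X 0 + integral {0..t} (\<lambda>s. v s (X s)))"
    using solution_integrable[OF X] unfolding absolutely_integrable_on_def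
    by (intro continuous_intros indefinite_integral_continuous_1) auto
  then show ?thesis by (rule continuous_on_eq) (rule solution_eq[OF X, symmetric])
qed

lemma solution_bounded:
  assumes "solution X" "solution Y"
  obtains R where "1 \<le> R" "\<And>t. t \<in> {0..T} \<Longrightarrow> \<bar>X t\<bar> \<le> R" "\<And>t. t \<in> {0..T} \<Longrightarrow> \<bar>Y t\<bar> \<le> R"
proof -
  have "bounded (X ` {0..T})" "bounded (Y ` {0..T})"
    using assms by (simp_all add: compact_continuous_image compact_imp_bounded solution_continuous)
  then obtain r1 r2 where "\<And>t. t \<in> {0..T} \<Longrightarrow> \<bar>X t\<bar> \<le> r1" "\<And>t. t \<in> {0..T} \<Longrightarrow> \<bar>Y t\<bar> \<le> r2"
    unfolding bounded_iff by (metis imageI real_norm_def)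
  then show ?thesis by (intro that[of "max 1 (max r1 r2)"]) (auto simp: le_max_iff_disj)
qed

lemma integrable_sub:
  assumes "(g :: real \<Rightarrow> real) absolutely_integrable_on {0..T}" "s \<in> {0..T}" "t \<in> {0..T}"
  shows "g absolutely_integrable_on {s..t}" "g integrable_on {s..t}"
  using absolutely_integrable_on_subinterval[OF assms(1), of s t] assms
  by (auto simp: absolutely_integrable_on_def)

text \<open>The meeting time \<open>s\<close> is arbitrary, not only 0: curves that meet later have
  coincided from the start, and this makes the flow strictly increasing in \<open>x\<close>.\<close>

lemma solution_unique:
  assumes X: "solution X" and Y: "solution Y" and s: "s \<in> {0..T}" "X s = Y s" and t: "t \<in> {0..T}"
  shows "X t = Y t"
proof -
  obtain R where R: "1 \<le> R" "\<And>t. t \<in> {0..T} \<Longrightarrow> \<bar>X t\<bar> \<le> R" "\<And>t. t \<in> {0..T} \<Longrightarrow> \<bar>Y t\<bar> \<le> R"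
    using solution_bounded[OF X Y] by blast
  define h where "h = (\<lambda>s. v s (X s) - v s (Y s))"
  have "X t - Y t = 0"
  proof (rule osgood_unique_zero[where h = h and a = "\<lambda>t. A t * (11 + ln R)" and K = "12 * R^2" and D = "\<lambda>t. X t - Y t" and s = s])
    show "h absolutely_integrable_on {0..T}"
      unfolding h_def by (intro set_integral_diff solution_integrable X Y)
    show "(\<lambda>t. A t * (11 + ln R)) absolutely_integrable_on {0..T}"
      using A_int by (intro set_integrable_mult_left) auto
    show "X t - Y t = X 0 - Y 0 + integral {0..t} h" if t: "t \<in> {0..T}" for t
    proof -
      have "integral {0..t} h = integral {0..t} (\<lambda>s. v s (X s)) - integral {0..t} (\<lambda>s. v s (Y s))"
        unfolding h_def using t T by (intro integral_diff integrable_sub(2) solution_integrable X Y) auto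
      then show ?thesis using solution_eq[OF X t] solution_eq[OF Y t] by linarith
    qed
    fix t assume t: "t \<in> {0..T}"
    show "\<bar>h t\<bar> \<le> A t * (11 + ln R) * (\<bar>X t - Y t\<bar> * (1 + ln (12 * R^2 / (X t - Y t)^2)))"
      unfolding h_def using log_lipschitz[OF R(1) R(3)[OF t] R(2)[OF t]] .
    show "0 \<le> A t * (11 + ln R)" using A_nonneg R(1) by (intro mult_nonneg_nonneg) auto
    have "\<bar>X t - Y t\<bar> \<le> 2 * R" using R(2,3)[OF t] by linarith
    then have "(X t - Y t)^2 \<le> (2 * R)^2" by (metis abs_le_square_iff abs_of_nonneg R(1) abs_ge_zero order_trans)
    moreover have "1 \<le> R^2" using R(1) by simp
    ultimately show "(X t - Y t)^2 + 1 \<le> 12 * R^2" by (simp add: power_mult_distrib)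
  qed (use s t in auto)
  then show ?thesis by simp
qed

end

text \<open>At a limit 0 the bound \<open>ln z <= z\<close> with \<open>z = 1 / sqrt u\<close> gives
  \<open>|u ln u| <= 2 * sqrt u\<close> for \<open>0 < u < 1\<close>; at \<open>u = 0\<close> the
  product vanishes.\<close>

lemma tendsto_x_ln_x:
  fixes u :: "nat \<Rightarrow> real"
  assumes u: "\<And>n. 0 \<le> u n" and lim: "u \<longlonglongrightarrow> l"
  shows "(\<lambda>n. u n * ln (u n)) \<longlonglongrightarrow> l * ln l"
proof (cases "l = 0")
  case True
  have "(\<lambda>n. u n * ln (u n)) \<longlonglongrightarrow> 0"
  proof (rule Lim_null_comparison)
    have "eventually (\<lambda>n. u n < 1) sequentially" using lim True by (intro order_tendstoD(2)) auto
    then show "eventually (\<lambda>n. norm (u n * ln (u n)) \<le> 2 * sqrt (u n)) sequentially"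
    proof eventually_elim
      case (elim n)
      show ?case
      proof (cases "u n = 0")
        case False
        then have p: "0 < u n" using u[of n] by simp
        have "ln (u n) = - 2 * ln (1 / sqrt (u n))" using p by (simp add: ln_div ln_sqrt)
        moreover have "ln (1 / sqrt (u n)) \<le> 1 / sqrt (u n)" using p by (intro less_imp_le ln_less_self) auto
        ultimately have "- ln (u n) \<le> 2 / sqrt (u n)" by simp
        then have "u n * (- ln (u n)) \<le> u n * (2 / sqrt (u n))" using p by (intro mult_left_mono) auto
        also have "\<dots> = 2 * (u n / sqrt (u n))" by simp
        also have "\<dots> = 2 * sqrt (u n)" using p by (simp only: real_div_sqrt less_imp_le)
        finally show ?thesis using p elim by (simp add: abs_mult)
      qed simp
    qed
    show "(\<lambda>n. 2 * sqrt (u n)) \<longlonglongrightarrow> 0"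
      using tendsto_mult[OF tendsto_const[of 2] tendsto_real_sqrt[OF lim]] True by simp
  qed
  then show ?thesis using True by simp
next
  case False
  then show ?thesis by (intro tendsto_intros lim)
qed

lemma log_lipschitz_modulus_tendsto:
  fixes u :: "nat \<Rightarrow> real"
  assumes u: "\<And>n. 0 \<le> u n" and lim: "u \<longlonglongrightarrow> l" and K: "0 < K"
  shows "(\<lambda>n. u n * (1 + ln (K / (u n)^2))) \<longlonglongrightarrow> l * (1 + ln (K / l^2))"
proof -
  have e: "r * (1 + ln (K / r^2)) = r + r * ln K - 2 * (r * ln r)" if "0 \<le> r" for r
    using that K by (cases "r = 0") (simp_all add: ln_div ln_realpow algebra_simps)
  have "0 \<le> l" using LIMSEQ_le_const[OF lim] u by auto
  then show ?thesis unfolding e[OF u] e[OF \<open>0 \<le> l\<close>]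
    by (intro tendsto_intros lim tendsto_x_ln_x u)
qed

lemma borel_measurable_lebesgue_on_LIMSEQ:
  fixes u :: "nat \<Rightarrow> real \<Rightarrow> real"
  assumes "\<And>n. u n \<in> borel_measurable (lebesgue_on S)" "\<And>x. x \<in> S \<Longrightarrow> (\<lambda>n. u n x) \<longlonglongrightarrow> w x"
  shows "w \<in> borel_measurable (lebesgue_on S)"
  by (rule borel_measurable_LIMSEQ_real[of "lebesgue_on S" u]) (use assms in auto)

context bmo_field begin

text \<open>Picard iteration \<open>P n\<close> for the field truncated to \<open>{-R..R}\<close>. The oscillation \<open>d n\<close> of the tail of the
  iterates decreases to a function satisfying an Osgood inequality, hence to \<open>0\<close>. The bound \<open>R\<close> comes
  from the growth estimate, which also holds for the truncated field, so the truncation is inactive.\<close>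

lemma solution_exists: "\<exists>X. solution X \<and> X 0 = x0"
proof -
  \<comment> \<open>The a priori bound of \<open>log_growth_bound\<close> for a curve starting at
    \<open>x0\<close> in a field of growth \<open>14 * A\<close>.\<close>
  define E where "E = exp (exp (ln (1 + ln (1 + x0^2)) + 3 * integral {0..T} (\<lambda>t. 14 * A t)))"
  define R where "R = 1 + sqrt E"
  have E: "0 < E" by (simp add: E_def)
  then have R: "1 \<le> R" "sqrt E \<le> R" by (auto simp: R_def)
  define c where "c = (\<lambda>y. max (- R) (min R y))"
  have c: "\<bar>c y\<bar> \<le> R" "\<bar>c x - c y\<bar> \<le> \<bar>x - y\<bar>" "\<bar>c y\<bar> \<le> \<bar>y\<bar>" "\<bar>c x - c y\<bar> \<le> 2 * R"
    "\<bar>y\<bar> \<le> R \<Longrightarrow> c y = y" for x y using R(1) by (auto simp: c_def max_def min_def)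
  have contc: "continuous_on S c" for S unfolding c_def by (intro continuous_intros)
  define P where "P = rec_nat (\<lambda>t. x0) (\<lambda>n X t. x0 + integral {0..t} (\<lambda>s. v s (c (X s))))"
  have P0: "P 0 = (\<lambda>t. x0)" and PS: "P (Suc n) = (\<lambda>t. x0 + integral {0..t} (\<lambda>s. v s (c (P n s))))" for n
    by (auto simp: P_def)
  have meas: "g \<in> borel_measurable (lebesgue_on {0..T})" if "continuous_on {0..T} g" for g :: "real \<Rightarrow> real"
    using that by (intro continuous_imp_measurable_on_sets_lebesgue) auto
  have cint: "(\<lambda>s. v s (c (Z s))) absolutely_integrable_on {0..T}" if "continuous_on {0..T} Z" for Z
    using c(1) by (intro bounded_curve_integrable[of _ R] meas continuous_on_compose2[OF contc that]) auto
  have Pcont: "continuous_on {0..T} (P n)" for n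
  proof (induction n)
    case (Suc n)
    show ?case unfolding PS using cint[OF Suc]
      by (intro continuous_intros indefinite_integral_continuous_1) (simp add: absolutely_integrable_on_def)
  qed (simp add: P0)
  have cPmeas: "(\<lambda>s. c (P n s)) \<in> borel_measurable (lebesgue_on {0..T})" for n
    by (intro meas continuous_on_compose2[OF contc Pcont]) auto
  note Pint = cint[OF Pcont]
  define b where "b = (\<lambda>t. A t * (11 + ln R))"
  define K where "K = 12 * R^2"
  define w where "w = (\<lambda>r. r * (1 + ln (K / r^2)))"
  have b0: "0 \<le> b t" for t using A_nonneg R(1) by (simp add: b_def)
  have bint: "b absolutely_integrable_on {0..T}" using A_cmult_integrable[of 1 "11 + ln R"] by (simp add: b_def)
  have K: "0 < K" using R(1) by (simp add: K_def)
  have wmono: "w r \<le> w s" if "0 \<le> r" "r \<le> s" "s \<le> 2 * R" for r s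
    unfolding w_def
  proof (rule log_lipschitz_modulus_mono)
    have "s^2 \<le> (2 * R)^2" using that by (intro power_mono) auto
    then show "3 * s^2 \<le> K" by (simp add: K_def power_mult_distrib)
  qed (use that in auto)
  have w0: "0 \<le> w r" if "0 \<le> r" "r \<le> 2 * R" for r using wmono[of 0 r] that by (simp add: w_def)
  have lip: "\<bar>v s (c x) - v s (c y)\<bar> \<le> b s * w \<bar>c x - c y\<bar>" for s x y
    using log_lipschitz[OF R(1) c(1)[of y] c(1)[of x], of s] by (simp add: b_def w_def K_def)
  define d where "d = (\<lambda>n t. SUP p\<in>{n..}\<times>{n..}. \<bar>c (P (fst p) t) - c (P (snd p) t)\<bar>)"
  have bdd: "bdd_above ((\<lambda>p. \<bar>c (P (fst p) t) - c (P (snd p) t)\<bar>) ` ({n..}\<times>{n..}))" for n t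
    using c(4) by (intro bdd_aboveI[of _ "2 * R"]) auto
  have d_ge: "\<bar>c (P m t) - c (P k t)\<bar> \<le> d n t" if "m \<ge> n" "k \<ge> n" for m k n t
    unfolding d_def using cSUP_upper[OF _ bdd, of "(m, k)" n t] that by auto
  have d0: "0 \<le> d n t" for n t using d_ge[of n n n t] by simp
  have d2: "d n t \<le> 2 * R" for n t unfolding d_def using c(4) by (intro cSUP_least) auto
  have ddec: "decseq (\<lambda>n. d n t)" for t
    unfolding d_def by (intro decseq_SucI cSUP_subset_mono bdd) auto
  have dmeas: "d n \<in> borel_measurable (lebesgue_on {0..T})" for n
    unfolding d_def using cPmeas bdd by (intro borel_measurable_cSUP) (auto intro!: borel_measurable_abs borel_measurable_diff)
  have bmeas: "b \<in> borel_measurable (lebesgue_on {0..T})"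
    using bint by (intro absolutely_integrable_imp_borel_measurable) auto
  have wmeas: "w \<in> borel_measurable borel" unfolding w_def by measurable
  have bw: "(\<lambda>s. b s * w (g s)) absolutely_integrable_on {0..T}"
    if g: "g \<in> borel_measurable (lebesgue_on {0..T})" "\<And>s. 0 \<le> g s" "\<And>s. g s \<le> 2 * R" for g
  proof (rule measurable_bounded_by_integrable_imp_absolutely_integrable)
    show "(\<lambda>s. b s * w (g s)) \<in> borel_measurable (lebesgue_on {0..T})"
      using bmeas measurable_compose[OF g(1) wmeas] by (rule borel_measurable_times)
    show "(\<lambda>s. b s * w (2 * R)) integrable_on {0..T}"
      using bint by (intro integrable_on_mult_left) (auto simp: absolutely_integrable_on_def)
    show "norm (b s * w (g s)) \<le> b s * w (2 * R)" for s
      using b0[of s] w0[of "g s"] wmono[of "g s" "2 * R"] g(2,3)[of s] by (simp add: abs_mult mult_left_mono)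
  qed auto
  have rec: "d (Suc n) t \<le> integral {0..t} (\<lambda>s. b s * w (d n s))" if t: "t \<in> {0..T}" for n t
    unfolding fun_cong[OF fun_cong[OF d_def], of "Suc n" t]
  proof (rule cSUP_least, safe)
    fix m k assume "Suc n \<le> m" "Suc n \<le> k"
    then obtain m' k' where mk: "m = Suc m'" "k = Suc k'" "n \<le> m'" "n \<le> k'" by (metis Suc_le_D Suc_le_mono)
    have i: "(\<lambda>s. v s (c (P j s))) integrable_on {0..t}" for j
      using t by (intro integrable_sub(2) Pint) auto
    have "\<bar>c (P m t) - c (P k t)\<bar> \<le> \<bar>P m t - P k t\<bar>" by (rule c(2))
    also have "\<bar>P m t - P k t\<bar> = norm (integral {0..t} (\<lambda>s. v s (c (P m' s)) - v s (c (P k' s))))"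
      using i by (simp add: mk PS integral_diff)
    also have "\<dots> \<le> integral {0..t} (\<lambda>s. b s * w (d n s))"
    proof (rule integral_norm_bound_integral)
      show "(\<lambda>s. v s (c (P m' s)) - v s (c (P k' s))) integrable_on {0..t}" by (intro integrable_diff i)
      show "(\<lambda>s. b s * w (d n s)) integrable_on {0..t}"
        using t d0 d2 by (intro integrable_sub(2) bw dmeas) auto
      fix s
      have "w \<bar>c (P m' s) - c (P k' s)\<bar> \<le> w (d n s)"
        using d_ge[OF mk(3,4)] d2 by (intro wmono) auto
      then have "b s * w \<bar>c (P m' s) - c (P k' s)\<bar> \<le> b s * w (d n s)" using b0 by (intro mult_left_mono) auto
      then show "norm (v s (c (P m' s)) - v s (c (P k' s))) \<le> b s * w (d n s)"
        using lip[of s "P m' s" "P k' s"] by simp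
    qed
    finally show "\<bar>c (P (fst (m, k)) t) - c (P (snd (m, k)) t)\<bar> \<le> integral {0..t} (\<lambda>s. b s * w (d n s))" by simp
  qed auto
  define dl where "dl = (\<lambda>t. lim (\<lambda>n. d n t))"
  have dlim: "(\<lambda>n. d n t) \<longlonglongrightarrow> dl t" for t
  proof -
    obtain L where "(\<lambda>n. d n t) \<longlonglongrightarrow> L" using decseq_convergent[OF ddec, of 0 t] d0 by blast
    then show ?thesis unfolding dl_def by (simp add: limI)
  qed
  have dl: "0 \<le> dl t" "dl t \<le> 2 * R" for t
    using LIMSEQ_le_const[OF dlim] LIMSEQ_le_const2[OF dlim] d0 d2 by blast+
  have dlmeas: "dl \<in> borel_measurable (lebesgue_on {0..T})"
    using dmeas dlim by (rule borel_measurable_lebesgue_on_LIMSEQ)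
  define h where "h = (\<lambda>s. b s * w (dl s))"
  have hint: "h absolutely_integrable_on {0..T}" unfolding h_def using dl by (intro bw dlmeas) auto
  have h0: "0 \<le> h s" for s unfolding h_def using b0 dl w0 by (intro mult_nonneg_nonneg) auto
  have dl_le: "dl t \<le> integral {0..t} h" if t: "t \<in> {0..T}" for t
  proof -
    have "(\<lambda>n. integral {0..t} (\<lambda>s. b s * w (d n s))) \<longlonglongrightarrow> integral {0..t} h"
    proof (rule dominated_convergence(2))
      show "(\<lambda>s. b s * w (d n s)) integrable_on {0..t}" for n
        using t d0 d2 by (intro integrable_sub(2) bw dmeas) auto
      show "(\<lambda>s. b s * w (2 * R)) integrable_on {0..t}"
        using integrable_sub(2)[OF bint, of 0 t] t by (intro integrable_on_mult_left) auto
      show "norm (b s * w (d n s)) \<le> b s * w (2 * R)" for n s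
        using b0[of s] w0[of "d n s"] wmono[of "d n s" "2 * R"] d0 d2 by (simp add: abs_mult mult_left_mono)
      show "(\<lambda>n. b s * w (d n s)) \<longlonglongrightarrow> h s" for s
        unfolding h_def w_def by (intro tendsto_mult_left log_lipschitz_modulus_tendsto d0 dlim K)
    qed
    moreover have "(\<lambda>n. d (Suc n) t) \<longlonglongrightarrow> dl t" using dlim by (rule LIMSEQ_Suc)
    ultimately show ?thesis using rec[OF t] by (meson LIMSEQ_le)
  qed
  define M where "M = integral {0..T} h"
  have u: "0 \<le> integral {0..t} h" "integral {0..t} h \<le> M" if "t \<in> {0..T}" for t
    unfolding M_def using integrable_sub(2)[OF hint, of 0 t] integrable_sub(2)[OF hint, of 0 T] that h0 T
    by (auto intro!: integral_nonneg integral_subset_le)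
  \<comment> \<open>The limit oscillation \<open>dl\<close> is merely measurable, so Osgood's
    argument is run on its absolutely continuous majorant, the integral of \<open>h\<close>. The
    enlarged \<open>K'\<close> keeps that majorant, which is at most \<open>M\<close>, in the range
    where the modulus is monotone.\<close>
  define K' where "K' = K + 3 * M^2 + 1"
  have zero: "integral {0..t} h = 0" if t: "t \<in> {0..T}" for t
  proof (rule osgood_unique_zero[where h = h and a = b and K = K' and T = T and s = 0 and D = "\<lambda>t. integral {0..t} h"])
    fix t assume t: "t \<in> {0..T}"
    have sq: "(integral {0..t} h)^2 \<le> M^2" using u[OF t] by (intro power_mono) auto
    then show "(integral {0..t} h)^2 + 1 \<le> K'" unfolding K'_def using K zero_le_power2[of M] by linarith
    have "w (dl t) \<le> dl t * (1 + ln (K' / (dl t)^2))"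
    proof (cases "dl t = 0")
      case False
      then have "0 < dl t" using dl(1)[of t] by simp
      moreover have "K \<le> K'" by (simp add: K'_def)
      ultimately have "ln (K / (dl t)^2) \<le> ln (K' / (dl t)^2)" using K by (intro ln_mono divide_right_mono) auto
      then show ?thesis unfolding w_def using dl(1) by (intro mult_left_mono) auto
    qed (simp add: w_def)
    also have "\<dots> \<le> integral {0..t} h * (1 + ln (K' / (integral {0..t} h)^2))"
      using dl(1) dl_le[OF t] sq K by (intro log_lipschitz_modulus_mono) (auto simp: K'_def)
    finally have "h t \<le> b t * (\<bar>integral {0..t} h\<bar> * (1 + ln (K' / (integral {0..t} h)^2)))"
      unfolding fun_cong[OF h_def, of t] using b0 u(1)[OF t] by (simp add: mult_left_mono)
    then show "\<bar>h t\<bar> \<le> b t * (\<bar>integral {0..t} h\<bar> * (1 + ln (K' / (integral {0..t} h)^2)))"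
      using h0[of t] by simp
  qed (use hint bint b0 T t in auto)
  have dl0: "dl t = 0" if "t \<in> {0..T}" for t using dl(1)[of t] dl_le[OF that] zero[OF that] by simp
  have "\<exists>z. (\<lambda>n. c (P n t)) \<longlonglongrightarrow> z" if t: "t \<in> {0..T}" for t
  proof -
    have "Cauchy (\<lambda>n. c (P n t))"
    proof (rule CauchyI)
      fix e :: real assume "0 < e"
      then have "eventually (\<lambda>n. d n t < e) sequentially" using dlim[of t] dl0[OF t] by (intro order_tendstoD(2)) auto
      then obtain n where "d n t < e" by (auto simp: eventually_sequentially)
      then show "\<exists>n. \<forall>m\<ge>n. \<forall>k\<ge>n. norm (c (P m t) - c (P k t)) < e"
        using d_ge by (metis le_less_trans real_norm_def)
    qed
    then show ?thesis using Cauchy_convergent convergent_def by blast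
  qed
  then obtain Z where Z: "\<And>t. t \<in> {0..T} \<Longrightarrow> (\<lambda>n. c (P n t)) \<longlonglongrightarrow> Z t" by metis
  have Zmeas: "Z \<in> borel_measurable (lebesgue_on {0..T})"
    using cPmeas Z by (rule borel_measurable_lebesgue_on_LIMSEQ)
  have ZR: "\<bar>Z t\<bar> \<le> R" if "t \<in> {0..T}" for t
    using LIMSEQ_le_const2[OF tendsto_rabs[OF Z[OF that]]] c(1) by blast
  have Zint: "(\<lambda>s. v s (Z s)) absolutely_integrable_on {0..T}"
    using Zmeas ZR by (rule bounded_curve_integrable)
  define Y where "Y = (\<lambda>t. x0 + integral {0..t} (\<lambda>s. v s (Z s)))"
  have PY: "(\<lambda>n. P (Suc n) t) \<longlonglongrightarrow> Y t" if t: "t \<in> {0..T}" for t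
    unfolding PS Y_def
  proof (intro tendsto_add tendsto_const dominated_convergence(2))
    show "(\<lambda>s. v s (c (P n s))) integrable_on {0..t}" for n
      using t by (intro integrable_sub(2) Pint) auto
    show "(\<lambda>s. 14 * A s * ((1 + R) * (1 + ln (1 + R^2)))) integrable_on {0..t}"
      using t by (intro integrable_sub(2) A_cmult_integrable) auto
    show "norm (v s (c (P n s))) \<le> 14 * A s * ((1 + R) * (1 + ln (1 + R^2)))" for n s
      using field_bound[OF c(1)] by simp
    fix s assume "s \<in> {0..t}"
    then have s: "s \<in> {0..T}" using t by auto
    show "(\<lambda>n. v s (c (P n s))) \<longlonglongrightarrow> v s (Z s)"
      using continuous_on_tendsto_compose[OF continuous_v[of UNIV s] Z[OF s]] by simp
  qed
  have ZY: "Z t = c (Y t)" if t: "t \<in> {0..T}" for t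
  proof -
    have "(\<lambda>n. c (P (Suc n) t)) \<longlonglongrightarrow> c (Y t)"
      using continuous_on_tendsto_compose[OF contc[of UNIV] PY[OF t]] by simp
    then show ?thesis using LIMSEQ_Suc[OF Z[OF t]] LIMSEQ_unique by blast
  qed
  have YR: "\<bar>Y t\<bar> \<le> R" if t: "t \<in> {0..T}" for t
  proof -
    have "(Y t)^2 \<le> exp (exp (ln (1 + ln (1 + (Y 0)^2)) + 3 * integral {0..T} (\<lambda>t. 14 * A t)))"
    proof (rule log_growth_bound[OF Zint])
      show "(\<lambda>t. 14 * A t) absolutely_integrable_on {0..T}" using A_cmult_integrable[of 14 1] by simp
      show "Y t = Y 0 + integral {0..t} (\<lambda>s. v s (Z s))" for t by (simp add: Y_def)
      show "0 \<le> 14 * A t" for t using A_nonneg by simp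
      fix t assume t: "t \<in> {0..T}"
      have "\<bar>Z t\<bar> \<le> \<bar>Y t\<bar>" using ZY[OF t] c(3) by simp
      then have "\<bar>v t (Z t)\<bar> \<le> 14 * A t * ((1 + \<bar>Y t\<bar>) * (1 + ln (1 + \<bar>Y t\<bar>^2)))" by (rule field_bound)
      then show "\<bar>v t (Z t)\<bar> \<le> 14 * A t * ((1 + \<bar>Y t\<bar>) * (1 + ln (1 + (Y t)^2)))" by simp
    qed (rule t)
    then have "(Y t)^2 \<le> E" by (simp add: E_def Y_def)
    then have "\<bar>Y t\<bar> \<le> sqrt E" by (metis real_sqrt_abs real_sqrt_le_mono)
    then show ?thesis using R(2) by simp
  qed
  have eq: "Z t = Y t" if "t \<in> {0..T}" for t using ZY[OF that] c(5)[OF YR[OF that]] by simp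
  have "solution Y"
    unfolding solution_def
  proof (intro conjI ballI)
    show "(\<lambda>s. v s (Y s)) absolutely_integrable_on {0..T}"
      using Zint by (rule set_integrable_cong[THEN iffD1, rotated -1]) (auto simp: eq)
    show "Y t = Y 0 + integral {0..t} (\<lambda>s. v s (Y s))" if "t \<in> {0..T}" for t
    proof -
      have "integral {0..t} (\<lambda>s. v s (Z s)) = integral {0..t} (\<lambda>s. v s (Y s))"
        using that by (intro integral_cong) (auto simp: eq)
      then show ?thesis by (simp add: Y_def)
    qed
  qed
  then show ?thesis by (intro exI[of _ Y]) (simp add: Y_def)
qed

end

section \<open>Entropy of partitions along the flow\<close>

text \<open>The termwise Gibbs inequality. Summed over weights of equal total mass, it makes
  relative entropy nonnegative.\<close>

lemma mult_ln_ge: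
  fixes l m :: real
  assumes "0 \<le> l" "0 < m"
  shows "l - m \<le> l * ln (l / m)"
proof (cases "l = 0")
  case False
  then have l: "0 < l" using assms by simp
  have "ln (m / l) \<le> m / l - 1" using l assms by (intro ln_le_minus_one) auto
  moreover have "ln (m / l) = - ln (l / m)" using l assms by (simp add: ln_div)
  ultimately have "l * (1 - m / l) \<le> l * ln (l / m)" using l by (intro mult_left_mono) auto
  then show ?thesis using l by (simp add: right_diff_distrib)
qed (use assms in auto)

context bmo_field begin

definition flow :: "real \<Rightarrow> real \<Rightarrow> real" where
  "flow t x = (SOME X. solution X \<and> X 0 = x) t"

lemma flow_solution: "solution (\<lambda>t. flow t x)" "flow 0 x = x"
  using someI_ex[OF solution_exists[of x]] by (simp_all add: flow_def)

lemma flow_less: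
  assumes xy: "x < y" and t: "t \<in> {0..T}"
  shows "flow t x < flow t y"
proof (rule ccontr)
  assume neg: "\<not> flow t x < flow t y"
  have "continuous_on {0..t} (\<lambda>s. flow s y - flow s x)"
    using t by (intro continuous_intros continuous_on_subset[OF solution_continuous[OF flow_solution(1)]]) auto
  then have "\<exists>s. 0 \<le> s \<and> s \<le> t \<and> flow s y - flow s x = 0"
    using neg xy t by (intro IVT2') (auto simp: flow_solution)
  then obtain s where "0 \<le> s" "s \<le> t" "flow s y - flow s x = 0" by blast
  then have s: "s \<in> {0..T}" "flow s x = flow s y" using t by auto
  have "flow 0 x = flow 0 y"
    using solution_unique[OF flow_solution(1)[of x] flow_solution(1)[of y] s] T by simp
  then show False using xy by (simp add: flow_solution)
qed

definition gap :: "real \<Rightarrow> real \<Rightarrow> real \<Rightarrow> real" where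
  "gap p q t = flow t q - flow t p"

text \<open>The mean of the spatial derivative of the velocity over the image of
  \<open>{p..q}\<close> at time \<open>t\<close>; at the same time the logarithmic derivative of
  \<open>gap\<close>.\<close>

definition rate :: "real \<Rightarrow> real \<Rightarrow> real \<Rightarrow> real" where
  "rate p q t = (v t (flow t q) - v t (flow t p)) / gap p q t"

lemma gap_pos: "p < q \<Longrightarrow> t \<in> {0..T} \<Longrightarrow> 0 < gap p q t"
  using flow_less by (simp add: gap_def)

text \<open>The substitute, at finite increments, for the equation of the logarithm of the Jacobian.
  It needs the gap to stay positive on all of \<open>{0..T}\<close>, where \<open>ln\<close> is then
  continuously differentiable along it.\<close>

lemma ln_gap:
  assumes pq: "p < q"
  shows "rate p q absolutely_integrable_on {0..T}"
    and "t \<in> {0..T} \<Longrightarrow> ln (gap p q t) = ln (gap p q 0) + integral {0..t} (rate p q)"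
proof -
  define h where "h = (\<lambda>s. v s (flow s q) - v s (flow s p))"
  have hint: "h absolutely_integrable_on {0..T}"
    unfolding h_def by (intro set_integral_diff solution_integrable flow_solution)
  have gap: "gap p q t = gap p q 0 + integral {0..t} h" if t: "t \<in> {0..T}" for t
  proof -
    have "integral {0..t} h = integral {0..t} (\<lambda>s. v s (flow s q)) - integral {0..t} (\<lambda>s. v s (flow s p))"
      unfolding h_def using t T by (intro integral_diff integrable_sub(2) solution_integrable flow_solution) auto
    then show ?thesis
      using solution_eq[OF flow_solution(1)[of q] t] solution_eq[OF flow_solution(1)[of p] t] by (simp add: gap_def)
  qed
  have rate: "rate p q = (\<lambda>s. inverse (gap p q s) * h s)"
    by (auto simp: rate_def h_def divide_inverse mult.commute)
  have ch: "(\<lambda>s. inverse (gap p q s) * h s) absolutely_integrable_on {0..t}"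
      "ln (gap p q t) - ln (gap p q 0) = integral {0..t} (\<lambda>s. inverse (gap p q s) * h s)" if t: "t \<in> {0..T}" for t
  proof -
    have ht: "0 \<le> t" "h absolutely_integrable_on {0..t}" using t T integrable_sub(1)[OF hint, of 0 t] by auto
    have X: "gap p q s = gap p q 0 + integral {0..s} h" if "s \<in> {0..t}" for s using gap[of s] that t by auto
    have G: "(ln has_real_derivative inverse (gap p q s)) (at (gap p q s))" if "s \<in> {0..t}" for s
      using gap_pos[OF pq, of s] that t by (intro DERIV_ln) auto
    have G': "continuous_on (gap p q ` {0..t}) inverse"
    proof (intro continuous_intros ballI)
      fix x assume "x \<in> gap p q ` {0..t}"
      then obtain s where "s \<in> {0..t}" "x = gap p q s" by auto
      then have s: "s \<in> {0..T}" "x = gap p q s" using t by auto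
      show "x \<noteq> 0" using gap_pos[OF pq s(1)] s(2) by simp
    qed
    show "(\<lambda>s. inverse (gap p q s) * h s) absolutely_integrable_on {0..t}"
      "ln (gap p q t) - ln (gap p q 0) = integral {0..t} (\<lambda>s. inverse (gap p q s) * h s)"
      using integrable_chain_rule[OF ht X G G'] by auto
  qed
  show "rate p q absolutely_integrable_on {0..T}" using ch(1)[of T] T by (simp add: rate)
  show "t \<in> {0..T} \<Longrightarrow> ln (gap p q t) = ln (gap p q 0) + integral {0..t} (rate p q)"
    using ch(2)[of t] by (simp add: rate)
qed

definition entropy :: "(nat \<Rightarrow> real) \<Rightarrow> (nat \<Rightarrow> real) \<Rightarrow> nat \<Rightarrow> real \<Rightarrow> real" where
  "entropy l x n t = (\<Sum>i<n. l i * ln (l i * gap (x 0) (x n) t / gap (x i) (x (Suc i)) t))"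

definition beta :: "real \<Rightarrow> real" where "beta t = integral {0..t} N"

context
  fixes l x :: "nat \<Rightarrow> real" and n :: nat
  assumes x: "\<And>i. i < n \<Longrightarrow> x i < x (Suc i)" and l: "\<And>i. i < n \<Longrightarrow> 0 \<le> l i" "(\<Sum>i<n. l i) = 1"
begin

lemma x_0_less_x_n: "x 0 < x n"
proof -
  have "0 < n" using l(2) by (cases n) auto
  moreover have "k < n \<Longrightarrow> x 0 < x (Suc k)" for k
  proof (induction k)
    case (Suc k) then show ?case using x[of "Suc k"] by simp
  qed (use x in auto)
  ultimately show ?thesis by (cases n) auto
qed

lemma weighted_rate_bound:
  assumes t: "t \<in> {0..T}"
  shows "(\<Sum>i<n. l i * \<bar>rate (x i) (x (Suc i)) t - rate (x 0) (x n) t\<bar>) \<le> 9 * N t * (entropy l x n t + 5)"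
proof -
  have less: "flow t (x i) < flow t (x (Suc i))" if "i < n" for i using flow_less[OF x[OF that] t] .
  show ?thesis
    using duality[of n "\<lambda>i. flow t (x i)" l t] less l
    by (simp add: rate_def gap_def entropy_def less_imp_le)
qed

lemma sum_gap: "k \<le> n \<Longrightarrow> (\<Sum>i<k. gap (x i) (x (Suc i)) t) = gap (x 0) (x k) t"
  by (induction k) (auto simp: gap_def)

lemma entropy_nonneg:
  assumes t: "t \<in> {0..T}"
  shows "0 \<le> entropy l x n t"
proof -
  define g where "g = gap (x 0) (x n) t"
  have g: "0 < g" unfolding g_def by (rule gap_pos[OF x_0_less_x_n t])
  have "(\<Sum>i<n. l i - gap (x i) (x (Suc i)) t / g) \<le> entropy l x n t"
    unfolding entropy_def
  proof (rule sum_mono)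
    fix i assume "i \<in> {..<n}"
    then have i: "i < n" by simp
    have gi: "0 < gap (x i) (x (Suc i)) t" by (rule gap_pos[OF x[OF i] t])
    have "l i - gap (x i) (x (Suc i)) t / g \<le> l i * ln (l i / (gap (x i) (x (Suc i)) t / g))"
      using l(1)[OF i] g gi by (intro mult_ln_ge) auto
    then show "l i - gap (x i) (x (Suc i)) t / g \<le> l i * ln (l i * gap (x 0) (x n) t / gap (x i) (x (Suc i)) t)"
      by (simp add: g_def)
  qed
  moreover have "(\<Sum>i<n. l i - gap (x i) (x (Suc i)) t / g) = 0"
    using sum_gap[of n t] l(2) g by (simp add: sum_subtractf sum_divide_distrib[symmetric] g_def)
  ultimately show ?thesis by simp
qed

definition "entropy_rate t = (\<Sum>i<n. l i * (rate (x 0) (x n) t - rate (x i) (x (Suc i)) t))"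

lemma entropy_rate_integrable: "entropy_rate absolutely_integrable_on {0..T}"
  unfolding entropy_rate_def
  using x ln_gap(1) x_0_less_x_n
  by (intro absolutely_integrable_sum set_integrable_mult_right set_integral_diff) auto

lemma entropy_integral:
  assumes t: "t \<in> {0..T}"
  shows "entropy l x n t = entropy l x n 0 + integral {0..t} entropy_rate"
proof -
  have e: "entropy l x n s = (\<Sum>i<n. l i * (ln (l i) + ln (gap (x 0) (x n) s) - ln (gap (x i) (x (Suc i)) s)))"
    if s: "s \<in> {0..T}" for s
    unfolding entropy_def
  proof (rule sum.cong)
    fix i assume "i \<in> {..<n}"
    then have i: "i < n" by simp
    show "l i * ln (l i * gap (x 0) (x n) s / gap (x i) (x (Suc i)) s) =
        l i * (ln (l i) + ln (gap (x 0) (x n) s) - ln (gap (x i) (x (Suc i)) s))"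
    proof (cases "l i = 0")
      case False
      then have "0 < l i" using l(1)[OF i] by simp
      then show ?thesis using gap_pos[OF x_0_less_x_n s] gap_pos[OF x[OF i] s] by (simp add: ln_div ln_mult)
    qed simp
  qed simp
  have ri: "rate p q integrable_on {0..t}" if "p < q" for p q
    using t T by (intro integrable_sub(2) ln_gap(1) that) auto
  have "integral {0..t} entropy_rate = (\<Sum>i<n. l i * (integral {0..t} (rate (x 0) (x n)) - integral {0..t} (rate (x i) (x (Suc i)))))"
    unfolding entropy_rate_def
    using ri x x_0_less_x_n
    by (subst integral_sum) (auto intro!: integrable_on_mult_right integrable_diff simp: integral_diff)
  moreover have "entropy l x n t - entropy l x n 0 = (\<Sum>i<n. l i * (integral {0..t} (rate (x 0) (x n)) - integral {0..t} (rate (x i) (x (Suc i)))))"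
    unfolding e[OF t] e[of 0, simplified, OF T] sum_subtractf[symmetric]
  proof (rule sum.cong)
    fix i assume "i \<in> {..<n}"
    then have i: "i < n" by simp
    show "l i * (ln (l i) + ln (gap (x 0) (x n) t) - ln (gap (x i) (x (Suc i)) t)) -
        l i * (ln (l i) + ln (gap (x 0) (x n) 0) - ln (gap (x i) (x (Suc i)) 0)) =
        l i * (integral {0..t} (rate (x 0) (x n)) - integral {0..t} (rate (x i) (x (Suc i))))"
      unfolding ln_gap(2)[OF x_0_less_x_n t] ln_gap(2)[OF x[OF i] t] by (simp add: algebra_simps)
  qed simp
  ultimately show ?thesis by simp
qed

lemma N_integrable: "s \<in> {0..T} \<Longrightarrow> t \<in> {0..T} \<Longrightarrow> (\<lambda>s. c * N s) absolutely_integrable_on {s..t}"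
  using integrable_sub(1)[OF N_int] by (intro set_integrable_mult_right) auto

lemma beta_mono:
  assumes "0 \<le> p" "p \<le> q" "q \<le> t" "t \<in> {0..T}" "0 \<le> c"
  shows "integral {p..q} (\<lambda>s. c * N s) \<le> c * beta t"
proof -
  have "integral {p..q} (\<lambda>s. c * N s) \<le> integral {0..t} (\<lambda>s. c * N s)"
    using assms N_integrable[of p q c] N_integrable[of 0 t c] N_nonneg
    by (intro integral_subset_le) (auto simp: absolutely_integrable_on_def)
  then show ?thesis by (simp add: beta_def)
qed

text \<open>The entropy is nonnegative, so \<open>ln (entropy + 5)\<close> is Lipschitz with respect to \<open>9 \<integral>N\<close>; unlike
  Gronwall's inequality this is symmetric in time.\<close>

lemma entropy_le:
  assumes t: "t \<in> {0..T}" and s: "s \<in> {0..t}" "entropy l x n s = 0" and r: "r \<in> {0..t}"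
  shows "entropy l x n r + 5 \<le> 5 * exp (9 * beta t)"
proof -
  have var: "\<bar>ln (entropy l x n q + 5) - ln (entropy l x n p + 5)\<bar> \<le> 9 * beta t"
    if pq: "0 \<le> p" "p \<le> q" "q \<le> t" for p q
  proof -
    have "\<bar>ln (entropy l x n q + 5) - ln (entropy l x n p + 5)\<bar> \<le> integral {p..q} (\<lambda>s. 9 * N s)"
    proof (rule chain_rule_variation[OF entropy_rate_integrable, where X = "entropy l x n" and G = "\<lambda>y. ln (y + 5)" and G' = "\<lambda>y. inverse (y + 5)"])
      fix s assume s: "s \<in> {0..T}"
      show "entropy l x n s = entropy l x n 0 + integral {0..s} entropy_rate" by (rule entropy_integral[OF s])
      have p: "0 < entropy l x n s + 5" using entropy_nonneg[OF s] by simp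
      then show "((\<lambda>y. ln (y + 5)) has_real_derivative inverse (entropy l x n s + 5)) (at (entropy l x n s))"
        by (auto intro!: derivative_eq_intros simp: divide_inverse)
      have "\<bar>entropy_rate s\<bar> \<le> (\<Sum>i<n. \<bar>l i * (rate (x 0) (x n) s - rate (x i) (x (Suc i)) s)\<bar>)"
        unfolding entropy_rate_def by (rule sum_abs)
      also have "\<dots> = (\<Sum>i<n. l i * \<bar>rate (x i) (x (Suc i)) s - rate (x 0) (x n) s\<bar>)"
        using l(1) by (intro sum.cong) (auto simp: abs_mult abs_minus_commute)
      also have "\<dots> \<le> 9 * N s * (entropy l x n s + 5)" by (rule weighted_rate_bound[OF s])
      finally show "\<bar>inverse (entropy l x n s + 5) * entropy_rate s\<bar> \<le> 9 * N s"
        using p by (simp add: abs_mult field_simps)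
    next
      show "continuous_on (entropy l x n ` {0..T}) (\<lambda>y. inverse (y + 5))"
      proof (intro continuous_intros ballI)
        fix y assume "y \<in> entropy l x n ` {0..T}"
        then show "y + 5 \<noteq> 0" using entropy_nonneg by force
      qed
      show "(\<lambda>s. 9 * N s) absolutely_integrable_on {0..T}" by (rule N_integrable) (use T in auto)
    qed (use pq t in auto)
    also have "\<dots> \<le> 9 * beta t" using pq t by (intro beta_mono) auto
    finally show ?thesis .
  qed
  have "ln (entropy l x n r + 5) - ln (entropy l x n s + 5) \<le> 9 * beta t"
    using var[of s r] var[of r s] s r by (cases "s \<le> r") auto
  then have "ln (entropy l x n r + 5) \<le> ln (5 * exp (9 * beta t))" using s(2) by (simp add: ln_mult)
  moreover have "0 < entropy l x n r + 5" using entropy_nonneg[of r] r t by simp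
  ultimately show ?thesis by simp
qed

text \<open>The duality bound integrated in time. It has the absolute values inside the sum, so it
  controls the mean size of the log-distortion and not only its signed average; 45 is the duality
  factor 9 times the initial 5 in \<open>entropy_le\<close>.\<close>

lemma sum_ln_gap_ratio_le:
  assumes t: "t \<in> {0..T}" and l0: "entropy l x n 0 = 0"
  shows "(\<Sum>i<n. l i * \<bar>ln (gap (x i) (x (Suc i)) t / gap (x 0) (x n) t) - ln (gap (x i) (x (Suc i)) 0 / gap (x 0) (x n) 0)\<bar>)
     \<le> 45 * beta t * exp (9 * beta t)"
proof -
  define D where "D = (\<lambda>i s. rate (x i) (x (Suc i)) s - rate (x 0) (x n) s)"
  have Di: "D i absolutely_integrable_on {0..t}" if "i < n" for i
    unfolding D_def using t T x[OF that] x_0_less_x_n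
    by (intro set_integral_diff integrable_sub(1)[OF ln_gap(1)]) auto
  have Di': "D i integrable_on {0..t}" "(\<lambda>s. \<bar>D i s\<bar>) integrable_on {0..t}" if "i < n" for i
    using Di[OF that] by (auto simp: absolutely_integrable_on_def)
  have eq: "ln (gap (x i) (x (Suc i)) t / gap (x 0) (x n) t) - ln (gap (x i) (x (Suc i)) 0 / gap (x 0) (x n) 0) = integral {0..t} (D i)"
    if i: "i < n" for i
  proof -
    have z: "0 \<in> {0..T}" using T by simp
    have "integral {0..t} (D i) = integral {0..t} (rate (x i) (x (Suc i))) - integral {0..t} (rate (x 0) (x n))"
      unfolding D_def using t T x[OF i] x_0_less_x_n by (intro integral_diff integrable_sub(2) ln_gap(1)) auto
    then show ?thesis
      using ln_gap(2)[OF x_0_less_x_n t] ln_gap(2)[OF x[OF i] t]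
        gap_pos[OF x_0_less_x_n t] gap_pos[OF x[OF i] t] gap_pos[OF x_0_less_x_n z] gap_pos[OF x[OF i] z]
      by (simp add: ln_div)
  qed
  have "(\<Sum>i<n. l i * \<bar>ln (gap (x i) (x (Suc i)) t / gap (x 0) (x n) t) - ln (gap (x i) (x (Suc i)) 0 / gap (x 0) (x n) 0)\<bar>)
     = (\<Sum>i<n. l i * \<bar>integral {0..t} (D i)\<bar>)"
    by (intro sum.cong) (auto simp: eq)
  also have "\<dots> \<le> (\<Sum>i<n. l i * integral {0..t} (\<lambda>s. \<bar>D i s\<bar>))"
    using l(1) integral_norm_bound_integral[OF Di'] by (intro sum_mono mult_left_mono) auto
  also have "\<dots> = integral {0..t} (\<lambda>s. \<Sum>i<n. l i * \<bar>D i s\<bar>)"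
    using Di' by (subst integral_sum) (auto intro!: integrable_on_mult_right)
  also have "\<dots> \<le> integral {0..t} (\<lambda>s. 9 * (5 * exp (9 * beta t)) * N s)"
  proof (rule integral_le)
    show "(\<lambda>s. \<Sum>i<n. l i * \<bar>D i s\<bar>) integrable_on {0..t}"
      using Di' by (intro integrable_sum integrable_on_mult_right) auto
    show "(\<lambda>s. 9 * (5 * exp (9 * beta t)) * N s) integrable_on {0..t}"
      using N_integrable[of 0 t "9 * (5 * exp (9 * beta t))"] t T absolutely_integrable_on_def by auto
    fix s assume s: "s \<in> {0..t}"
    then have sT: "s \<in> {0..T}" using t by auto
    have "(\<Sum>i<n. l i * \<bar>D i s\<bar>) \<le> 9 * N s * (entropy l x n s + 5)"
      unfolding D_def by (rule weighted_rate_bound[OF sT])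
    also have "\<dots> \<le> 9 * N s * (5 * exp (9 * beta t))"
      using entropy_le[OF t _ l0 s] t N_nonneg[of s] by (intro mult_left_mono) auto
    finally show "(\<Sum>i<n. l i * \<bar>D i s\<bar>) \<le> 9 * (5 * exp (9 * beta t)) * N s" by (simp add: ac_simps)
  qed
  also have "\<dots> = 45 * beta t * exp (9 * beta t)" by (simp add: beta_def)
  finally show ?thesis .
qed

end

text \<open>The two bounds come from the same differential inequality, run forwards from \<open>0\<close> to \<open>t\<close> for
  the weights at time \<open>0\<close> and backwards from \<open>t\<close> to \<open>0\<close> for the weights at time \<open>t\<close>.\<close>

lemma flow_partition_bounds:
  assumes x: "\<And>i. i < n \<Longrightarrow> x i < x (Suc i)" and n: "0 < n" and t: "t \<in> {0..T}"
  defines "l \<equiv> \<lambda>i. (x (Suc i) - x i) / (x n - x 0)"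
    and "m \<equiv> \<lambda>i. (flow t (x (Suc i)) - flow t (x i)) / (flow t (x n) - flow t (x 0))"
  shows "(\<Sum>i<n. l i * \<bar>ln (m i / l i)\<bar>) \<le> 45 * beta t * exp (9 * beta t)"
    and "(\<Sum>i<n. m i * ln (m i / l i)) \<le> 5 * exp (9 * beta t)"
proof -
  have z: "0 \<in> {0..T}" using T by simp
  have tel: "k \<le> n \<Longrightarrow> x 0 \<le> x k \<and> (0 < k \<longrightarrow> x 0 < x k)" for k
  proof (induction k)
    case (Suc k) then show ?case using x[of k] by auto
  qed simp
  have xn: "x 0 < x n" using tel[of n] n by simp
  have l: "l i = gap (x i) (x (Suc i)) 0 / gap (x 0) (x n) 0" for i by (simp add: l_def gap_def flow_solution)
  have m: "m i = gap (x i) (x (Suc i)) t / gap (x 0) (x n) t" for i by (simp add: m_def gap_def)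
  have lpos: "0 < l i" if "i < n" for i unfolding l using gap_pos[OF x[OF that] z] gap_pos[OF xn z] by simp
  have mpos: "0 < m i" if "i < n" for i unfolding m using gap_pos[OF x[OF that] t] gap_pos[OF xn t] by simp
  have sum: "(\<Sum>i<k. gap (x i) (x (Suc i)) s) = gap (x 0) (x k) s" for k s
    by (induction k) (auto simp: gap_def)
  have l1: "(\<Sum>i<n. l i) = 1" unfolding l using sum[of 0 n] gap_pos[OF xn z] by (simp add: sum_divide_distrib[symmetric])
  have m1: "(\<Sum>i<n. m i) = 1" unfolding m using sum[of t n] gap_pos[OF xn t] by (simp add: sum_divide_distrib[symmetric])
  have e0: "entropy l x n 0 = 0"
    unfolding entropy_def
  proof (rule sum.neutral, rule ballI)
    fix i assume "i \<in> {..<n}"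
    then have "l i * gap (x 0) (x n) 0 / gap (x i) (x (Suc i)) 0 = 1"
      using gap_pos[OF x z, of i] gap_pos[OF xn z] by (simp add: l)
    then show "l i * ln (l i * gap (x 0) (x n) 0 / gap (x i) (x (Suc i)) 0) = 0" by simp
  qed
  have et: "entropy m x n t = 0"
    unfolding entropy_def
  proof (rule sum.neutral, rule ballI)
    fix i assume "i \<in> {..<n}"
    then have "m i * gap (x 0) (x n) t / gap (x i) (x (Suc i)) t = 1"
      using gap_pos[OF x t, of i] gap_pos[OF xn t] by (simp add: m)
    then show "m i * ln (m i * gap (x 0) (x n) t / gap (x i) (x (Suc i)) t) = 0" by simp
  qed
  have "(\<Sum>i<n. l i * \<bar>ln (m i / l i)\<bar>) = (\<Sum>i<n. l i * \<bar>ln (m i) - ln (l i)\<bar>)"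
  proof (rule sum.cong)
    fix i assume "i \<in> {..<n}"
    then show "l i * \<bar>ln (m i / l i)\<bar> = l i * \<bar>ln (m i) - ln (l i)\<bar>"
      using lpos[of i] mpos[of i] by (simp add: ln_div)
  qed simp
  also have "\<dots> \<le> 45 * beta t * exp (9 * beta t)"
    unfolding m l(1)[symmetric]
    using sum_ln_gap_ratio_le[of n x l t, OF x _ l1 t e0] lpos by (simp add: l less_imp_le)
  finally show "(\<Sum>i<n. l i * \<bar>ln (m i / l i)\<bar>) \<le> 45 * beta t * exp (9 * beta t)" .
  have "(\<Sum>i<n. m i * ln (m i / l i)) = entropy m x n 0"
    unfolding entropy_def by (intro sum.cong) (auto simp: l)
  also have "\<dots> \<le> 5 * exp (9 * beta t)"
    using entropy_le[of n x m t t 0, OF x _ m1 t _ et] mpos t by (simp add: less_imp_le)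
  finally show "(\<Sum>i<n. m i * ln (m i / l i)) \<le> 5 * exp (9 * beta t)" .
qed

end

section \<open>Densities of functions with bounded partition entropy\<close>

lemma absolutely_integrable_iff_lebesgue_on:
  fixes f :: "real \<Rightarrow> real"
  assumes "S \<in> sets lebesgue"
  shows "f absolutely_integrable_on S \<longleftrightarrow> integrable (lebesgue_on S) f"
  using assms by (simp add: set_integrable_def integrable_restrict_space)

text \<open>The positive and the negative part of \<open>f\<close> are densities of finite measures
  that agree on half-lines, hence everywhere; uniqueness of densities finishes.\<close>

lemma AE_zero_of_tail_integrals:
  fixes f :: "real \<Rightarrow> real"
  assumes f: "integrable lborel f" and zero: "\<And>x. (LINT y|lborel. indicator {x<..} y * f y) = 0"
  shows "AE x in lborel. f x = 0"
proof -
  have fm [measurable]: "f \<in> borel_measurable borel" using f by auto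
  define P N where "P = (\<lambda>x. max 0 (f x))" and "N = (\<lambda>x. max 0 (- f x))"
  have [measurable]: "P \<in> borel_measurable borel" "N \<in> borel_measurable borel" by (auto simp: P_def N_def)
  have PN: "integrable lborel P" "integrable lborel N" unfolding P_def N_def using f by auto
  have fin: "(\<integral>\<^sup>+x. ennreal (P x) \<partial>lborel) \<noteq> \<infinity>" "(\<integral>\<^sup>+x. ennreal (N x) \<partial>lborel) \<noteq> \<infinity>"
    using PN by (auto simp: integrable_iff_bounded P_def N_def nn_integral_eq_integral)
  have "density lborel (\<lambda>x. ennreal (P x)) = density lborel (\<lambda>x. ennreal (N x))"
  proof (rule measure_eqI_lessThan)
    fix x :: real
    have i: "integrable lborel (\<lambda>y. indicator {x<..} y * P y)" "integrable lborel (\<lambda>y. indicator {x<..} y * N y)"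
      using integrable_mult_indicator[OF _ PN(1), of "{x<..}"] integrable_mult_indicator[OF _ PN(2), of "{x<..}"] by auto
    have e: "emeasure (density lborel (\<lambda>x. ennreal (g x))) {x<..} = ennreal (LINT y|lborel. indicator {x<..} y * g y)"
      if [measurable]: "g \<in> borel_measurable borel" and g: "\<And>y. 0 \<le> g y" "integrable lborel (\<lambda>y. indicator {x<..} y * g y)" for g
    proof -
      have "emeasure (density lborel (\<lambda>x. ennreal (g x))) {x<..} = (\<integral>\<^sup>+y. ennreal (indicator {x<..} y * g y) \<partial>lborel)"
        by (subst emeasure_density) (auto intro!: nn_integral_cong split: split_indicator)
      also have "\<dots> = ennreal (LINT y|lborel. indicator {x<..} y * g y)"
        using g by (intro nn_integral_eq_integral) auto
      finally show ?thesis .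
    qed
    have "(LINT y|lborel. indicator {x<..} y * P y) - (LINT y|lborel. indicator {x<..} y * N y) = (LINT y|lborel. indicator {x<..} y * P y - indicator {x<..} y * N y)"
      using i by simp
    also have "\<dots> = (LINT y|lborel. indicator {x<..} y * f y)"
      by (intro Bochner_Integration.integral_cong) (auto simp: P_def N_def split: split_indicator)
    finally have "(LINT y|lborel. indicator {x<..} y * P y) = (LINT y|lborel. indicator {x<..} y * N y)"
      using zero by simp
    then show "emeasure (density lborel (\<lambda>x. ennreal (P x))) {x<..} = emeasure (density lborel (\<lambda>x. ennreal (N x))) {x<..}"
      using e[of P] e[of N] i by (simp add: P_def N_def)
    show "emeasure (density lborel (\<lambda>x. ennreal (P x))) {x<..} < \<infinity>"
      using e[of P] i by (simp add: P_def)
  qed auto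
  then have "AE x in lborel. ennreal (P x) = ennreal (N x)"
    using finite_density_unique[of "\<lambda>x. ennreal (P x)" lborel "\<lambda>x. ennreal (N x)"] fin by simp
  then show ?thesis
  proof eventually_elim
    case (elim x)
    then have "P x = N x" by (simp add: P_def N_def)
    then show ?case unfolding P_def N_def by (auto simp: max_def split: if_splits)
  qed
qed

text \<open>The extension of \<open>f\<close> by zero has a Borel version, whose tail integrals are
  differences of the vanishing indefinite integrals.\<close>

lemma AE_zero_of_indefinite_integral:
  fixes f :: "real \<Rightarrow> real"
  assumes f: "f absolutely_integrable_on {p..q}" and zero: "\<And>x. x \<in> {p..q} \<Longrightarrow> integral {p..x} f = 0"
  shows "AE x in lebesgue. x \<in> {p..q} \<longrightarrow> f x = 0"
proof -
  define F where "F = (\<lambda>x. indicator {p..q} x * f x)"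
  have F: "integrable lebesgue F" using f by (simp add: set_integrable_def F_def)
  have "\<exists>g\<in>borel_measurable lborel. AE x in lborel. F x = g x"
    using F by (intro completion_ex_borel_measurable_real borel_measurable_integrable)
  then obtain g where g: "g \<in> borel_measurable lborel" "AE x in lborel. F x = g x"
    by (rule bexE)
  have gL: "AE x in lebesgue. F x = g x" using g(2) by (rule AE_completion)
  have gi: "integrable lebesgue g"
    using integrable_cong_AE_imp[OF F measurable_completion[OF g(1)]] gL by (simp add: eq_commute)
  then have gb: "integrable lborel g" using g(1) by (simp add: integrable_completion)
  have "AE x in lborel. g x = 0"
  proof (rule AE_zero_of_tail_integrals[OF gb])
    fix x
    have tail: "(\<lambda>y. indicator {x<..} y * h y) \<in> borel_measurable lebesgue"
      if "h \<in> borel_measurable lebesgue" for h :: "real \<Rightarrow> real"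
      by (intro borel_measurable_times borel_measurable_indicator that) auto
    have "(LINT y|lborel. indicator {x<..} y * g y) = (LINT y|lebesgue. indicator {x<..} y * g y)"
      using g(1) by (intro integral_completion[symmetric]) auto
    also have "\<dots> = (LINT y|lebesgue. indicator {x<..} y * F y)"
      using gL by (intro integral_cong_AE tail borel_measurable_integrable F gi) auto
    also have "\<dots> = 0"
    proof (cases "q < x \<or> q < p")
      case True
      then have "(\<lambda>y. indicator {x<..} y * F y) = (\<lambda>y. 0)" by (auto simp: F_def fun_eq_iff split: split_indicator)
      then show ?thesis by simp
    next
      case False
      define x' where "x' = max p x"
      have x': "x' \<in> {p..q}" using False by (auto simp: x'_def)
      have fi: "f integrable_on {p..q}" using f absolutely_integrable_on_def by blast
      have "{x'..q} \<subseteq> {p..q}" using x' by auto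
      then have f': "f absolutely_integrable_on {x'..q}" using absolutely_integrable_on_subinterval[OF f] by simp
      have "(LINT y|lebesgue. indicator {x<..} y * F y) = (LINT y:{x'..q}|lebesgue. f y)"
        unfolding set_lebesgue_integral_def
      proof (rule integral_cong_AE)
        have "AE y in lebesgue. y \<noteq> x'"
          by (rule AE_completion) (rule AE_lborel_singleton)
        then show "AE y in lebesgue. indicator {x<..} y * F y = indicat_real {x'..q} y *\<^sub>R f y"
          by eventually_elim (auto simp: F_def x'_def split: split_indicator)
        show "(\<lambda>y. indicator {x<..} y * F y) \<in> borel_measurable lebesgue"
          by (intro tail borel_measurable_integrable F)
        show "(\<lambda>y. indicat_real {x'..q} y *\<^sub>R f y) \<in> borel_measurable lebesgue"
          using f' by (auto simp: set_integrable_def)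
      qed
      also have "\<dots> = integral {x'..q} f" using f' by (rule set_lebesgue_integral_eq_integral)
      also have "\<dots> = integral {p..q} f - integral {p..x'} f"
        using integral_initial_segment[OF fi, of x' q] x' by auto
      also have "\<dots> = 0" using zero[of q] zero[of x'] x' by auto
      finally show ?thesis .
    qed
    finally show "(LINT y|lborel. indicator {x<..} y * g y) = 0" .
  qed
  then have "AE x in lebesgue. g x = 0" by (rule AE_completion)
  with gL show ?thesis by eventually_elim (auto simp: F_def)
qed

section \<open>Dyadic slopes as a martingale, and comparison of distances\<close>

lemma dyadic_slope_pos:
  "p < q \<Longrightarrow> (\<And>x y. x < y \<Longrightarrow> v x < v y) \<Longrightarrow> 0 < dyadic_slope n v p q x"
  by (induction n arbitrary: p q) auto

text \<open>The martingale property: tested against a function of the slope of level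
  \<open>n\<close>, the finer slope of level \<open>m\<close> acts like the slope of level
  \<open>n\<close>.\<close>

lemma has_integral_dyadic_slope_mult:
  "p < q \<Longrightarrow> n \<le> m \<Longrightarrow>
    ((\<lambda>x. dyadic_slope m v p q x * G (dyadic_slope n v p q x)) has_integral dyadic_sum n (\<lambda>y. y * G y) v p q) {p..q}"
proof (induction n arbitrary: m p q)
  case 0
  have "((\<lambda>x. dyadic_slope m v p q x * G ((v q - v p) / (q - p))) has_integral (v q - v p) * G ((v q - v p) / (q - p))) {p..q}"
    using has_integral_dyadic_slope[of p q "\<lambda>y. y" m v] dyadic_sum_id[of p q m v] 0
    by (intro has_integral_mult_left) auto
  then show ?case using 0 by simp
next
  case (Suc n)
  let ?m = "(p + q) / 2"
  have mm: "p < ?m" "?m < q" using Suc.prems by auto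
  obtain k where k: "m = Suc k" "n \<le> k" using Suc.prems by (metis Suc_le_D Suc_le_mono)
  have "((\<lambda>x. dyadic_slope m v p q x * G (dyadic_slope (Suc n) v p q x)) has_integral dyadic_sum n (\<lambda>y. y * G y) v p ?m) {p..?m}"
    by (rule has_integral_spike_finite[OF _ _ Suc.IH[OF mm(1) k(2)], of "{?m}"]) (auto simp: k)
  moreover have "((\<lambda>x. dyadic_slope m v p q x * G (dyadic_slope (Suc n) v p q x)) has_integral dyadic_sum n (\<lambda>y. y * G y) v ?m q) {?m..q}"
    by (rule has_integral_spike_finite[OF _ _ Suc.IH[OF mm(2) k(2)], of "{}"]) (auto simp: k)
  ultimately show ?case using has_integral_combine[of p ?m q] mm by simp
qed

lemma sum_lessThan_plus: "(\<Sum>i<a + b. f i) = (\<Sum>i<a. f i) + (\<Sum>i<b::nat. f (a + i) :: real)"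
  by (induction b) auto

lemma dyadic_sum_points:
  "dyadic_sum n G v p q = (\<Sum>i<2 ^ n. (q - p) / 2 ^ n *
     G ((v (p + real (Suc i) * ((q - p) / 2 ^ n)) - v (p + real i * ((q - p) / 2 ^ n))) / ((q - p) / 2 ^ n)))"
proof (induction n arbitrary: p q)
  case (Suc n)
  let ?m = "(p + q) / 2"
  define h where "h = (q - p) / 2 ^ Suc n"
  define F where "F = (\<lambda>i. h * G ((v (p + real (Suc i) * h) - v (p + real i * h)) / h))"
  have h1: "(?m - p) / 2 ^ n = h" "(q - ?m) / 2 ^ n = h" by (simp_all add: h_def field_simps)
  have m: "?m + real k * h = p + real (2 ^ n + k) * h" for k
    by (simp add: h_def field_simps)
  have "dyadic_sum (Suc n) G v p q = (\<Sum>i<2 ^ n. F i) + (\<Sum>i<2 ^ n. F (2 ^ n + i))"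
    unfolding dyadic_sum.simps Suc.IH h1 m F_def by simp
  also have "\<dots> = (\<Sum>i<2 ^ Suc n. F i)" using sum_lessThan_plus[of F "2 ^ n" "2 ^ n"] by (simp add: mult_2)
  finally show ?case by (simp add: F_def h_def)
qed simp

text \<open>This is \<open>ln z <= z - 1\<close> at \<open>z = sqrt b / sqrt a\<close>. The terms
  \<open>- a + b\<close> make the entropy density nonnegative pointwise and cancel on integrating
  two densities of equal mass.\<close>

lemma hellinger_le_entropy:
  fixes a b :: real
  assumes "0 < a" "0 < b"
  shows "(sqrt a - sqrt b)^2 \<le> a * ln (a / b) - a + b"
proof -
  have "ln (sqrt b / sqrt a) \<le> sqrt b / sqrt a - 1" using assms by (intro ln_le_minus_one) auto
  moreover have "ln (a / b) = - 2 * ln (sqrt b / sqrt a)" using assms by (simp add: ln_div ln_sqrt)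
  ultimately have "2 * (1 - sqrt b / sqrt a) \<le> ln (a / b)" by simp
  then have "a * (2 * (1 - sqrt b / sqrt a)) \<le> a * ln (a / b)" using assms by (intro mult_left_mono) auto
  moreover have "a * (2 * (1 - sqrt b / sqrt a)) = 2 * a - 2 * (a / sqrt a * sqrt b)"
    by (simp add: algebra_simps)
  then have "a * (2 * (1 - sqrt b / sqrt a)) = 2 * a - 2 * (sqrt a * sqrt b)"
    using assms by (simp only: real_div_sqrt less_imp_le)
  moreover have "(sqrt a - sqrt b)^2 = a + b - 2 * (sqrt a * sqrt b)"
    using assms by (simp add: power2_diff)
  ultimately show ?thesis by simp
qed

text \<open>The difference factors into \<open>sqrt a - sqrt b\<close> and
  \<open>sqrt a + sqrt b\<close>; the weighted arithmetic-geometric inequality with the free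
  parameter \<open>e\<close> does the work of Cauchy--Schwarz.\<close>

lemma abs_diff_le_hellinger:
  fixes a b e :: real
  assumes "0 < a" "0 < b" "0 < e"
  shows "\<bar>a - b\<bar> \<le> (sqrt a - sqrt b)^2 / e + e * (a + b)"
proof -
  define x y where "x = \<bar>sqrt a - sqrt b\<bar>" and "y = sqrt a + sqrt b"
  have "a - b = (sqrt a - sqrt b) * (sqrt a + sqrt b)" using assms by (simp add: algebra_simps)
  then have "\<bar>a - b\<bar> = x * y" using assms by (simp add: x_def y_def abs_mult)
  moreover have "0 \<le> (x - e * y / 2)^2" by simp
  then have "x * y * e \<le> x^2 + (e * y)^2 / 4" by (simp add: power2_eq_square algebra_simps)
  moreover have "y^2 \<le> 4 * (a + b)"
  proof -
    have "y^2 + (sqrt a - sqrt b)^2 = 2 * (a + b)" using assms by (simp add: y_def power2_eq_square algebra_simps)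
    then show ?thesis using assms by (smt (verit) zero_le_power2)
  qed
  then have "(e * y)^2 / 4 \<le> e * e * (a + b)" using assms by (simp add: power_mult_distrib power2_eq_square[of e] mult_left_mono)
  moreover from calculation(1) have "\<bar>a - b\<bar> * e = x * y * e" by simp
  ultimately have "\<bar>a - b\<bar> * e \<le> x^2 + e * e * (a + b)" by linarith
  then have "\<bar>a - b\<bar> \<le> (x^2 + e * e * (a + b)) / e" using assms by (simp add: pos_le_divide_eq)
  also have "\<dots> = x^2 / e + e * (a + b)" using assms by (simp add: add_divide_distrib)
  finally show ?thesis by (simp add: x_def)
qed

text \<open>All that is retained of the flow at one time: monotonicity and two bounds uniform over
  partitions. \<open>K2\<close> yields continuity and the convergence of the slopes, thus absolute
  continuity; \<open>K1\<close> yields the positivity of the density and the size of its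
  logarithm.\<close>

locale partition_bounded =
  fixes psi :: "real \<Rightarrow> real" and K1 K2 :: real
  assumes strict: "s < t \<Longrightarrow> psi s < psi t"
    and log_bound: "(\<And>i. i < n \<Longrightarrow> x i < x (Suc i)) \<Longrightarrow> 0 < n \<Longrightarrow>
      (\<Sum>i<n. (x (Suc i) - x i) / (x n - x 0) *
        \<bar>ln ((psi (x (Suc i)) - psi (x i)) / (psi (x n) - psi (x 0)) / ((x (Suc i) - x i) / (x n - x 0)))\<bar>) \<le> K1"
    and entropy_bound: "(\<And>i. i < n \<Longrightarrow> x i < x (Suc i)) \<Longrightarrow> 0 < n \<Longrightarrow>
      (\<Sum>i<n. (psi (x (Suc i)) - psi (x i)) / (psi (x n) - psi (x 0)) *
        ln ((psi (x (Suc i)) - psi (x i)) / (psi (x n) - psi (x 0)) / ((x (Suc i) - x i) / (x n - x 0)))) \<le> K2"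
begin

text \<open>Partition \<open>{x - 1..x + 1}\<close> at \<open>p\<close> and \<open>q\<close>. The
  outer cells contribute to the entropy at least what \<open>mult_ln_ge\<close> says, so the entropy
  bound limits how much image a short middle cell can carry: a logarithmic modulus of
  continuity.\<close>

lemma short_interval:
  assumes "x - 1 < p" "p < q" "q < x + 1"
  shows "(psi q - psi p) * ln (2 / (q - p)) \<le> (K2 + 1) * (psi (x + 1) - psi (x - 1))"
proof -
  define y where "y = (\<lambda>i::nat. if i = 0 then x - 1 else if i = 1 then p else if i = 2 then q else x + 1)"
  define L where "L = psi (x + 1) - psi (x - 1)"
  define m0 m1 m2 where "m0 = (psi p - psi (x - 1)) / L" and "m1 = (psi q - psi p) / L" and "m2 = (psi (x + 1) - psi q) / L"
  define l0 l1 l2 where "l0 = (p - (x - 1)) / 2" and "l1 = (q - p) / 2" and "l2 = (x + 1 - q) / 2"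
  have L: "0 < L" using strict[of "x - 1" "x + 1"] by (simp add: L_def)
  have pos: "0 < m0" "0 < m1" "0 < m2" "0 < l0" "0 < l1" "0 < l2"
    using assms strict L by (auto simp: m0_def m1_def m2_def l0_def l1_def l2_def)
  have m: "m0 + m1 + m2 = 1" using L unfolding m0_def m1_def m2_def by (simp add: add_divide_distrib[symmetric] L_def)
  have l: "l0 + l1 + l2 = 1" unfolding l0_def l1_def l2_def by (simp add: field_simps)
  have "i < 3 \<Longrightarrow> y i < y (Suc i)" for i using assms by (auto simp: y_def split: if_splits)
  from entropy_bound[of 3 y, OF this]
  have "m0 * ln (m0 / l0) + m1 * ln (m1 / l1) + m2 * ln (m2 / l2) \<le> K2"
    by (simp add: numeral_3_eq_3 y_def m0_def m1_def m2_def l0_def l1_def l2_def L_def)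
  moreover have "m0 - l0 \<le> m0 * ln (m0 / l0)" "m2 - l2 \<le> m2 * ln (m2 / l2)"
    using pos by (auto intro!: mult_ln_ge)
  moreover have "m1 - 1 \<le> m1 * ln m1" using mult_ln_ge[of m1 1] pos by simp
  moreover have "m1 * ln (m1 / l1) = m1 * ln m1 + m1 * ln (2 / (q - p))"
  proof -
    have "m1 / l1 = m1 * (2 / (q - p))" by (simp add: l1_def)
    moreover have "ln (m1 * (2 / (q - p))) = ln m1 + ln (2 / (q - p))"
      using pos(2) assms by (intro ln_mult_pos) auto
    ultimately show ?thesis by (simp add: distrib_left)
  qed
  ultimately have "m1 * ln (2 / (q - p)) \<le> K2 + 1" using pos m l by simp
  then show ?thesis using L unfolding m1_def L_def[symmetric] by (simp add: pos_divide_le_eq)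
qed

lemma continuous_psi: "continuous_on S psi"
proof -
  have "isCont psi x" for x
    unfolding continuous_at_eps_delta
  proof (intro allI impI)
    fix e :: real assume e: "0 < e"
    define B where "B = \<bar>(K2 + 1) * (psi (x + 1) - psi (x - 1))\<bar> + 1"
    \<comment> \<open>Below \<open>2 * exp (- (B / e))\<close> the logarithm in
      \<open>short_interval\<close> exceeds \<open>B / e\<close>; the cap at 1 keeps the points
      inside the window around \<open>x\<close>.\<close>
    define d where "d = min 1 (2 * exp (- (B / e)))"
    have B: "0 < B / e" using e by (simp add: B_def add_nonneg_pos)
    have small: "psi q - psi p < e" if "x - 1 < p" "p < q" "q < x + 1" "q - p < d" for p q
    proof -
      have "q - p < 2 * exp (- (B / e))" using that by (simp add: d_def)
      then have "exp (B / e) < 2 / (q - p)" using that by (simp add: exp_minus field_simps)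
      then have "B / e < ln (2 / (q - p))"
        by (metis exp_gt_zero ln_exp ln_less_cancel_iff order_less_trans)
      then have "(psi q - psi p) * (B / e) \<le> (psi q - psi p) * ln (2 / (q - p))"
        using strict[OF that(2)] by (intro mult_left_mono) auto
      also have "\<dots> < B" using short_interval[OF that(1-3)] by (simp add: B_def)
      finally have "(psi q - psi p) * (B / e) < e * (B / e)" using e by simp
      then show ?thesis using B by (metis mult_less_cancel_right_pos)
    qed
    have "dist (psi y) (psi x) < e" if "dist y x < d" for y
    proof -
      have d: "\<bar>y - x\<bar> < d" "\<bar>y - x\<bar> < 1" using that by (auto simp: dist_real_def d_def)
      consider "x < y" | "y < x" | "x = y" by linarith
      then show ?thesis
      proof cases
        case 1 then show ?thesis using small[of x y] strict[OF 1] d by (simp add: dist_real_def)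
      next
        case 2 then show ?thesis using small[of y x] strict[OF 2] d by (simp add: dist_real_def)
      qed (use e in simp)
    qed
    moreover have "0 < d" by (simp add: d_def)
    ultimately show "\<exists>d>0. \<forall>y. dist y x < d \<longrightarrow> dist (psi y) (psi x) < e" by blast
  qed
  then show ?thesis by (simp add: continuous_at_imp_continuous_on)
qed

context
  fixes p q c :: real
  assumes pq: "p < q" and c_def: "c = (psi q - psi p) / (q - p)"
begin

lemma c_pos: "0 < c" using strict[OF pq] pq by (simp add: c_def)

abbreviation "W n \<equiv> dyadic_slope n psi p q"

lemma W_pos: "0 < W n x" by (rule dyadic_slope_pos[OF pq strict])

lemma dyadic_points:
  obtains x :: "nat \<Rightarrow> real" and h where "0 < h" "\<And>i. x (Suc i) - x i = h" "x 0 = p" "x (2 ^ n) = q" "q - p = 2 ^ n * h"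
    "\<And>G. dyadic_sum n G psi p q = (\<Sum>i<2 ^ n. h * G ((psi (x (Suc i)) - psi (x i)) / h))"
proof
  define h x where "h = (q - p) / 2 ^ n" and "x = (\<lambda>i. p + real i * h)"
  show "0 < h" using pq by (simp add: h_def)
  show "x (Suc i) - x i = h" for i by (simp add: x_def algebra_simps)
  show "x 0 = p" "x (2 ^ n) = q" "q - p = 2 ^ n * h" by (simp_all add: x_def h_def)
  show "dyadic_sum n G psi p q = (\<Sum>i<2 ^ n. h * G ((psi (x (Suc i)) - psi (x i)) / h))" for G
    unfolding dyadic_sum_points[of n G] x_def h_def ..
qed

lemma dyadic_log_bound: "dyadic_sum n (\<lambda>y. \<bar>ln (y / c)\<bar>) psi p q \<le> K1 * (q - p)"
proof -
  obtain x h where x: "0 < h" "\<And>i. x (Suc i) - x i = h" "x 0 = p" "x (2 ^ n) = q" "q - p = 2 ^ n * h"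
    "\<And>G. dyadic_sum n G psi p q = (\<Sum>i<2 ^ n. h * G ((psi (x (Suc i)) - psi (x i)) / h))"
    by (rule dyadic_points[of n], rule that, assumption+)
  have inc: "x i < x (Suc i)" for i using x(1) x(2)[of i] by linarith
  have e: "(psi (x (Suc i)) - psi (x i)) / (psi q - psi p) / (h / (q - p)) = (psi (x (Suc i)) - psi (x i)) / h / c" for i
    by (simp add: c_def)
  have "(\<Sum>i<2 ^ n. h / (q - p) * \<bar>ln ((psi (x (Suc i)) - psi (x i)) / h / c)\<bar>) \<le> K1"
    using log_bound[of "2 ^ n" x] inc unfolding x(2,3,4) e by simp
  then have "(q - p) * (\<Sum>i<2 ^ n. h / (q - p) * \<bar>ln ((psi (x (Suc i)) - psi (x i)) / h / c)\<bar>) \<le> (q - p) * K1"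
    using pq by (intro mult_left_mono) auto
  moreover have "(q - p) * (\<Sum>i<2 ^ n. h / (q - p) * \<bar>ln ((psi (x (Suc i)) - psi (x i)) / h / c)\<bar>) = dyadic_sum n (\<lambda>y. \<bar>ln (y / c)\<bar>) psi p q"
    unfolding x(6) sum_distrib_left using pq by (intro sum.cong) auto
  ultimately show ?thesis by (simp add: mult.commute)
qed

lemma dyadic_entropy_bound: "dyadic_sum n (\<lambda>y. y * ln (y / c)) psi p q \<le> K2 * (psi q - psi p)"
proof -
  obtain x h where x: "0 < h" "\<And>i. x (Suc i) - x i = h" "x 0 = p" "x (2 ^ n) = q" "q - p = 2 ^ n * h"
    "\<And>G. dyadic_sum n G psi p q = (\<Sum>i<2 ^ n. h * G ((psi (x (Suc i)) - psi (x i)) / h))"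
    by (rule dyadic_points[of n], rule that, assumption+)
  have inc: "x i < x (Suc i)" for i using x(1) x(2)[of i] by linarith
  have e: "(psi (x (Suc i)) - psi (x i)) / (psi q - psi p) / (h / (q - p)) = (psi (x (Suc i)) - psi (x i)) / h / c" for i
    by (simp add: c_def)
  have d: "0 < psi q - psi p" using strict[OF pq] by simp
  have "(\<Sum>i<2 ^ n. (psi (x (Suc i)) - psi (x i)) / (psi q - psi p) * ln ((psi (x (Suc i)) - psi (x i)) / h / c)) \<le> K2"
    using entropy_bound[of "2 ^ n" x] inc unfolding x(2,3,4) e by simp
  then have "(psi q - psi p) * (\<Sum>i<2 ^ n. (psi (x (Suc i)) - psi (x i)) / (psi q - psi p) * ln ((psi (x (Suc i)) - psi (x i)) / h / c)) \<le> (psi q - psi p) * K2"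
    using d by (intro mult_left_mono) auto
  moreover have "(psi q - psi p) * (\<Sum>i<2 ^ n. (psi (x (Suc i)) - psi (x i)) / (psi q - psi p) * ln ((psi (x (Suc i)) - psi (x i)) / h / c)) = dyadic_sum n (\<lambda>y. y * ln (y / c)) psi p q"
    unfolding x(6) sum_distrib_left using d x(1) by (intro sum.cong) auto
  ultimately show ?thesis by (simp add: mult.commute)
qed

abbreviation "H n \<equiv> dyadic_sum n (\<lambda>y. y * ln (y / c)) psi p q"

text \<open>\<open>ln (W n x / c)\<close> depends on the coarse slope only, so by the martingale
  property the cross term \<open>W m x * ln (W n x / c)\<close> has integral \<open>H n\<close>. The
  linear terms cancel because both slopes integrate to the same increment.\<close>

lemma has_integral_relative_entropy:
  assumes "n \<le> m"
  shows "((\<lambda>x. W m x * ln (W m x / W n x) - W m x + W n x) has_integral H m - H n) {p..q}"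
proof -
  have "((\<lambda>x. W m x * ln (W m x / c) - W m x * ln (W n x / c) - W m x + W n x) has_integral H m - H n - (psi q - psi p) + (psi q - psi p)) {p..q}"
    using has_integral_dyadic_slope[of p q "\<lambda>y. y * ln (y / c)" m psi] has_integral_dyadic_slope_mult[OF pq assms, of psi "\<lambda>y. ln (y / c)"]
      has_integral_dyadic_slope[of p q "\<lambda>y. y" _ psi] dyadic_sum_id[OF pq, of _ psi] pq
    by (intro has_integral_add has_integral_diff) auto
  moreover have "W m x * ln (W m x / c) - W m x * ln (W n x / c) = W m x * ln (W m x / W n x)" for x
    using W_pos[of m x] W_pos[of n x] c_pos by (simp add: ln_div algebra_simps)
  ultimately show ?thesis by simp
qed

lemma H_incseq: "n \<le> m \<Longrightarrow> H n \<le> H m"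
proof -
  assume nm: "n \<le> m"
  have "0 \<le> H m - H n"
  proof (rule has_integral_nonneg[OF has_integral_relative_entropy[OF nm]])
    show "0 \<le> W m x * ln (W m x / W n x) - W m x + W n x" for x
      using mult_ln_ge[of "W m x" "W n x"] W_pos[of m x] W_pos[of n x] by simp
  qed
  then show ?thesis by simp
qed

lemma W_L1_diff:
  assumes "n \<le> m" "0 < e"
  shows "integral {p..q} (\<lambda>x. \<bar>W m x - W n x\<bar>) \<le> (H m - H n) / e + e * (2 * (psi q - psi p))"
proof (rule has_integral_le)
  have "(\<lambda>x. W m x) absolutely_integrable_on {p..q}" "(\<lambda>x. W n x) absolutely_integrable_on {p..q}"
    by (rule dyadic_slope_absolutely_integrable[where G = "\<lambda>x. x", OF measurable_ident_sets[OF refl]])+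
  then have "(\<lambda>x. W m x - W n x) absolutely_integrable_on {p..q}" by (rule set_integral_diff)
  then show "((\<lambda>x. \<bar>W m x - W n x\<bar>) has_integral integral {p..q} (\<lambda>x. \<bar>W m x - W n x\<bar>)) {p..q}"
    by (simp add: absolutely_integrable_on_def integrable_integral)
  have "((\<lambda>x. W m x + W n x) has_integral (psi q - psi p) + (psi q - psi p)) {p..q}"
    using has_integral_dyadic_slope[of p q "\<lambda>y. y" _ psi] dyadic_sum_id[OF pq, of _ psi] pq
    by (intro has_integral_add) auto
  then have "((\<lambda>x. W m x + W n x) has_integral 2 * (psi q - psi p)) {p..q}" by simp
  then show "((\<lambda>x. (W m x * ln (W m x / W n x) - W m x + W n x) / e + e * (W m x + W n x)) has_integral
      (H m - H n) / e + e * (2 * (psi q - psi p))) {p..q}"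
    using has_integral_relative_entropy[OF assms(1)]
    by (intro has_integral_add has_integral_mult_right has_integral_divide)
  fix x
  have "(sqrt (W m x) - sqrt (W n x))^2 / e \<le> (W m x * ln (W m x / W n x) - W m x + W n x) / e"
    using hellinger_le_entropy[OF W_pos[of m x] W_pos[of n x]] assms(2) by (intro divide_right_mono) auto
  then show "\<bar>W m x - W n x\<bar> \<le> (W m x * ln (W m x / W n x) - W m x + W n x) / e + e * (W m x + W n x)"
    using abs_diff_le_hellinger[OF W_pos[of m x] W_pos[of n x] assms(2)] by linarith
qed

text \<open>\<open>H m - H n\<close> is the relative entropy of the dyadic slopes at level \<open>m\<close> with respect to those at
  level \<open>n\<close>, so bounded entropy makes them a Cauchy sequence.\<close>

lemma W_L1_Cauchy:
  assumes "0 < d"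
  shows "\<exists>k. \<forall>n\<ge>k. \<forall>m\<ge>n. integral {p..q} (\<lambda>x. \<bar>W m x - W n x\<bar>) \<le> d"
proof -
  define D where "D = psi q - psi p"
  have D: "0 < D" using strict[OF pq] by (simp add: D_def)
  \<comment> \<open>Balances the two terms of \<open>W_L1_diff\<close>: the mass term becomes
    \<open>d / 2\<close>, and a tail of \<open>H\<close> below \<open>d * e / 2\<close> accounts for
    the other half.\<close>
  define e where "e = d / (4 * D)"
  have e: "0 < e" using assms D by (simp add: e_def)
  have "incseq H" using H_incseq by (intro monoI) auto
  then obtain L where "H \<longlonglongrightarrow> L" "\<forall>n. H n \<le> L"
    using incseq_convergent[of H "K2 * D"] dyadic_entropy_bound by (auto simp: D_def)
  moreover have "0 < d * e / 2" using assms e by simp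
  ultimately obtain k where k: "\<And>n. n \<ge> k \<Longrightarrow> L - d * e / 2 < H n"
    by (metis (no_types, lifting) eventually_sequentially less_add_same_cancel1 add_diff_cancel_right' diff_add_cancel order_tendstoD(1) diff_strict_left_mono diff_zero)
  have "integral {p..q} (\<lambda>x. \<bar>W m x - W n x\<bar>) \<le> d" if "k \<le> n" "n \<le> m" for n m
  proof -
    have "H m - H n \<le> d * e / 2" using k[OF that(1)] \<open>\<forall>n. H n \<le> L\<close>[rule_format, of m] by linarith
    then have "(H m - H n) / e \<le> d / 2" using e by (simp add: field_simps)
    moreover have "e * (2 * D) = d / 2" using D by (simp add: e_def)
    ultimately show ?thesis using W_L1_diff[OF that(2) e] unfolding D_def[symmetric] by linarith
  qed
  then show ?thesis by blast
qed

abbreviation (input) "M \<equiv> lebesgue_on {p..q}"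

lemma integrable_W:
  fixes G :: "real \<Rightarrow> real"
  shows "G \<in> borel_measurable borel \<Longrightarrow> integrable M (\<lambda>x. G (W n x))"
  using dyadic_slope_absolutely_integrable[of G p q n psi p q] by (simp add: absolutely_integrable_iff_lebesgue_on)

text \<open>The argument of Riesz and Fischer: along a subsequence with summable \<open>L^1\<close>
  increments the slopes converge almost everywhere under an integrable majorant. Dominated
  convergence then identifies the indefinite integral of the limit, since the interpolants converge
  to \<open>psi\<close>.\<close>

lemma W_subsequence_limit:
  obtains r g where "strict_mono r" "integrable M g" "AE x in M. (\<lambda>k. W (r k) x) \<longlonglongrightarrow> g x"
    "\<And>x. x \<in> {p..q} \<Longrightarrow> integral {p..x} g = psi x - psi p"
proof -
  have "\<forall>j::nat. \<exists>k. \<forall>n\<ge>k. \<forall>m\<ge>n. integral {p..q} (\<lambda>x. \<bar>W m x - W n x\<bar>) \<le> (1/2) ^ j"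
    using W_L1_Cauchy by simp
  then obtain rho where rho: "\<And>j n m. rho j \<le> n \<Longrightarrow> n \<le> m \<Longrightarrow> integral {p..q} (\<lambda>x. \<bar>W m x - W n x\<bar>) \<le> (1/2) ^ j"
    by metis
  \<comment> \<open>The partial sums dominate each \<open>rho k\<close>, and the added
    \<open>k\<close> makes the sequence strictly increasing.\<close>
  define r where "r = (\<lambda>k. (\<Sum>j\<le>k. rho j) + k)"
  have r: "strict_mono r" unfolding strict_mono_Suc_iff by (simp add: r_def)
  have r_ge: "rho k \<le> r k" for k unfolding r_def by (simp add: sum.remove[of "{..k}" k] trans_le_add1)
  define F where "F = (\<lambda>k x. W (r (Suc k)) x - W (r k) x)"
  have Wi: "integrable M (W n)" for n using integrable_W[of "\<lambda>x. x" n] by simp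
  have Fi: "integrable M (F k)" for k unfolding F_def by (intro Bochner_Integration.integrable_diff Wi)
  have F_norm: "(LINT x|M. \<bar>F k x\<bar>) \<le> (1/2) ^ k" for k
  proof -
    have "(LINT x|M. \<bar>F k x\<bar>) = integral {p..q} (\<lambda>x. \<bar>F k x\<bar>)"
      using Fi[of k] by (intro lebesgue_integral_eq_integral) auto
    also have "\<dots> \<le> (1/2) ^ k"
      unfolding F_def using rho[OF r_ge, of k "r (Suc k)"] strict_mono_less_eq[OF r, of k "Suc k"] by simp
    finally show ?thesis .
  qed
  have Fsum: "AE x in M. summable (\<lambda>k. \<bar>F k x\<bar>)"
  proof -
    have "(\<integral>\<^sup>+x. (\<Sum>k. ennreal \<bar>F k x\<bar>) \<partial>M) = (\<Sum>k. \<integral>\<^sup>+x. ennreal \<bar>F k x\<bar> \<partial>M)"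
      using Fi by (intro nn_integral_suminf) auto
    also have "\<dots> \<le> (\<Sum>k. ennreal ((1/2) ^ k))"
      using F_norm Fi by (intro suminf_le) (auto simp: nn_integral_eq_integral intro!: ennreal_leI)
    also have "\<dots> = ennreal (\<Sum>k. (1/2) ^ k)"
      by (intro suminf_ennreal2) (auto simp: summable_geometric)
    finally have "(\<integral>\<^sup>+x. (\<Sum>k. ennreal \<bar>F k x\<bar>) \<partial>M) \<noteq> \<infinity>" by (auto simp: top_unique)
    then have "AE x in M. (\<Sum>k. ennreal \<bar>F k x\<bar>) \<noteq> \<infinity>"
      using Fi by (intro nn_integral_PInf_AE) auto
    then show ?thesis by eventually_elim (auto intro: summable_suminf_not_top)
  qed
  define h where "h = (\<lambda>x. W (r 0) x + (\<Sum>k. \<bar>F k x\<bar>))"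
  have hi: "integrable M h"
    unfolding h_def
  proof (intro Bochner_Integration.integrable_add Wi integrable_suminf)
    show "integrable M (\<lambda>x. \<bar>F k x\<bar>)" for k using Fi by auto
    show "AE x in M. summable (\<lambda>k. norm \<bar>F k x\<bar>)" using Fsum by simp
    show "summable (\<lambda>k. LINT x|M. norm \<bar>F k x\<bar>)"
      using F_norm by (intro summable_comparison_test[OF _ summable_geometric[of "1/2::real"]]) (auto intro!: exI[of _ 0])
  qed
  define g where "g = (\<lambda>x. W (r 0) x + (\<Sum>k. F k x))"
  have tel: "(\<Sum>i<k. F i x) = W (r k) x - W (r 0) x" for k x
    unfolding F_def by (rule sum_lessThan_telescope)
  have lim: "AE x in M. (\<lambda>k. W (r k) x) \<longlonglongrightarrow> g x"
    using Fsum
  proof eventually_elim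
    case (elim x)
    then have "summable (\<lambda>k. F k x)" by (rule summable_rabs_cancel)
    then have "(\<lambda>k. \<Sum>i<k. F i x) \<longlonglongrightarrow> (\<Sum>k. F k x)" by (rule summable_LIMSEQ)
    then have "(\<lambda>k. W (r 0) x + (\<Sum>i<k. F i x)) \<longlonglongrightarrow> g x" unfolding g_def by (intro tendsto_intros)
    then show ?case by (simp add: tel)
  qed
  have dom: "AE x in M. norm (W (r k) x) \<le> h x" for k
    using Fsum
  proof eventually_elim
    case (elim x)
    have "W (r k) x = W (r 0) x + (\<Sum>i<k. F i x)" by (simp add: tel)
    also have "\<dots> \<le> W (r 0) x + (\<Sum>i<k. \<bar>F i x\<bar>)" by (intro add_left_mono sum_mono) auto
    also have "\<dots> \<le> h x" unfolding h_def using elim by (intro add_left_mono sum_le_suminf) auto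
    finally show ?case using W_pos[of "r k" x] by simp
  qed
  have gm: "g \<in> borel_measurable M"
    unfolding g_def using Fi Wi by (intro borel_measurable_add borel_measurable_suminf borel_measurable_integrable)
  have gi: "integrable M g"
    using integrable_dominated_convergence[OF gm borel_measurable_integrable[OF Wi] hi lim dom] .
  have int: "integral {p..x} g = psi x - psi p" if x: "x \<in> {p..q}" for x
  proof -
    have conv: "(LINT y|M. indicator {p..x} y * u y) = integral {p..x} u" if u: "integrable M u" for u :: "real \<Rightarrow> real"
    proof -
      have "u absolutely_integrable_on {p..q}" using u by (simp add: absolutely_integrable_iff_lebesgue_on)
      moreover have "{p..x} \<subseteq> {p..q}" using x by auto
      ultimately have "u absolutely_integrable_on {p..x}" using absolutely_integrable_on_subinterval by blast
      then have "integral {p..x} u = (LINT y:{p..x}|lebesgue. u y)" by (simp add: set_lebesgue_integral_eq_integral)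
      also have "\<dots> = (LINT y|M. indicator {p..x} y * u y)"
        unfolding set_lebesgue_integral_def using x
        by (subst integral_restrict_space) (auto intro!: Bochner_Integration.integral_cong split: split_indicator)
      finally show ?thesis by simp
    qed
    have im: "(\<lambda>y. indicator {p..x} y * u y) \<in> borel_measurable M" if "u \<in> borel_measurable M" for u :: "real \<Rightarrow> real"
    proof (intro borel_measurable_times that borel_measurable_indicator)
      have "{p..x} = {p..q} \<inter> {p..x}" using x by auto
      then show "{p..x} \<in> sets M" by (metis lmeasurable_iff_integrable_on sets_restrict_space imageI fmeasurableD lmeasurable_interval(1))
    qed
    have "(\<lambda>k. LINT y|M. indicator {p..x} y * W (r k) y) \<longlonglongrightarrow> (LINT y|M. indicator {p..x} y * g y)"
    proof (rule integral_dominated_convergence[OF im[OF gm] im[OF borel_measurable_integrable[OF Wi]] hi])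
      show "AE y in M. (\<lambda>k. indicator {p..x} y * W (r k) y) \<longlonglongrightarrow> indicator {p..x} y * g y"
        using lim by eventually_elim (intro tendsto_intros)
      show "AE y in M. norm (indicator {p..x} y * W (r k) y) \<le> h y" for k
        using dom[of k] by eventually_elim (auto split: split_indicator)
    qed
    then have "(\<lambda>k. integral {p..x} (W (r k))) \<longlonglongrightarrow> integral {p..x} g" by (simp add: conv Wi gi)
    moreover have "(\<lambda>k. integral {p..x} (W (r k))) \<longlonglongrightarrow> psi x - psi p"
      using LIMSEQ_subseq_LIMSEQ[OF interpolation_tendsto[OF pq x continuous_psi] r] by (simp add: o_def)
    ultimately show ?thesis by (rule LIMSEQ_unique)
  qed
  show ?thesis using that[OF r gi lim int] .
qed

lemma density_on:
  obtains g where "g absolutely_integrable_on {p..q}" "\<And>x. x \<in> {p..q} \<Longrightarrow> integral {p..x} g = psi x - psi p"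
    "AE x in lebesgue. x \<in> {p..q} \<longrightarrow> 0 < g x" "(\<lambda>x. ln (g x) - ln c) absolutely_integrable_on {p..q}"
    "integral {p..q} (\<lambda>x. \<bar>ln (g x) - ln c\<bar>) \<le> K1 * (q - p)"
proof -
  obtain r g where r: "strict_mono r" and gi: "integrable M g" and lim: "AE x in M. (\<lambda>k. W (r k) x) \<longlonglongrightarrow> g x"
    and int: "\<And>x. x \<in> {p..q} \<Longrightarrow> integral {p..x} g = psi x - psi p" using W_subsequence_limit by blast
  define u where "u = (\<lambda>k x. \<bar>ln (W (r k) x / c)\<bar>)"
  have ui: "integrable M (u k)" for k
    unfolding u_def using integrable_W[of "\<lambda>y. \<bar>ln (y / c)\<bar>"] by simp
  have u_le: "(\<integral>\<^sup>+x. ennreal (u k x) \<partial>M) \<le> ennreal (K1 * (q - p))" for k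
  proof -
    have "(\<integral>\<^sup>+x. ennreal (u k x) \<partial>M) = ennreal (LINT x|M. u k x)"
      using ui by (intro nn_integral_eq_integral) (auto simp: u_def)
    also have "(LINT x|M. u k x) = integral {p..q} (u k)" using ui by (intro lebesgue_integral_eq_integral) auto
    also have "\<dots> = dyadic_sum (r k) (\<lambda>y. \<bar>ln (y / c)\<bar>) psi p q"
      unfolding u_def using has_integral_dyadic_slope[of p q "\<lambda>y. \<bar>ln (y / c)\<bar>" "r k" psi] pq by (simp add: integral_unique)
    finally show ?thesis using dyadic_log_bound by (simp add: ennreal_leI)
  qed
  have fatou: "(\<integral>\<^sup>+x. liminf (\<lambda>k. ennreal (u k x)) \<partial>M) \<le> ennreal (K1 * (q - p))"
  proof -
    have "(\<integral>\<^sup>+x. liminf (\<lambda>k. ennreal (u k x)) \<partial>M) \<le> liminf (\<lambda>k. \<integral>\<^sup>+x. ennreal (u k x) \<partial>M)"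
      using ui by (intro nn_integral_liminf) auto
    also have "\<dots> \<le> liminf (\<lambda>k. ennreal (K1 * (q - p)))" using u_le by (intro Liminf_mono) auto
    finally show ?thesis by (simp add: Liminf_const)
  qed
  then have "(\<integral>\<^sup>+x. liminf (\<lambda>k. ennreal (u k x)) \<partial>M) \<noteq> \<infinity>" by (auto simp: top_unique)
  then have "AE x in M. liminf (\<lambda>k. ennreal (u k x)) \<noteq> \<infinity>"
    using ui by (intro nn_integral_PInf_AE borel_measurable_liminf) auto
  with lim have main: "AE x in M. 0 < g x \<and> liminf (\<lambda>k. ennreal (u k x)) = ennreal \<bar>ln (g x / c)\<bar>"
  proof eventually_elim
    case (elim x)
    have "0 \<le> g x" using LIMSEQ_le_const[OF elim(1)] W_pos less_imp_le by blast
    \<comment> \<open>Where the density vanished, the logarithms of the slopes would tend to minus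
      infinity, against the finite lower limit provided by Fatou's lemma.\<close>
    have "g x \<noteq> 0"
    proof
      assume g0: "g x = 0"
      have "filterlim (\<lambda>k. W (r k) x / c) (at_right 0) sequentially"
        unfolding filterlim_at using tendsto_divide[OF elim(1) tendsto_const[of c]] W_pos c_pos g0
          by (auto simp: less_imp_neq[OF W_pos, symmetric])
      then have "filterlim (\<lambda>k. ln (W (r k) x / c)) at_bot sequentially"
        by (rule filterlim_compose[OF ln_at_0])
      then have "filterlim (\<lambda>k. u k x) at_top sequentially"
        unfolding u_def real_norm_def[symmetric]
        by (intro filterlim_at_infinity_imp_norm_at_top filterlim_mono[OF _ at_bot_le_at_infinity order_refl])
      then have "(\<lambda>k. ennreal (u k x)) \<longlonglongrightarrow> top" by (simp add: ennreal_tendsto_top_eq_at_top)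
      then have "liminf (\<lambda>k. ennreal (u k x)) = top" by (intro lim_imp_Liminf) auto
      then show False using elim(2) by simp
    qed
    then have g: "0 < g x" using \<open>0 \<le> g x\<close> by simp
    have "(\<lambda>k. ennreal (u k x)) \<longlonglongrightarrow> ennreal \<bar>ln (g x / c)\<bar>"
      unfolding u_def using g c_pos by (intro tendsto_ennrealI tendsto_rabs tendsto_ln tendsto_divide elim(1) tendsto_const) auto
    then show ?case using g by (auto intro!: lim_imp_Liminf)
  qed
  have gm: "g \<in> borel_measurable M" using gi by auto
  have Lm: "(\<lambda>x. ln (g x) - ln c) \<in> borel_measurable M" using gm by (intro borel_measurable_diff borel_measurable_ln) auto
  have AEe: "AE x in M. liminf (\<lambda>k. ennreal (u k x)) = ennreal \<bar>ln (g x) - ln c\<bar>"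
    using main by eventually_elim (use c_pos in \<open>auto simp: ln_div\<close>)
  have le: "(\<integral>\<^sup>+x. ennreal \<bar>ln (g x) - ln c\<bar> \<partial>M) \<le> ennreal (K1 * (q - p))"
    using fatou nn_integral_cong_AE[OF AEe] by simp
  then have Li: "integrable M (\<lambda>x. ln (g x) - ln c)"
    using Lm by (intro integrableI_bounded) (auto intro: le_less_trans)
  have K: "0 \<le> K1 * (q - p)"
    using dyadic_log_bound[of 0] dyadic_sum_nonneg[of "\<lambda>y. \<bar>ln (y / c)\<bar>" p q 0 psi] pq by simp
  have "ennreal (LINT x|M. \<bar>ln (g x) - ln c\<bar>) \<le> ennreal (K1 * (q - p))"
    using le Li by (subst nn_integral_eq_integral[symmetric]) auto
  then have "(LINT x|M. \<bar>ln (g x) - ln c\<bar>) \<le> K1 * (q - p)" using K by simp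
  moreover have "(LINT x|M. \<bar>ln (g x) - ln c\<bar>) = integral {p..q} (\<lambda>x. \<bar>ln (g x) - ln c\<bar>)"
    using Li by (intro lebesgue_integral_eq_integral) auto
  ultimately have "integral {p..q} (\<lambda>x. \<bar>ln (g x) - ln c\<bar>) \<le> K1 * (q - p)" by simp
  moreover have "AE x in lebesgue. x \<in> {p..q} \<longrightarrow> 0 < g x"
    using main by (subst (asm) AE_restrict_space_iff) auto
  ultimately show ?thesis
    using that[OF _ int] gi Li by (simp add: absolutely_integrable_iff_lebesgue_on)
qed

end

end

lemma AE_eq_on_imp:
  fixes f g :: "real \<Rightarrow> real"
  assumes "AE x in lebesgue. x \<in> S \<longrightarrow> f x = g x"
  shows "f absolutely_integrable_on S \<Longrightarrow> g absolutely_integrable_on S" "integral S f = integral S g"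
proof -
  obtain N where N: "negligible N" "{x. \<not> (x \<in> S \<longrightarrow> f x = g x)} \<subseteq> N"
    using assms unfolding eventually_ae_filter_negligible by blast
  have e: "g x = f x" if "x \<in> S - N" for x using N(2) that by auto
  show "f absolutely_integrable_on S \<Longrightarrow> g absolutely_integrable_on S"
    using absolutely_integrable_spike[OF _ N(1)] e by blast
  show "integral S f = integral S g" using integral_spike[OF N(1), of S g f] e by metis
qed

context partition_bounded begin

text \<open>\<open>density_on\<close> gives a separate density for each interval. One function
  positive everywhere is glued from the unit cells and then compared with the local density of an
  arbitrary interval to inherit the logarithmic bound.\<close>

lemma density:
  obtains g where "\<And>x. 0 < g x" "\<And>p q. g absolutely_integrable_on {p..q}"
    "\<And>p q. p \<le> q \<Longrightarrow> integral {p..q} g = psi q - psi p"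
    "\<And>p q. p < q \<Longrightarrow> (\<lambda>x. ln (g x) - ln ((psi q - psi p) / (q - p))) absolutely_integrable_on {p..q}"
    "\<And>p q. p < q \<Longrightarrow> integral {p..q} (\<lambda>x. \<bar>ln (g x) - ln ((psi q - psi p) / (q - p))\<bar>) \<le> K1 * (q - p)"
proof -
  have "\<exists>g. (\<forall>x. 0 < g x) \<and> g absolutely_integrable_on {real_of_int k..real_of_int k + 1} \<and>
      (\<forall>x\<in>{real_of_int k..real_of_int k + 1}. integral {real_of_int k..x} g = psi x - psi k)" for k
  proof -
    obtain g where g: "g absolutely_integrable_on {real_of_int k..real_of_int k + 1}"
      "\<And>x. x \<in> {real_of_int k..real_of_int k + 1} \<Longrightarrow> integral {real_of_int k..x} g = psi x - psi k"
      "AE x in lebesgue. x \<in> {real_of_int k..real_of_int k + 1} \<longrightarrow> 0 < g x"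
      using density_on[of "real_of_int k" "real_of_int k + 1", OF _ refl] by auto
    define g' where "g' = (\<lambda>x. if 0 < g x then g x else 1)"
    have ae: "AE x in lebesgue. x \<in> {real_of_int k..y} \<longrightarrow> g x = g' x" if "y \<le> real_of_int k + 1" for y
      using g(3) by eventually_elim (use that in \<open>auto simp: g'_def\<close>)
    have "g' absolutely_integrable_on {real_of_int k..real_of_int k + 1}" using AE_eq_on_imp(1)[OF ae g(1)] by simp
    moreover have "integral {real_of_int k..x} g' = psi x - psi k" if "x \<in> {real_of_int k..real_of_int k + 1}" for x
      using AE_eq_on_imp(2)[OF ae, of x] g(2)[OF that] that by simp
    ultimately show ?thesis by (intro exI[of _ g']) (auto simp: g'_def)
  qed
  then obtain gk where gk: "\<And>k x. 0 < gk k x" "\<And>k. gk k absolutely_integrable_on {real_of_int k..real_of_int k + 1}"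
    "\<And>k x. x \<in> {real_of_int k..real_of_int k + 1} \<Longrightarrow> integral {real_of_int k..x} (gk k) = psi x - psi k"
    by metis
  define G where "G = (\<lambda>x. gk \<lfloor>x\<rfloor> x)"
  have cell: "G absolutely_integrable_on {a..b} \<and> integral {a..b} G = psi b - psi a"
    if ab: "real_of_int k \<le> a" "a \<le> b" "b \<le> real_of_int k + 1" for a b k
  proof -
    have eq: "G x = gk k x" if "x \<in> {a..b} - {real_of_int k + 1}" for x
    proof -
      have "\<lfloor>x\<rfloor> = k" using that ab by (intro floor_unique) auto
      then show ?thesis by (simp add: G_def)
    qed
    have sub: "gk k absolutely_integrable_on {a..b}"
      using absolutely_integrable_on_subinterval[OF gk(2)[of k], of a b] ab by auto
    have "G absolutely_integrable_on {a..b}"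
      by (rule absolutely_integrable_spike[OF sub negligible_sing eq])
    moreover have "integral {a..b} G = integral {a..b} (gk k)"
      using integral_spike[OF negligible_sing[of "real_of_int k + 1"], of "{a..b}" "gk k" G] eq by simp
    moreover have "\<dots> = integral {real_of_int k..b} (gk k) - integral {real_of_int k..a} (gk k)"
      using integral_initial_segment[of "gk k" "real_of_int k" "real_of_int k + 1" a b] gk(2)[of k] ab
      by (simp add: absolutely_integrable_on_def)
    ultimately show ?thesis using gk(3)[of a k] gk(3)[of b k] ab by simp
  qed
  have main: "G absolutely_integrable_on {p..q} \<and> integral {p..q} G = psi q - psi p" if pq: "p \<le> q" for p q
  proof -
    have trans: "G absolutely_integrable_on {a..c} \<and> integral {a..c} G = psi c - psi a"
      if "a \<le> b" "b \<le> c" "G absolutely_integrable_on {a..b} \<and> integral {a..b} G = psi b - psi a"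
        "G absolutely_integrable_on {b..c} \<and> integral {b..c} G = psi c - psi b" for a b c
    proof -
      have i: "G absolutely_integrable_on {a..c}"
        using that by (intro absolutely_integrable_on_combine[of a b G c]) auto
      then have "integral {a..b} G + integral {b..c} G = integral {a..c} G"
        using that by (intro Henstock_Kurzweil_Integration.integral_combine) (auto simp: absolutely_integrable_on_def)
      then show ?thesis using that i by linarith
    qed
    \<comment> \<open>The claim is additive in the interval, so bisection reduces it to intervals
      shorter than 1, which meet at most two unit cells and are cut at the floor of
      \<open>b\<close>.\<close>
    define Q where "Q = (\<lambda>a b. a \<le> b \<longrightarrow> G absolutely_integrable_on {a..b} \<and> integral {a..b} G = psi b - psi a)"
    have "Q p q"
    proof (induction rule: Bolzano[OF pq])
      case (1 a b c)
      then show ?case unfolding Q_def using trans[of a b c] by blast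
    next
      case (2 x)
      have "Q a b" if "a \<le> x" "x \<le> b" "b - a < 1" for a b
      proof (cases "real_of_int \<lfloor>b\<rfloor> \<le> a")
        case True
        then show ?thesis unfolding Q_def using cell[of "\<lfloor>b\<rfloor>" a b] that by linarith
      next
        case False
        have b: "real_of_int \<lfloor>b\<rfloor> \<le> b" by simp
        have l: "real_of_int (\<lfloor>b\<rfloor> - 1) \<le> a" "a \<le> real_of_int \<lfloor>b\<rfloor>" "real_of_int \<lfloor>b\<rfloor> \<le> real_of_int (\<lfloor>b\<rfloor> - 1) + 1"
          using False that b by (simp_all, linarith)
        have r: "real_of_int \<lfloor>b\<rfloor> \<le> real_of_int \<lfloor>b\<rfloor>" "b \<le> real_of_int \<lfloor>b\<rfloor> + 1" by (simp, linarith)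
        show ?thesis unfolding Q_def using trans[OF l(2) b cell[OF l] cell[OF r(1) b r(2)]] by simp
      qed
      then show ?case by (intro exI[of _ 1]) auto
    qed
    then show ?thesis using pq by (simp add: Q_def)
  qed
  have Gai: "G absolutely_integrable_on {p..q}" for p q
    using main[of p q] by (cases "p \<le> q") auto
  have logs: "(\<lambda>x. ln (G x) - ln ((psi q - psi p) / (q - p))) absolutely_integrable_on {p..q} \<and>
      integral {p..q} (\<lambda>x. \<bar>ln (G x) - ln ((psi q - psi p) / (q - p))\<bar>) \<le> K1 * (q - p)" if pq: "p < q" for p q
  proof -
    define c where "c = (psi q - psi p) / (q - p)"
    obtain g where g: "g absolutely_integrable_on {p..q}" "\<And>x. x \<in> {p..q} \<Longrightarrow> integral {p..x} g = psi x - psi p"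
      "(\<lambda>x. ln (g x) - ln c) absolutely_integrable_on {p..q}"
      "integral {p..q} (\<lambda>x. \<bar>ln (g x) - ln c\<bar>) \<le> K1 * (q - p)"
      by (rule density_on[OF pq c_def], rule that, assumption+)
    \<comment> \<open>Both densities have the increments of \<open>psi\<close> as integrals over
      initial segments, so their difference has vanishing indefinite integral.\<close>
    have "AE x in lebesgue. x \<in> {p..q} \<longrightarrow> g x - G x = 0"
    proof (rule AE_zero_of_indefinite_integral)
      show "(\<lambda>x. g x - G x) absolutely_integrable_on {p..q}" by (intro set_integral_diff g(1) Gai)
      fix x assume x: "x \<in> {p..q}"
      have "g absolutely_integrable_on {p..x}"
        using absolutely_integrable_on_subinterval[OF g(1), of p x] x by auto
      then have "integral {p..x} (\<lambda>x. g x - G x) = integral {p..x} g - integral {p..x} G"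
        using Gai[of p x] by (intro integral_diff) (auto simp: absolutely_integrable_on_def)
      then show "integral {p..x} (\<lambda>x. g x - G x) = 0" using g(2)[OF x] main[of p x] x by simp
    qed
    then have ae: "AE x in lebesgue. x \<in> {p..q} \<longrightarrow> ln (g x) - ln c = ln (G x) - ln c"
      "AE x in lebesgue. x \<in> {p..q} \<longrightarrow> \<bar>ln (g x) - ln c\<bar> = \<bar>ln (G x) - ln c\<bar>"
      by (eventually_elim, simp)+
    show ?thesis using AE_eq_on_imp(1)[OF ae(1) g(3)] AE_eq_on_imp(2)[OF ae(2)] g(4) by (simp add: c_def)
  qed
  show ?thesis
    using that[of G] gk(1) Gai main logs by (auto simp: G_def)
qed

end

section \<open>Test functions\<close>

text \<open>Differentiates first and then recurses, whereas \<open>test_function\<close> iterates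
  \<open>deriv\<close> on the outside. In this form each closure property is an induction that uses
  only the first derivative of the expression.\<close>

primrec differentiable_upto :: "nat \<Rightarrow> (real \<Rightarrow> real) \<Rightarrow> bool" where
  "differentiable_upto 0 f \<longleftrightarrow> (\<forall>x. f field_differentiable at x)"
| "differentiable_upto (Suc n) f \<longleftrightarrow> (\<forall>x. f field_differentiable at x) \<and> differentiable_upto n (deriv f)"

lemma differentiable_upto_differentiable: "differentiable_upto n f \<Longrightarrow> f field_differentiable at x"
  by (cases n) auto

lemma differentiable_upto_Suc_D: "differentiable_upto (Suc n) f \<Longrightarrow> differentiable_upto n f"
  by (induction n arbitrary: f) auto

lemma differentiable_upto_funpow:
  "(\<And>n. differentiable_upto n f) \<Longrightarrow> (deriv ^^ n) f field_differentiable at x"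
proof (induction n arbitrary: f)
  case 0
  then show ?case using differentiable_upto_differentiable[of 0 f x] by simp
next
  case (Suc n)
  have "differentiable_upto m (deriv f)" for m using Suc.prems[of "Suc m"] by simp
  then show ?case using Suc.IH[of "deriv f"] by (simp add: funpow_swap1)
qed

lemma differentiable_upto_SucI:
  assumes "\<And>x. (f has_real_derivative f' x) (at x)" "differentiable_upto n f'"
  shows "differentiable_upto (Suc n) f"
proof -
  have "deriv f = f'" using assms(1) by (auto intro: DERIV_imp_deriv)
  then show ?thesis using assms by (auto simp: field_differentiable_def)
qed

lemma has_deriv_of_differentiable_upto:
  assumes "differentiable_upto n f"
  shows "(f has_real_derivative deriv f x) (at x)"
  using differentiable_upto_differentiable[OF assms, of x] by (simp add: DERIV_deriv_iff_field_differentiable)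

lemma differentiable_upto_lincomb:
  "differentiable_upto n f \<Longrightarrow> differentiable_upto n g \<Longrightarrow> differentiable_upto n (\<lambda>x. a * f x + b * g x)"
proof (induction n arbitrary: f g)
  case 0
  then show ?case by (auto intro!: field_differentiable_add field_differentiable_mult)
next
  case (Suc n)
  show ?case
  proof (rule differentiable_upto_SucI)
    show "((\<lambda>x. a * f x + b * g x) has_real_derivative a * deriv f x + b * deriv g x) (at x)" for x
      using has_deriv_of_differentiable_upto[OF Suc.prems(1)] has_deriv_of_differentiable_upto[OF Suc.prems(2)]
      by (auto intro!: derivative_eq_intros)
    show "differentiable_upto n (\<lambda>x. a * deriv f x + b * deriv g x)" using Suc by simp
  qed
qed

lemma differentiable_upto_mult:
  "differentiable_upto n f \<Longrightarrow> differentiable_upto n g \<Longrightarrow> differentiable_upto n (\<lambda>x. f x * g x)"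
proof (induction n arbitrary: f g)
  case 0
  then show ?case by (auto intro!: field_differentiable_mult)
next
  case (Suc n)
  show ?case
  proof (rule differentiable_upto_SucI)
    show "((\<lambda>x. f x * g x) has_real_derivative 1 * (f x * deriv g x) + 1 * (deriv f x * g x)) (at x)" for x
      using has_deriv_of_differentiable_upto[OF Suc.prems(1)] has_deriv_of_differentiable_upto[OF Suc.prems(2)]
      by (auto intro!: derivative_eq_intros)
    have "differentiable_upto n (\<lambda>x. f x * deriv g x)" "differentiable_upto n (\<lambda>x. deriv f x * g x)"
      using Suc.IH Suc.prems differentiable_upto_Suc_D by auto
    then show "differentiable_upto n (\<lambda>x. 1 * (f x * deriv g x) + 1 * (deriv f x * g x))"
      by (rule differentiable_upto_lincomb)
  qed
qed

lemma differentiable_upto_affine: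
  "differentiable_upto n f \<Longrightarrow> differentiable_upto n (\<lambda>x. f (k * x + d))"
proof (induction n arbitrary: f)
  case 0
  have "((\<lambda>x. f (k * x + d)) has_real_derivative deriv f (k * x + d) * k) (at x)" for x
    by (rule DERIV_chain2[OF has_deriv_of_differentiable_upto[OF 0]]) (auto intro!: derivative_eq_intros)
  then show ?case by (auto simp: field_differentiable_def)
next
  case (Suc n)
  show ?case
  proof (rule differentiable_upto_SucI)
    show "((\<lambda>x. f (k * x + d)) has_real_derivative k * deriv f (k * x + d) + 0 * deriv f (k * x + d)) (at x)" for x
      by (rule DERIV_chain2[OF has_deriv_of_differentiable_upto[OF Suc.prems], THEN DERIV_cong]) (auto intro!: derivative_eq_intros)
    have "differentiable_upto n (\<lambda>x. deriv f (k * x + d))" using Suc by simp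
    then show "differentiable_upto n (\<lambda>x. k * deriv f (k * x + d) + 0 * deriv f (k * x + d))"
      by (intro differentiable_upto_lincomb)
  qed
qed

text \<open>The family over all \<open>k\<close> is closed under differentiation up to linear
  combinations, which makes smoothness of the standard function \<open>exp (- 1 / x)\<close> an
  induction.\<close>

definition flat :: "nat \<Rightarrow> real \<Rightarrow> real" where
  "flat k x = (if 0 < x then exp (- 1 / x) / x ^ k else 0)"

text \<open>A single term, of degree \<open>k + 2\<close>, of the series of
  \<open>exp (1 / x)\<close> bounds \<open>flat k\<close> quadratically; that suffices for a
  vanishing derivative at 0, for all \<open>k\<close> at once.\<close>

lemma flat_bound: "\<bar>flat k x\<bar> \<le> fact (k + 2) * x^2"
proof (cases "0 < x")
  case True
  have "(1 / x) ^ (k + 2) / fact (k + 2) \<le> exp (1 / x)"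
  proof -
    have "(1 / x) ^ (k + 2) / fact (k + 2) = (\<Sum>i\<in>{k + 2}. (1 / x) ^ i / fact i)" by simp
    also have "\<dots> \<le> (\<Sum>i. (1 / x) ^ i / fact i)"
      using True summable_exp[of "1 / x"] by (intro sum_le_suminf) (auto simp: divide_inverse mult.commute)
    finally show ?thesis by (simp add: exp_def divide_inverse mult.commute)
  qed
  then have "(1 / x) ^ (k + 2) \<le> exp (1 / x) * fact (k + 2)"
    by (rule iffD1[OF pos_divide_le_eq, rotated]) simp
  then have "(1 / x) ^ (k + 2) \<le> fact (k + 2) * exp (1 / x)" by (simp only: mult.commute)
  then have "exp (- (1 / x)) * (1 / x) ^ (k + 2) \<le> exp (- (1 / x)) * (fact (k + 2) * exp (1 / x))"
    by (intro mult_left_mono) auto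
  also have "\<dots> = fact (k + 2)" by (simp add: exp_minus)
  finally have "exp (- (1 / x)) * (1 / x) ^ (k + 2) * x^2 \<le> fact (k + 2) * x^2" by (intro mult_right_mono) auto
  moreover have "exp (- (1 / x)) * (1 / x) ^ (k + 2) * x^2 = flat k x"
    using True by (simp add: flat_def power_add power_divide power2_eq_square)
  moreover have "0 \<le> flat k x" using True by (simp add: flat_def)
  ultimately show ?thesis by simp
qed (simp add: flat_def)

lemma has_derivative_zero_quadratic:
  fixes f :: "real \<Rightarrow> real"
  assumes "\<And>x. \<bar>f x\<bar> \<le> C * x^2"
  shows "(f has_real_derivative 0) (at 0)"
proof -
  have f0: "f 0 = 0" using assms[of 0] by simp
  have "((\<lambda>h. f h / h) \<longlongrightarrow> 0) (at 0)"
  proof (rule Lim_null_comparison)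
    show "eventually (\<lambda>h. norm (f h / h) \<le> C * \<bar>h\<bar>) (at 0)"
    proof (rule eventually_mono[OF eventually_at_ball'[of 1]])
      fix h :: real assume "h \<in> ball 0 1 \<and> h \<noteq> 0 \<and> h \<in> UNIV"
      then have h: "0 < \<bar>h\<bar>" by simp
      have "h^2 = \<bar>h\<bar> * \<bar>h\<bar>" by (simp add: power2_eq_square)
      then have "\<bar>f h\<bar> \<le> C * \<bar>h\<bar> * \<bar>h\<bar>" using assms[of h] by simp
      then show "norm (f h / h) \<le> C * \<bar>h\<bar>" using h by (simp add: pos_divide_le_eq)
    qed auto
    have "((\<lambda>h. C * \<bar>h\<bar>) \<longlongrightarrow> C * \<bar>0\<bar>) (at (0::real))" by (intro tendsto_intros)
    then show "((\<lambda>h. C * \<bar>h\<bar>) \<longlongrightarrow> 0) (at (0::real))" by simp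
  qed
  then show ?thesis by (simp add: DERIV_def f0)
qed

text \<open>The factors \<open>1\<close> and \<open>- real k\<close> are written out to match the
  shape of \<open>differentiable_upto_lincomb\<close>.\<close>

lemma flat_deriv: "(flat k has_real_derivative 1 * flat (k + 2) x + (- real k) * flat (k + 1) x) (at x)"
proof -
  consider "0 < x" | "x < 0" | "x = 0" by linarith
  then show ?thesis
  proof cases
    case 1
    have "((\<lambda>x. exp (- 1 / x) / x ^ k) has_real_derivative 1 * flat (k + 2) x + (- real k) * flat (k + 1) x) (at x)"
    proof (cases k)
      case 0
      then show ?thesis using 1
        by (auto intro!: derivative_eq_intros simp: flat_def power2_eq_square)
    next
      case (Suc j)
      have "((\<lambda>x. exp (- 1 / x) / x ^ k) has_real_derivative
          ((exp (- 1 / x) * (1 / x^2)) * x ^ k - exp (- 1 / x) * (real k * x ^ (k - 1))) / (x ^ k * x ^ k)) (at x)"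
        using 1 by (auto intro!: derivative_eq_intros simp: power2_eq_square)
      moreover have "((exp (- 1 / x) * (1 / x^2)) * x ^ k - exp (- 1 / x) * (real k * x ^ (k - 1))) / (x ^ k * x ^ k) =
          1 * flat (k + 2) x + (- real k) * flat (k + 1) x"
        using 1 Suc by (simp add: flat_def field_simps power2_eq_square power_add)
      ultimately show ?thesis by simp
    qed
    moreover have "eventually (\<lambda>y. flat k y = exp (- 1 / y) / y ^ k) (nhds x)"
      using eventually_nhds_in_open[of "{0<..}" x] 1 by (auto simp: flat_def elim!: eventually_mono)
    ultimately show ?thesis by (subst DERIV_cong_ev[OF refl _ refl])
  next
    case 2
    have "eventually (\<lambda>y. flat k y = 0) (nhds x)"
      using eventually_nhds_in_open[of "{..<0}" x] 2 by (auto simp: flat_def elim!: eventually_mono)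
    then have "(flat k has_real_derivative 0) (at x)" by (subst DERIV_cong_ev[OF refl _ refl]) auto
    then show ?thesis using 2 by (simp add: flat_def)
  next
    case 3
    have "flat j 0 = 0" for j by (simp add: flat_def)
    then show ?thesis using has_derivative_zero_quadratic[OF flat_bound, of k] 3 by simp
  qed
qed

lemma differentiable_upto_flat: "differentiable_upto n (flat k)"
proof (induction n arbitrary: k)
  case 0
  then show ?case using flat_deriv by (auto simp: field_differentiable_def)
next
  case (Suc n)
  show ?case
    by (rule differentiable_upto_SucI[OF flat_deriv]) (intro differentiable_upto_lincomb Suc)
qed

definition bump :: "real \<Rightarrow> real" where "bump x = flat 0 x * flat 0 ((-1) * x + 1)"
text \<open>Up to the height \<open>step 1\<close>, a smooth Heaviside function. The lower limit
  \<open>-1\<close> lies left of the support of \<open>bump\<close>, so every \<open>x >= 0\<close>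
  is interior to \<open>{-1..x + 1}\<close> and the indefinite integral has a two-sided derivative
  there.\<close>

definition step :: "real \<Rightarrow> real" where "step x = integral {-1..x} bump"
definition ramp :: "real \<Rightarrow> real" where "ramp x = integral {-1..x} step"

lemma differentiable_upto_bump: "differentiable_upto n bump"
  using differentiable_upto_mult[OF differentiable_upto_flat[of n 0] differentiable_upto_affine[OF differentiable_upto_flat[of n 0], of "-1" 1]]
  by (simp add: bump_def[abs_def])

lemma bump_zero: "x \<le> 0 \<or> 1 \<le> x \<Longrightarrow> bump x = 0" and bump_nonneg: "0 \<le> bump x" and bump_pos: "0 < x \<Longrightarrow> x < 1 \<Longrightarrow> 0 < bump x"
  by (auto simp: bump_def flat_def)

lemma indefinite_integral_deriv:
  fixes f :: "real \<Rightarrow> real"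
  assumes cont: "continuous_on UNIV f" and zero: "\<And>x. x \<le> 0 \<Longrightarrow> f x = 0"
  shows "((\<lambda>x. integral {-1..x} f) has_real_derivative f x) (at x)"
    and "x \<le> 0 \<Longrightarrow> integral {-1..x} f = 0"
proof -
  show z: "x \<le> 0 \<Longrightarrow> integral {-1..x} f = 0" for x
    using integral_cong[of "{-1..x}" f "\<lambda>x. 0"] zero by simp
  show "((\<lambda>x. integral {-1..x} f) has_real_derivative f x) (at x)"
  proof (cases "x < 0")
    case True
    have "eventually (\<lambda>y. integral {-1..y} f = 0) (nhds x)"
      using eventually_nhds_in_open[of "{..<0}" x] True z by (auto elim!: eventually_mono)
    then have "((\<lambda>x. integral {-1..x} f) has_real_derivative 0) (at x)" by (subst DERIV_cong_ev[OF refl _ refl]) auto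
    then show ?thesis using zero True by simp
  next
    case False
    have "((\<lambda>x. integral {-1..x} f) has_real_derivative f x) (at x within {-1..x + 1})"
      using False continuous_on_subset[OF cont] by (intro integral_has_real_derivative) auto
    then show ?thesis using False at_within_Icc_at[of "-1" x "x + 1"] by simp
  qed
qed

lemma continuous_bump: "continuous_on UNIV bump"
  using differentiable_upto_differentiable[OF differentiable_upto_bump[of 0]]
  by (intro continuous_at_imp_continuous_on ballI field_differentiable_imp_continuous_at)

lemma step_deriv: "(step has_real_derivative bump x) (at x)"
  unfolding step_def[abs_def] by (rule indefinite_integral_deriv(1)[OF continuous_bump]) (simp add: bump_zero)

lemma step_zero: "x \<le> 0 \<Longrightarrow> step x = 0"
  unfolding step_def by (rule indefinite_integral_deriv(2)[OF continuous_bump]) (simp_all add: bump_zero)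

lemma continuous_step: "continuous_on UNIV step"
  using step_deriv by (intro continuous_at_imp_continuous_on ballI DERIV_isCont)

lemma ramp_deriv: "(ramp has_real_derivative step x) (at x)"
  unfolding ramp_def[abs_def] by (rule indefinite_integral_deriv(1)[OF continuous_step]) (simp add: step_zero)

lemma ramp_zero: "x \<le> 0 \<Longrightarrow> ramp x = 0"
  unfolding ramp_def by (rule indefinite_integral_deriv(2)[OF continuous_step]) (simp_all add: step_zero)

lemma differentiable_upto_ramp: "differentiable_upto n ramp"
proof -
  have "differentiable_upto (Suc (Suc n)) ramp"
    by (intro differentiable_upto_SucI[OF ramp_deriv] differentiable_upto_SucI[OF step_deriv] differentiable_upto_bump)
  then show ?thesis using differentiable_upto_Suc_D by blast
qed

lemma bump_integrable: "bump integrable_on {a..b}"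
  using continuous_on_subset[OF continuous_bump] by (intro integrable_continuous_real) auto

lemma step_eq: "1 \<le> x \<Longrightarrow> step x = step 1"
proof -
  assume x: "1 \<le> x"
  have "integral {-1..x} bump - integral {-1..1} bump = integral {1..x} bump"
    using x by (intro integral_initial_segment bump_integrable) auto
  also have "\<dots> = 0" using integral_cong[of "{1..x}" bump "\<lambda>x. 0"] bump_zero by simp
  finally show ?thesis by (simp add: step_def)
qed

lemma step_bounds: "0 \<le> step x" "step x \<le> step 1" "0 < step 1"
proof -
  show nonneg: "0 \<le> step x" for x unfolding step_def by (intro integral_nonneg bump_integrable bump_nonneg)
  show "step x \<le> step 1"
  proof (cases "x \<le> 1")
    case True then show ?thesis unfolding step_def by (intro integral_subset_le bump_integrable) (auto simp: bump_nonneg)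
  next
    case False then show ?thesis using step_eq[of x] by linarith
  qed
  show "0 < step 1"
  proof (rule ccontr)
    assume "\<not> 0 < step 1"
    then have z: "integral {-1..1} bump = 0" using nonneg[of 1] by (simp add: step_def)
    have "integral {-1..1} bump = 0 \<longleftrightarrow> (\<forall>x\<in>{-1..1}. bump x = 0)"
      by (rule integral_eq_0_iff) (auto intro: continuous_on_subset[OF continuous_bump] bump_nonneg)
    then have "bump (1/2) = 0" using z by simp
    then show False using bump_pos[of "1/2"] by simp
  qed
qed

lemma ramp_eq: "1 \<le> x \<Longrightarrow> ramp x = ramp 1 + step 1 * (x - 1)"
proof -
  assume x: "1 \<le> x"
  have "step integrable_on {-1..x}"
    using continuous_on_subset[OF continuous_step] by (intro integrable_continuous_real) auto
  then have "integral {-1..x} step - integral {-1..1} step = integral {1..x} step"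
    using x by (intro integral_initial_segment) auto
  also have "\<dots> = integral {1..x} (\<lambda>_. step 1)" by (rule integral_cong) (rule step_eq, simp)
  also have "\<dots> = step 1 * (x - 1)" using x by simp
  finally show ?thesis by (simp add: ramp_def)
qed

section \<open>Distributional derivatives and the lemma of du Bois-Reymond\<close>

lemma locally_integrable_iff: "locally_integrable f \<longleftrightarrow> (\<forall>p q. f absolutely_integrable_on {p..q})"
proof
  assume f: "\<forall>p q. f absolutely_integrable_on {p..q}"
  show "locally_integrable f"
    unfolding locally_integrable_def
  proof (intro allI impI)
    fix K :: "real set" assume K: "compact K"
    then obtain r where r: "\<forall>x\<in>K. norm x \<le> r"
      using compact_imp_bounded[OF K] unfolding bounded_iff by (elim exE)
    have "K \<subseteq> {- r..r}"
    proof
      fix x assume "x \<in> K"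
      then have "\<bar>x\<bar> \<le> r" using r by simp
      then show "x \<in> {- r..r}" by auto
    qed
    moreover have "K \<in> sets lebesgue" using K by (simp add: compact_imp_closed)
    ultimately show "f absolutely_integrable_on K" using f set_integrable_subset by blast
  qed
qed (simp add: locally_integrable_def)

lemma test_function_deriv: "test_function h \<Longrightarrow> (h has_real_derivative deriv h x) (at x)"
  using DERIV_deriv_iff_field_differentiable[of h x] unfolding test_function_def by (metis funpow_0)

lemma test_function_continuous_deriv: "test_function h \<Longrightarrow> continuous_on S (deriv h)"
proof -
  assume h: "test_function h"
  have "(deriv ^^ 1) h field_differentiable at x" for x using h unfolding test_function_def by blast
  then show ?thesis
    by (intro continuous_at_imp_continuous_on ballI field_differentiable_imp_continuous_at) simp
qed

lemma test_function_support:
  assumes "test_function h"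
  obtains r where "0 < r" "\<And>x. r \<le> \<bar>x\<bar> \<Longrightarrow> h x = 0" "\<And>x. r \<le> \<bar>x\<bar> \<Longrightarrow> deriv h x = 0"
proof -
  have "bounded (closure {x. h x \<noteq> 0})" using assms compact_imp_bounded unfolding test_function_def by blast
  then obtain r where r': "\<forall>x\<in>closure {x. h x \<noteq> 0}. norm x \<le> r"
    unfolding bounded_iff by (elim exE)
  have r: "\<bar>x\<bar> \<le> r" if "h x \<noteq> 0" for x
    using r'[rule_format, of x] closure_subset[of "{x. h x \<noteq> 0}"] that by auto
  have "deriv h x = 0" if x: "\<bar>r\<bar> + 1 \<le> \<bar>x\<bar>" for x
  proof -
    have "open {y. \<bar>r\<bar> < \<bar>y::real\<bar>}" by (intro open_Collect_less continuous_intros)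
    then have "eventually (\<lambda>y. h y = 0) (nhds x)"
      using eventually_nhds_in_open[of "{y. \<bar>r\<bar> < \<bar>y\<bar>}" x] x r by (force elim!: eventually_mono)
    then have "(h has_real_derivative 0) (at x)" by (subst DERIV_cong_ev[OF refl _ refl]) auto
    then show ?thesis by (rule DERIV_imp_deriv)
  qed
  moreover have "h x = 0" if "\<bar>r\<bar> + 1 \<le> \<bar>x\<bar>" for x using r[of x] that by force
  ultimately show ?thesis by (intro that[of "\<bar>r\<bar> + 1"]) auto
qed

lemma lebesgue_integral_supported:
  fixes h :: "real \<Rightarrow> real"
  assumes "h absolutely_integrable_on {a..b}" "\<And>x. x \<notin> {a..b} \<Longrightarrow> h x = 0"
  shows "(LINT x|lebesgue. h x) = integral {a..b} h"
proof -
  have "(LINT x|lebesgue. h x) = (LINT x:{a..b}|lebesgue. h x)"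
    unfolding set_lebesgue_integral_def using assms(2)
    by (intro Bochner_Integration.integral_cong) (auto split: split_indicator)
  then show ?thesis using assms(1) by (simp add: set_lebesgue_integral_eq_integral)
qed

lemma absolutely_integrable_mult_continuous:
  fixes f g :: "real \<Rightarrow> real"
  assumes "f absolutely_integrable_on {a..b}" "continuous_on {a..b} g"
  shows "(\<lambda>x. f x * g x) absolutely_integrable_on {a..b}"
proof -
  have "bounded (g ` {a..b})" using assms(2) by (simp add: compact_continuous_image compact_imp_bounded)
  moreover have "g \<in> borel_measurable (lebesgue_on {a..b})"
    using assms(2) by (simp add: continuous_imp_measurable_on_sets_lebesgue)
  ultimately have "(\<lambda>x. g x * f x) absolutely_integrable_on {a..b}"
    using absolutely_integrable_bounded_measurable_product_real[OF _ _ _ assms(1)] by simp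
  then show ?thesis by (simp add: mult.commute)
qed

lemma continuous_of_increments:
  fixes F g :: "real \<Rightarrow> real"
  assumes g: "\<And>p q. g absolutely_integrable_on {p..q}" and F: "\<And>p q. p \<le> q \<Longrightarrow> F q - F p = integral {p..q} g"
  shows "continuous_on {a..b} F"
proof -
  have "continuous_on {a..b} (\<lambda>x. F a + integral {a..x} g)"
    using g[of a b] by (intro continuous_intros indefinite_integral_continuous_1) (simp add: absolutely_integrable_on_def)
  then show ?thesis by (rule continuous_on_eq) (use F in \<open>auto simp: algebra_simps\<close>)
qed

text \<open>The product rule for \<open>F h\<close> is the chain rule for the squares of \<open>F + h\<close> and \<open>F - h\<close>.\<close>

lemma has_distributional_derivI:
  fixes F g :: "real \<Rightarrow> real"
  assumes g: "\<And>p q. g absolutely_integrable_on {p..q}" and F: "\<And>p q. p \<le> q \<Longrightarrow> F q - F p = integral {p..q} g"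
  shows "has_distributional_deriv F g"
  unfolding has_distributional_deriv_def locally_integrable_iff
proof (intro conjI allI impI)
  have cF: "continuous_on {a..b} F" for a b by (rule continuous_of_increments[OF g F])
  then show "F absolutely_integrable_on {p..q}" for p q by (rule absolutely_integrable_continuous_real)
  show "g absolutely_integrable_on {p..q}" for p q by (rule g)
  fix h assume h: "test_function h"
  obtain r where r: "0 < r" "\<And>x. r \<le> \<bar>x\<bar> \<Longrightarrow> h x = 0" "\<And>x. r \<le> \<bar>x\<bar> \<Longrightarrow> deriv h x = 0"
    using test_function_support[OF h] by blast
  have ch: "continuous_on S h" for S
    using test_function_deriv[OF h] by (intro continuous_at_imp_continuous_on ballI DERIV_isCont)
  have cdh: "continuous_on S (deriv h)" for S using test_function_continuous_deriv[OF h] .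
  have dhi: "deriv h absolutely_integrable_on {a..b}" for a b by (rule absolutely_integrable_continuous_real[OF cdh])
  have hi: "h t = h (- r) + integral {- r..t} (deriv h)" if "t \<in> {- r..r}" for t
  proof -
    have "(deriv h has_integral h t - h (- r)) {- r..t}"
      using that test_function_deriv[OF h]
      by (intro fundamental_theorem_of_calculus)
        (auto simp: has_real_derivative_iff_has_vector_derivative[symmetric] intro: has_field_derivative_at_within)
    then show ?thesis by (simp add: integral_unique)
  qed
  have sq: "(\<lambda>t. 2 * (F t + s * h t) * (g t + s * deriv h t)) integrable_on {- r..r} \<and>
      (F r + s * h r)^2 - (F (- r) + s * h (- r))^2 = integral {- r..r} (\<lambda>t. 2 * (F t + s * h t) * (g t + s * deriv h t))" for s
  proof -
    have le: "- r \<le> r" using r(1) by simp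
    have ai: "(\<lambda>t. g t + s * deriv h t) absolutely_integrable_on {- r..r}"
      by (intro set_integral_add g set_integrable_mult_right dhi)
    have X: "F t + s * h t = (F (- r) + s * h (- r)) + integral {- r..t} (\<lambda>t. g t + s * deriv h t)" if t: "t \<in> {- r..r}" for t
    proof -
      have "integral {- r..t} (\<lambda>t. g t + s * deriv h t) = integral {- r..t} g + s * integral {- r..t} (deriv h)"
        using g[of "- r" t] dhi[of "- r" t]
        by (subst integral_add) (auto simp: absolutely_integrable_on_def intro: integrable_on_mult_right)
      moreover have "F t - F (- r) = integral {- r..t} g" using F t by auto
      moreover have "s * integral {- r..t} (deriv h) = s * h t - s * h (- r)" using hi[OF t] by (simp add: algebra_simps)
      ultimately show ?thesis by simp
    qed
    have D: "((\<lambda>y. y^2) has_real_derivative 2 * y) (at y)" for y :: real by (auto intro!: derivative_eq_intros)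
    have C: "continuous_on S (\<lambda>y::real. 2 * y)" for S by (intro continuous_intros)
    show ?thesis
      using integrable_chain_rule[OF le ai X D C] by (simp add: absolutely_integrable_on_def)
  qed
  have int0: "integral {- r..r} (\<lambda>t. F t * deriv h t + g t * h t) = 0"
  proof -
    have "4 * integral {- r..r} (\<lambda>t. F t * deriv h t + g t * h t) = integral {- r..r} (\<lambda>t. 4 * (F t * deriv h t + g t * h t))"
      by (rule integral_mult_right[symmetric])
    also have "\<dots> =
        integral {- r..r} (\<lambda>t. 2 * (F t + 1 * h t) * (g t + 1 * deriv h t) - 2 * (F t + (-1) * h t) * (g t + (-1) * deriv h t))"
      by (intro integral_cong) (simp add: algebra_simps)
    also have "\<dots> = ((F r + 1 * h r)^2 - (F (- r) + 1 * h (- r))^2) - ((F r + (-1) * h r)^2 - (F (- r) + (-1) * h (- r))^2)"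
      using sq[of 1] sq[of "-1"] by (subst integral_diff) (simp_all only:)
    also have "\<dots> = 0" using r by simp
    finally show ?thesis by simp
  qed
  have i1: "(\<lambda>t. F t * deriv h t) absolutely_integrable_on {- r..r}" and i2: "(\<lambda>t. g t * h t) absolutely_integrable_on {- r..r}"
    using absolutely_integrable_mult_continuous[OF absolutely_integrable_continuous_real[OF cF] cdh]
      absolutely_integrable_mult_continuous[OF g ch] by auto
  have "(LINT x|lebesgue. F x * deriv h x) = integral {- r..r} (\<lambda>t. F t * deriv h t)"
    by (rule lebesgue_integral_supported[OF i1]) (use r in auto)
  moreover have "(LINT x|lebesgue. g x * h x) = integral {- r..r} (\<lambda>t. g t * h t)"
    by (rule lebesgue_integral_supported[OF i2]) (use r in auto)
  moreover have "integral {- r..r} (\<lambda>t. F t * deriv h t + g t * h t) = integral {- r..r} (\<lambda>t. F t * deriv h t) + integral {- r..r} (\<lambda>t. g t * h t)"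
    using i1 i2 by (intro integral_add) (auto simp: absolutely_integrable_on_def)
  ultimately show "(LINT x|lebesgue. F x * deriv h x) = - (LINT x|lebesgue. g x * h x)" using int0 by linarith
qed

text \<open>Divided by \<open>k\<close>, the test function \<open>probe p q k\<close> has a derivative that converges to a multiple of the
  indicator of \<open>(p, q]\<close> minus \<open>q - p\<close> times that of \<open>(0, 1]\<close>.\<close>

definition probe :: "real \<Rightarrow> real \<Rightarrow> real \<Rightarrow> real \<Rightarrow> real" where
  "probe p q k x = 1 * (1 * ramp (k * x + (- (k * p))) + (-1) * ramp (k * x + (- (k * q)))) +
     (-1) * ((q - p) * ramp (k * x + 0) + (- (q - p)) * ramp (k * x + (- k)))"

definition probe_slope :: "real \<Rightarrow> real \<Rightarrow> real \<Rightarrow> real \<Rightarrow> real" where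
  "probe_slope p q k x = step (k * (x - p)) - step (k * (x - q)) - (q - p) * (step (k * x) - step (k * (x - 1)))"

lemma probe_deriv: "(probe p q k has_real_derivative k * probe_slope p q k x) (at x)"
proof -
  have r: "((\<lambda>x. ramp (k * x + d)) has_real_derivative step (k * x + d) * k) (at x)" for d
    by (rule DERIV_chain2[OF ramp_deriv]) (auto intro!: derivative_eq_intros)
  show ?thesis unfolding probe_def
    by (rule derivative_eq_intros r refl | simp)+
      (simp add: probe_slope_def algebra_simps)
qed

text \<open>Right of both intervals the four ramps are affine and cancel: weighting the unit
  interval by \<open>q - p\<close> gives the slope mean zero. This makes the primitive compactly
  supported.\<close>

lemma probe_support:
  assumes pq: "p < q" and k: "1 \<le> k"
  shows "x < min p 0 \<Longrightarrow> probe p q k x = 0" "max q 1 + 1 < x \<Longrightarrow> probe p q k x = 0"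
proof -
  have n: "k * y \<le> 0" if "y \<le> 0" for y using that k by (simp add: mult_nonneg_nonpos)
  have g: "1 \<le> k * y" if "1 \<le> y" for y using mult_mono[OF k that] k by simp
  have e: "k * x + - (k * d) = k * (x - d)" for d by (simp add: algebra_simps)
  show "x < min p 0 \<Longrightarrow> probe p q k x = 0"
    unfolding probe_def e using pq n[of "x - p"] n[of "x - q"] n[of x] n[of "x - 1"] e[of 1] by (simp add: ramp_zero)
  assume x: "max q 1 + 1 < x"
  have "ramp (k * (x - p)) = ramp 1 + step 1 * (k * (x - p) - 1)"
    "ramp (k * (x - q)) = ramp 1 + step 1 * (k * (x - q) - 1)"
    "ramp (k * x) = ramp 1 + step 1 * (k * x - 1)"
    "ramp (k * (x - 1)) = ramp 1 + step 1 * (k * (x - 1) - 1)"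
    using x pq by (auto intro!: ramp_eq g)
  moreover have "probe p q k x = 1 * (1 * ramp (k * (x - p)) + (-1) * ramp (k * (x - q))) +
     (-1) * ((q - p) * ramp (k * x) + (- (q - p)) * ramp (k * (x - 1)))"
    unfolding probe_def e using e[of 1] by simp
  moreover have "1 * (1 * (r + s * (k * (x - p) - 1)) + (-1) * (r + s * (k * (x - q) - 1))) +
     (-1) * ((q - p) * (r + s * (k * x - 1)) + (- (q - p)) * (r + s * (k * (x - 1) - 1))) = 0" for r s :: real
    by algebra
  ultimately show "probe p q k x = 0" by (simp only:)
qed

lemma test_function_probe:
  assumes pq: "p < q" and k: "1 \<le> k"
  shows "test_function (probe p q k)"
  unfolding test_function_def
proof (intro conjI allI)
  have "differentiable_upto n (probe p q k)" for n
    unfolding probe_def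
    by (intro differentiable_upto_lincomb differentiable_upto_affine differentiable_upto_ramp)
  then show "(deriv ^^ n) (probe p q k) field_differentiable at x" for n x
    by (rule differentiable_upto_funpow)
  have "{x. probe p q k x \<noteq> 0} \<subseteq> {min p 0..max q 1 + 1}"
    using probe_support[OF pq k] by (force simp: not_less[symmetric])
  then have "closure {x. probe p q k x \<noteq> 0} \<subseteq> {min p 0..max q 1 + 1}" by (intro closure_minimal) auto
  then show "compact (closure {x. probe p q k x \<noteq> 0})"
    by (meson bounded_closed_interval bounded_subset closed_closure compact_eq_bounded_closed)
qed

lemma step_scaled_tendsto: "(\<lambda>k. step (real (Suc k) * x)) \<longlonglongrightarrow> (if 0 < x then step 1 else 0)"
proof (cases "0 < x")
  case True
  obtain n where n: "1 < real n * x" using reals_Archimedean3[OF True] by auto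
  have "step (real (Suc k) * x) = step 1" if "n \<le> k" for k
  proof -
    have "real n * x \<le> real (Suc k) * x" using that True by (intro mult_right_mono) auto
    then show ?thesis using n by (intro step_eq) linarith
  qed
  then have "eventually (\<lambda>k. step (real (Suc k) * x) = step 1) sequentially" by (auto simp: eventually_sequentially)
  then show ?thesis using True by (simp add: tendsto_eventually)
next
  case False
  have "step (real (Suc k) * x) = 0" for k
    using False by (intro step_zero mult_nonneg_nonpos) auto
  then show ?thesis using False by (simp only: if_False tendsto_const)
qed

text \<open>In the limit the probes show that \<open>H\<close> has the same mean over
  \<open>{p..q}\<close> as over \<open>{0..1}\<close>. Subtracting that mean leaves a function with
  vanishing indefinite integrals.\<close>

lemma du_bois_reymond:
  fixes H :: "real \<Rightarrow> real"
  assumes H: "\<And>p q. H absolutely_integrable_on {p..q}"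
    and zero: "\<And>h. test_function h \<Longrightarrow> (LINT x|lebesgue. H x * deriv h x) = 0"
  shows "\<exists>c. AE x in lebesgue. H x = c"
proof -
  define c where "c = integral {0..1} H"
  have main: "integral {p..q} H = (q - p) * c" if pq: "p < q" for p q
  proof -
    define A B where "A = min p 0" and "B = max q 1 + 1"
    define D where "D = (\<lambda>k x. H x * probe_slope p q (real (Suc k)) x)"
    have slope_cont: "continuous_on S (probe_slope p q k)" for S k
      unfolding probe_slope_def
      by (intro continuous_intros continuous_on_compose2[OF continuous_step]) auto
    have Di: "D k absolutely_integrable_on {A..B}" for k
      unfolding D_def by (rule absolutely_integrable_mult_continuous[OF H slope_cont])
    have D0: "integral {A..B} (D k) = 0" for k
    proof -
      have dp: "deriv (probe p q (real (Suc k))) = (\<lambda>x. real (Suc k) * probe_slope p q (real (Suc k)) x)"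
        by (rule ext) (rule DERIV_imp_deriv[OF probe_deriv])
      have out: "probe_slope p q (real (Suc k)) x = 0" if x: "x \<notin> {A..B}" for x
      proof -
        have "x < A \<or> B < x" using x by auto
        then have "eventually (\<lambda>y. probe p q (real (Suc k)) y = 0) (nhds x)"
        proof
          assume "x < A"
          then show ?thesis using eventually_nhds_in_open[of "{..<A}" x] probe_support(1)[OF pq, of "real (Suc k)"]
            by (auto simp: A_def elim!: eventually_mono)
        next
          assume "B < x"
          then show ?thesis using eventually_nhds_in_open[of "{B<..}" x] probe_support(2)[OF pq, of "real (Suc k)"]
            by (auto simp: B_def elim!: eventually_mono)
        qed
        then have "(probe p q (real (Suc k)) has_real_derivative 0) (at x)" by (subst DERIV_cong_ev[OF refl _ refl]) auto
        then have "real (Suc k) * probe_slope p q (real (Suc k)) x = 0" using probe_deriv DERIV_unique by blast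
        then show ?thesis by simp
      qed
      have "0 = (LINT x|lebesgue. H x * deriv (probe p q (real (Suc k))) x)"
        using zero[OF test_function_probe[OF pq, of "real (Suc k)"]] by simp
      also have "\<dots> = (LINT x|lebesgue. real (Suc k) * D k x)"
        unfolding dp D_def by (simp only: mult.left_commute)
      also have "\<dots> = real (Suc k) * (LINT x|lebesgue. D k x)" by simp
      also have "(LINT x|lebesgue. D k x) = integral {A..B} (D k)"
      proof (rule lebesgue_integral_supported[OF Di])
        fix x assume "x \<notin> {A..B}"
        from out[OF this] show "D k x = 0" unfolding D_def by (simp only: mult_zero_right)
      qed
      finally show ?thesis by simp
    qed
    define E where "E = (\<lambda>x. H x * (step 1 * (indicator {p<..q} x - (q - p) * indicator {0<..1} x)))"
    have "(\<lambda>k. integral {A..B} (D k)) \<longlonglongrightarrow> integral {A..B} E"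
    proof (rule dominated_convergence(2))
      show "D k integrable_on {A..B}" for k using Di absolutely_integrable_on_def by blast
      show "(\<lambda>x. \<bar>H x\<bar> * (step 1 * (1 + (q - p)))) integrable_on {A..B}"
        using H[of A B] by (intro integrable_on_mult_left) (simp add: absolutely_integrable_on_def)
      show "norm (D k x) \<le> \<bar>H x\<bar> * (step 1 * (1 + (q - p)))" for k x
      proof -
        have st: "\<bar>step a - step b\<bar> \<le> step 1" for a b using step_bounds(1,2)[of a] step_bounds(1,2)[of b] by linarith
        have st': "\<bar>(q - p) * (step a - step b)\<bar> \<le> (q - p) * step 1" for a b
          using st[of a b] pq by (simp add: abs_mult mult_left_mono)
        have "\<bar>probe_slope p q (real (Suc k)) x\<bar> \<le>
            \<bar>step (real (Suc k) * (x - p)) - step (real (Suc k) * (x - q))\<bar> +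
            \<bar>(q - p) * (step (real (Suc k) * x) - step (real (Suc k) * (x - 1)))\<bar>"
          unfolding probe_slope_def by (rule abs_triangle_ineq4)
        also have "\<dots> \<le> step 1 + (q - p) * step 1" by (intro add_mono st st')
        also have "\<dots> = step 1 * (1 + (q - p))" by algebra
        finally have "\<bar>H x\<bar> * \<bar>probe_slope p q (real (Suc k)) x\<bar> \<le> \<bar>H x\<bar> * (step 1 * (1 + (q - p)))"
          by (intro mult_left_mono) auto
        then show ?thesis unfolding D_def by (simp only: abs_mult real_norm_def)
      qed
      show "(\<lambda>k. D k x) \<longlonglongrightarrow> E x" for x
      proof -
        have "(\<lambda>k. D k x) \<longlonglongrightarrow> H x * ((if 0 < x - p then step 1 else 0) - (if 0 < x - q then step 1 else 0) -
            (q - p) * ((if 0 < x then step 1 else 0) - (if 0 < x - 1 then step 1 else 0)))"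
          unfolding D_def probe_slope_def by (intro tendsto_intros step_scaled_tendsto)
        moreover have "H x * ((if 0 < x - p then step 1 else 0) - (if 0 < x - q then step 1 else 0) -
            (q - p) * ((if 0 < x then step 1 else 0) - (if 0 < x - 1 then step 1 else 0))) = E x"
          unfolding E_def using pq by (auto split: split_indicator simp: algebra_simps)
        ultimately show ?thesis by simp
      qed
    qed
    then have E0: "integral {A..B} E = 0" by (simp add: D0 LIMSEQ_const_iff)
    have part: "((\<lambda>x. H x * indicator {a<..b} x) has_integral integral {a..b} H) {A..B}" if "A \<le> a" "a < b" "b \<le> B" for a b
    proof -
      have "((\<lambda>x. if x \<in> {a..b} then H x else 0) has_integral integral {a..b} H) {A..B}"
      proof (subst has_integral_restrict)
        show "{a..b} \<subseteq> {A..B}" using that by auto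
        show "(H has_integral integral {a..b} H) {a..b}"
          using H[of a b] by (intro integrable_integral) (simp add: absolutely_integrable_on_def)
      qed
      then show ?thesis
        by (rule has_integral_spike_finite[of "{a}", rotated 2]) (auto split: split_indicator)
    qed
    have "(E has_integral step 1 * (integral {p..q} H - (q - p) * integral {0..1} H)) {A..B}"
      unfolding E_def
    proof (rule has_integral_eq_rhs[OF has_integral_eq])
      show "((\<lambda>x. step 1 * (H x * indicator {p<..q} x - (q - p) * (H x * indicator {0<..1} x))) has_integral
         step 1 * (integral {p..q} H - (q - p) * integral {0..1} H)) {A..B}"
        using pq by (intro has_integral_mult_right has_integral_diff part) (auto simp: A_def B_def)
    qed (auto simp: algebra_simps)
    then have "step 1 * (integral {p..q} H - (q - p) * c) = 0" using E0 by (simp add: integral_unique c_def)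
    then show ?thesis using step_bounds(3) by simp
  qed
  have "AE x in lebesgue. x \<in> {- real n..real n} \<longrightarrow> H x - c = 0" for n
  proof (rule AE_zero_of_indefinite_integral)
    show "(\<lambda>x. H x - c) absolutely_integrable_on {- real n..real n}" by (intro set_integral_diff H) auto
    fix x assume x: "x \<in> {- real n..real n}"
    have "integral {- real n..x} (\<lambda>x. H x - c) = integral {- real n..x} H - c * (x + real n)"
      using H[of "- real n" x] x by (subst integral_diff) (auto simp: absolutely_integrable_on_def)
    then show "integral {- real n..x} (\<lambda>x. H x - c) = 0"
      using main[of "- real n" x] x by (cases "x = - real n") auto
  qed
  then have "AE x in lebesgue. \<forall>n. x \<in> {- real n..real n} \<longrightarrow> H x - c = 0"
    unfolding AE_all_countable by blast
  then have "AE x in lebesgue. H x = c"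
  proof eventually_elim
    case (elim x)
    obtain n where "\<bar>x\<bar> \<le> real n" using real_arch_simple by blast
    then show ?case using elim[rule_format, of n] by (auto simp: abs_le_iff)
  qed
  then show ?thesis by blast
qed

section \<open>Weights and representatives\<close>

lemma mean_eq: "f absolutely_integrable_on {p..q} \<Longrightarrow> mean p q f = integral {p..q} f / (q - p)"
  by (simp add: mean_def set_lebesgue_integral_eq_integral)

lemma absolutely_integrable_const_Icc: "(\<lambda>x::real. c :: real) absolutely_integrable_on {p..q}"
  by (rule absolutely_integrable_continuous_real) (rule continuous_on_const)

text \<open>Passing from an arbitrary centre \<open>c\<close> to the mean costs a factor 2. It is
  needed because the flow estimate is centred at the logarithm of a difference quotient and not at
  the mean of the logarithm.\<close>

lemma bmo_deviation_le:
  fixes f :: "real \<Rightarrow> real"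
  assumes f: "(\<lambda>x. f x - c) absolutely_integrable_on {p..q}" and pq: "p < q"
    and le: "integral {p..q} (\<lambda>x. \<bar>f x - c\<bar>) \<le> K * (q - p)"
  shows "f absolutely_integrable_on {p..q}" "\<bar>mean p q f - c\<bar> \<le> K" "mean p q (\<lambda>x. \<bar>f x - mean p q f\<bar>) \<le> 2 * K"
proof -
  show fi: "f absolutely_integrable_on {p..q}"
    using set_integral_add(1)[OF f absolutely_integrable_const_Icc[of p q c]] by simp
  define m where "m = mean p q f"
  have "integral {p..q} (\<lambda>x. f x - c) = integral {p..q} f - c * (q - p)"
    using fi pq by (subst integral_diff) (auto simp: absolutely_integrable_on_def)
  then have mc: "m - c = integral {p..q} (\<lambda>x. f x - c) / (q - p)"
    using pq by (simp add: m_def mean_eq[OF fi] field_simps)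
  have "\<bar>integral {p..q} (\<lambda>x. f x - c)\<bar> \<le> integral {p..q} (\<lambda>x. \<bar>f x - c\<bar>)"
    using f integral_norm_bound_integral[of "\<lambda>x. f x - c" "{p..q}" "\<lambda>x. \<bar>f x - c\<bar>"]
    by (simp add: absolutely_integrable_on_def)
  then have "\<bar>integral {p..q} (\<lambda>x. f x - c)\<bar> \<le> K * (q - p)" using le by simp
  then show mK: "\<bar>mean p q f - c\<bar> \<le> K"
    unfolding m_def[symmetric] mc using pq by (simp add: pos_divide_le_eq)
  have fm: "(\<lambda>x. f x - m) absolutely_integrable_on {p..q}" by (intro set_integral_diff fi absolutely_integrable_const_Icc)
  then have fma: "(\<lambda>x. \<bar>f x - m\<bar>) absolutely_integrable_on {p..q}" by (simp add: absolutely_integrable_on_def)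
  have "integral {p..q} (\<lambda>x. \<bar>f x - m\<bar>) \<le> integral {p..q} (\<lambda>x. \<bar>f x - c\<bar> + K)"
  proof (rule integral_le)
    show "(\<lambda>x. \<bar>f x - m\<bar>) integrable_on {p..q}" using fm by (simp add: absolutely_integrable_on_def)
    show "(\<lambda>x. \<bar>f x - c\<bar> + K) integrable_on {p..q}"
      using f by (intro integrable_add integrable_const_ivl) (simp add: absolutely_integrable_on_def)
    show "\<bar>f x - m\<bar> \<le> \<bar>f x - c\<bar> + K" for x using mK unfolding m_def[symmetric] by linarith
  qed
  also have "\<dots> = integral {p..q} (\<lambda>x. \<bar>f x - c\<bar>) + K * (q - p)"
    using f pq by (subst integral_add) (auto simp: absolutely_integrable_on_def)
  finally have "integral {p..q} (\<lambda>x. \<bar>f x - m\<bar>) \<le> 2 * K * (q - p)" using le by simp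
  then show "mean p q (\<lambda>x. \<bar>f x - mean p q f\<bar>) \<le> 2 * K"
    unfolding m_def[symmetric] mean_eq[OF fma] using pq by (simp add: pos_divide_le_eq)
qed

text \<open>The difference quotient of \<open>psi\<close> is the mean of \<open>g\<close>. Hence the
  same deviation bound serves twice: for the seminorm of \<open>ln g\<close>, and, since the mean of
  \<open>ln g\<close> is within \<open>K\<close> of the logarithm of the mean, for the bound
  \<open>exp K\<close> on the weight constant.\<close>

lemma weight_of_density:
  fixes psi g :: "real \<Rightarrow> real"
  assumes strict: "\<And>x y. x < y \<Longrightarrow> psi x < psi y"
    and pos: "\<And>x. 0 < g x" and g: "\<And>p q. g absolutely_integrable_on {p..q}"
    and int: "\<And>p q. p \<le> q \<Longrightarrow> integral {p..q} g = psi q - psi p"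
    and ln_int: "\<And>p q. p < q \<Longrightarrow> (\<lambda>x. ln (g x) - ln ((psi q - psi p) / (q - p))) absolutely_integrable_on {p..q}"
    and ln_le: "\<And>p q. p < q \<Longrightarrow> integral {p..q} (\<lambda>x. \<bar>ln (g x) - ln ((psi q - psi p) / (q - p))\<bar>) \<le> K * (q - p)"
  shows "has_distributional_deriv psi g" "Ainf_weight (\<lambda>x. \<bar>g x\<bar>)" "(\<lambda>x. ln \<bar>g x\<bar>) \<in> BMO"
    "bmo_norm (\<lambda>x. ln \<bar>g x\<bar>) \<le> ennreal (2 * K)"
proof -
  have abs: "\<bar>g x\<bar> = g x" for x using pos[of x] by simp
  show "has_distributional_deriv psi g" using g int by (intro has_distributional_derivI) auto
  note dev = bmo_deviation_le[OF ln_int _ ln_le]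
  have lni: "(\<lambda>x. ln (g x)) absolutely_integrable_on {p..q}" for p q
  proof (cases "p < q")
    case True then show ?thesis using dev(1) by blast
  next
    case False
    then have "{p..q} = {} \<or> {p..q} = {p}" by auto
    then show ?thesis by (auto intro: absolutely_integrable_negligible)
  qed
  show norm: "bmo_norm (\<lambda>x. ln \<bar>g x\<bar>) \<le> ennreal (2 * K)"
    unfolding bmo_norm_def abs using dev(3) by (intro SUP_least) (auto intro!: ennreal_leI)
  show "(\<lambda>x. ln \<bar>g x\<bar>) \<in> BMO"
    unfolding BMO_def abs mem_Collect_eq
  proof (intro conjI)
    show "locally_integrable (\<lambda>x. ln (g x))" using lni by (simp add: locally_integrable_iff)
    show "bmo_norm (\<lambda>x. ln (g x)) < \<infinity>" using norm unfolding abs by (rule le_less_trans) simp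
  qed
  have "Ainf_const g \<le> ennreal (exp K)"
    unfolding Ainf_const_def
  proof (rule SUP_least, clarify)
    fix p q :: real assume pq: "p < q"
    define c where "c = (psi q - psi p) / (q - p)"
    have c: "0 < c" using strict[OF pq] pq by (simp add: c_def)
    have m: "mean p q g = c" using mean_eq[OF g] int pq by (simp add: c_def)
    have "\<bar>mean p q (\<lambda>x. ln (g x)) - ln c\<bar> \<le> K" using dev(2)[OF pq pq pq] by (simp add: c_def)
    then have "- mean p q (\<lambda>x. ln (g x)) \<le> K + (- ln c)" by linarith
    then have "exp (- mean p q (\<lambda>x. ln (g x))) \<le> exp K * exp (- ln c)" by (simp add: exp_add[symmetric])
    also have "exp (- ln c) = 1 / c" using c by (simp add: exp_minus divide_inverse)
    finally have "c * exp (- mean p q (\<lambda>x. ln (g x))) \<le> exp K" using c by (simp add: field_simps)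
    then show "ennreal (mean p q g) * (if set_integrable lebesgue {p..q} (\<lambda>x. ln (g x))
         then ennreal (exp (- mean p q (\<lambda>x. ln (g x)))) else \<infinity>) \<le> ennreal (exp K)"
      using lni[of p q] c by (simp add: m ennreal_mult[symmetric] ennreal_leI)
  qed
  then have "Ainf_const g < \<infinity>" by (rule le_less_trans) simp
  then show "Ainf_weight (\<lambda>x. \<bar>g x\<bar>)"
    unfolding Ainf_weight_def abs using g pos by (simp add: locally_integrable_iff less_imp_le)
qed

lemma (in bmo_field) flow_weight:
  assumes t: "t \<in> {0..T}"
  shows "\<exists>g. has_distributional_deriv (flow t) g \<and> Ainf_weight (\<lambda>x. \<bar>g x\<bar>) \<and> (\<lambda>x. ln \<bar>g x\<bar>) \<in> BMO \<and>
    bmo_norm (\<lambda>x. ln \<bar>g x\<bar>) \<le> ennreal (90 * beta t * exp (9 * beta t))"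
proof -
  interpret partition_bounded "flow t" "45 * beta t * exp (9 * beta t)" "5 * exp (9 * beta t)"
  proof
    show "flow t x < flow t y" if "x < y" for x y using flow_less[OF that t] .
    fix x :: "nat \<Rightarrow> real" and n :: nat
    assume x: "\<And>i. i < n \<Longrightarrow> x i < x (Suc i)" and n: "0 < n"
    show "(\<Sum>i<n. (x (Suc i) - x i) / (x n - x 0) *
        \<bar>ln ((flow t (x (Suc i)) - flow t (x i)) / (flow t (x n) - flow t (x 0)) / ((x (Suc i) - x i) / (x n - x 0)))\<bar>)
        \<le> 45 * beta t * exp (9 * beta t)"
      using flow_partition_bounds(1)[of n x t] x n t by blast
    show "(\<Sum>i<n. (flow t (x (Suc i)) - flow t (x i)) / (flow t (x n) - flow t (x 0)) *
        ln ((flow t (x (Suc i)) - flow t (x i)) / (flow t (x n) - flow t (x 0)) / ((x (Suc i) - x i) / (x n - x 0))))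
        \<le> 5 * exp (9 * beta t)"
      using flow_partition_bounds(2)[of n x t] x n t by blast
  qed
  obtain g where g: "\<And>x. 0 < g x" "\<And>p q. g absolutely_integrable_on {p..q}"
    "\<And>p q. p \<le> q \<Longrightarrow> integral {p..q} g = flow t q - flow t p"
    "\<And>p q. p < q \<Longrightarrow> (\<lambda>x. ln (g x) - ln ((flow t q - flow t p) / (q - p))) absolutely_integrable_on {p..q}"
    "\<And>p q. p < q \<Longrightarrow> integral {p..q} (\<lambda>x. \<bar>ln (g x) - ln ((flow t q - flow t p) / (q - p))\<bar>) \<le> 45 * beta t * exp (9 * beta t) * (q - p)"
    by (rule density, rule that, assumption+)
  note w = weight_of_density[OF flow_less[OF _ t] g]
  have "2 * (45 * beta t * exp (9 * beta t)) = 90 * beta t * exp (9 * beta t)" by simp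
  then show ?thesis using w by (intro exI[of _ g]) (simp add: mult.assoc)
qed

text \<open>The primitive that vanishes at 0; for either sign of \<open>x\<close> one of the two
  integrals is over an empty interval.\<close>

definition antiderivative :: "(real \<Rightarrow> real) \<Rightarrow> real \<Rightarrow> real" where
  "antiderivative g x = integral {0..x} g - integral {x..0} g"

lemma antiderivative_diff:
  assumes g: "\<And>p q. g absolutely_integrable_on {p..q}" and pq: "p \<le> q"
  shows "antiderivative g q - antiderivative g p = integral {p..q} g"
proof -
  have i: "g integrable_on {a..b}" for a b using g[of a b] by (simp add: absolutely_integrable_on_def)
  have c: "integral {a..b} g + integral {b..d} g = integral {a..d} g" if "a \<le> b" "b \<le> d" for a b d
    using that i by (intro Henstock_Kurzweil_Integration.integral_combine) auto
  have z: "integral {a..b} g = 0" if "b \<le> a" for a b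
    using that by (cases "a = b") auto
  consider "0 \<le> p" | "q \<le> 0" | "p < 0" "0 < q" by linarith
  then show ?thesis
  proof cases
    case 1 then show ?thesis using pq c[of 0 p q] z[of 0 p] z[of 0 q] by (simp add: antiderivative_def)
  next
    case 2 then show ?thesis using pq c[of p q 0] z[of p 0] z[of q 0] by (simp add: antiderivative_def)
  next
    case 3 then show ?thesis using c[of p 0 q] z[of p 0] z[of 0 q] by (simp add: antiderivative_def)
  qed
qed

section \<open>Continuous representatives\<close>

lemma continuous_AE_eq_imp_eq:
  fixes f g :: "real \<Rightarrow> real"
  assumes "continuous_on UNIV f" "continuous_on UNIV g" "AE x in lebesgue. f x = g x"
  shows "f = g"
proof (rule ccontr)
  assume "f \<noteq> g"
  have "open {x. f x \<noteq> g x}" using assms(1,2) by (rule open_Collect_neq)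
  moreover have "{x. f x \<noteq> g x} \<noteq> {}" using \<open>f \<noteq> g\<close> by auto
  ultimately have "\<not> negligible {x. f x \<noteq> g x}" by (rule open_not_negligible)
  then show False using assms(3) negligible_subset unfolding eventually_ae_filter_negligible by blast
qed

lemma cont_rep_eq:
  assumes "continuous_on UNIV u" "AE x in lebesgue. f x = u x"
  shows "cont_rep f = u"
  unfolding cont_rep_def
proof (rule the_equality)
  fix g assume g: "continuous_on UNIV g \<and> (AE x in lebesgue. f x = g x)"
  then have "AE x in lebesgue. g x = u x" using assms(2) by (auto elim: eventually_elim2)
  then show "g = u" using g assms(1) continuous_AE_eq_imp_eq by blast
qed (use assms in blast)

lemma distributional_deriv_representation:
  assumes "has_distributional_deriv F g"
  shows "\<exists>c. AE x in lebesgue. F x = c + antiderivative g x"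
proof -
  have F: "\<And>p q. F absolutely_integrable_on {p..q}" and g: "\<And>p q. g absolutely_integrable_on {p..q}"
    and Fg: "\<And>h. test_function h \<Longrightarrow> (LINT x|lebesgue. F x * deriv h x) = - (LINT x|lebesgue. g x * h x)"
    using assms unfolding has_distributional_deriv_def locally_integrable_iff by blast+
  have Ag: "has_distributional_deriv (antiderivative g) g"
    by (rule has_distributional_derivI[OF g antiderivative_diff[OF g]])
  have A: "\<And>p q. antiderivative g absolutely_integrable_on {p..q}"
    using Ag unfolding has_distributional_deriv_def locally_integrable_iff by blast
  have "\<exists>c. AE x in lebesgue. F x - antiderivative g x = c"
  proof (rule du_bois_reymond)
    show "(\<lambda>x. F x - antiderivative g x) absolutely_integrable_on {p..q}" for p q by (intro set_integral_diff F A)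
    fix h assume h: "test_function h"
    obtain r where r: "0 < r" "\<And>x. r \<le> \<bar>x\<bar> \<Longrightarrow> h x = 0" "\<And>x. r \<le> \<bar>x\<bar> \<Longrightarrow> deriv h x = 0"
      by (rule test_function_support[OF h], rule that, assumption+)
    have out: "deriv h x = 0" if "x \<notin> {- r..r}" for x using r(3)[of x] that by auto
    note cdh = test_function_continuous_deriv[OF h]
    have i: "(\<lambda>x. u x * deriv h x) absolutely_integrable_on {- r..r}" if "\<And>p q. u absolutely_integrable_on {p..q}" for u
      by (rule absolutely_integrable_mult_continuous[OF that cdh])
    have e: "(LINT x|lebesgue. u x * deriv h x) = integral {- r..r} (\<lambda>x. u x * deriv h x)"
      if "\<And>p q. u absolutely_integrable_on {p..q}" for u
      by (rule lebesgue_integral_supported[OF i[OF that]]) (simp add: out)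
    have "(LINT x|lebesgue. (F x - antiderivative g x) * deriv h x) = integral {- r..r} (\<lambda>x. (F x - antiderivative g x) * deriv h x)"
      by (rule e) (intro set_integral_diff F A)
    also have "\<dots> = integral {- r..r} (\<lambda>x. F x * deriv h x) - integral {- r..r} (\<lambda>x. antiderivative g x * deriv h x)"
      unfolding left_diff_distrib using i[OF F] i[OF A] by (intro integral_diff) (simp_all add: absolutely_integrable_on_def)
    also have "\<dots> = 0"
      using e[OF F] e[OF A] Fg[OF h] Ag h unfolding has_distributional_deriv_def by simp
    finally show "(LINT x|lebesgue. (F x - antiderivative g x) * deriv h x) = 0" .
  qed
  then obtain c where "AE x in lebesgue. F x - antiderivative g x = c" by blast
  then have "AE x in lebesgue. F x = c + antiderivative g x" by eventually_elim auto
  then show ?thesis by blast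
qed

lemma bmo_norm_cong_AE:
  assumes "AE x in lebesgue. f x = g x"
    and f: "\<And>p q. f absolutely_integrable_on {p..q}"
  shows "bmo_norm f = bmo_norm g"
proof -
  have m: "mean p q u = mean p q w" if uw: "AE x in lebesgue. u x = w x" and u: "u absolutely_integrable_on {p..q}" for u w p q
  proof -
    have ae: "AE x in lebesgue. x \<in> {p..q} \<longrightarrow> u x = w x" using uw by eventually_elim simp
    show ?thesis using mean_eq[OF u] mean_eq[OF AE_eq_on_imp(1)[OF ae u]] AE_eq_on_imp(2)[OF ae] by simp
  qed
  have "mean p q (\<lambda>x. \<bar>f x - mean p q f\<bar>) = mean p q (\<lambda>x. \<bar>g x - mean p q g\<bar>)" for p q
  proof (rule m)
    have "mean p q f = mean p q g" by (rule m[OF assms(1) f])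
    then show "AE x in lebesgue. \<bar>f x - mean p q f\<bar> = \<bar>g x - mean p q g\<bar>"
      using assms(1) by (auto elim: eventually_mono)
    have "(\<lambda>x. f x - mean p q f) absolutely_integrable_on {p..q}" by (intro set_integral_diff f absolutely_integrable_const_Icc)
    then show "(\<lambda>x. \<bar>f x - mean p q f\<bar>) absolutely_integrable_on {p..q}"
      by (simp add: absolutely_integrable_on_def)
  qed
  then show ?thesis unfolding bmo_norm_def by simp
qed

section \<open>Measurability in time and Borel versions\<close>

lemma rational_sequence: "\<exists>a. (\<forall>n::nat. a n \<in> \<rat>) \<and> a \<longlonglongrightarrow> (x::real)"
proof -
  have "\<exists>r\<in>\<rat>. x < r \<and> r < x + inverse (real (Suc n))" for n
    by (rule Rats_dense_in_real) simp
  then obtain a where a: "\<And>n. a n \<in> \<rat>" "\<And>n. x < a n" "\<And>n. a n < x + inverse (real (Suc n))" by metis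
  have "a \<longlonglongrightarrow> x"
  proof (rule real_tendsto_sandwich[of "\<lambda>n. x" a sequentially "\<lambda>n. x + inverse (real (Suc n))"])
    show "(\<lambda>n. x + inverse (real (Suc n))) \<longlonglongrightarrow> x"
      using tendsto_add[OF tendsto_const[of x] LIMSEQ_inverse_real_of_nat] by simp
  qed (use a(2,3) in \<open>auto intro!: always_eventually less_imp_le\<close>)
  then show ?thesis using a(1) by blast
qed

lemma continuous_antiderivative:
  assumes g: "\<And>p q. g absolutely_integrable_on {p..q}"
  shows "continuous_on S (antiderivative g)"
proof -
  have "continuous_on {x - 1..x + 1} (antiderivative g)" for x
    by (rule continuous_of_increments[OF g antiderivative_diff[OF g]])
  then have "isCont (antiderivative g) x" for x
    by (rule continuous_on_interior[of "{x - 1..x + 1}"]) auto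
  then show ?thesis by (simp add: continuous_at_imp_continuous_on)
qed

text \<open>A countable supremum makes the seminorm measurable in time. Means are continuous in the
  endpoints; under approximation the inner mean moves too, at the cost \<open>|cn n - c|\<close>,
  which tends to 0.\<close>

lemma bmo_norm_rational:
  assumes f: "\<And>p q. f absolutely_integrable_on {p..q}"
  shows "bmo_norm f = (SUP (p, q) \<in> {(p, q). p \<in> \<rat> \<and> q \<in> \<rat> \<and> p < q}. ennreal (mean p q (\<lambda>x. \<bar>f x - mean p q f\<bar>)))"
    (is "_ = ?R")
proof (rule antisym)
  show "?R \<le> bmo_norm f" unfolding bmo_norm_def by (rule SUP_subset_mono) auto
  show "bmo_norm f \<le> ?R"
    unfolding bmo_norm_def
  proof (rule SUP_least, clarify)
    fix p q :: real assume pq: "p < q"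
    obtain a b where a: "\<And>n. a n \<in> \<rat>" "a \<longlonglongrightarrow> p" and b: "\<And>n. b n \<in> \<rat>" "b \<longlonglongrightarrow> q"
      using rational_sequence by metis
    define c where "c = mean p q f"
    define cn where "cn = (\<lambda>n. mean (a n) (b n) f)"
    have fc: "(\<lambda>x. f x - k) absolutely_integrable_on {u..w}" for k u w by (intro set_integral_diff f absolutely_integrable_const_Icc)
    then have fca: "(\<lambda>x. \<bar>f x - k\<bar>) absolutely_integrable_on {u..w}" for k u w
      by (simp add: absolutely_integrable_on_def)
    have cts: "isCont (antiderivative g) x" if "\<And>p q. g absolutely_integrable_on {p..q}" for g x
      using continuous_antiderivative[OF that, of UNIV] by (simp add: continuous_on_eq_continuous_at)
    have lt: "eventually (\<lambda>n. a n < b n) sequentially"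
      using order_tendstoD(2)[OF a(2), of "(p + q) / 2"] order_tendstoD(1)[OF b(2), of "(p + q) / 2"] pq
      by (auto elim: eventually_elim2)
    have lim_mean: "(\<lambda>n. mean (a n) (b n) g) \<longlonglongrightarrow> mean p q g" if g: "\<And>p q. g absolutely_integrable_on {p..q}" for g
    proof -
      have e: "mean u w g = (antiderivative g w - antiderivative g u) / (w - u)" if "u \<le> w" for u w
        using mean_eq[OF g] antiderivative_diff[OF g that] by simp
      have "(\<lambda>n. (antiderivative g (b n) - antiderivative g (a n)) / (b n - a n)) \<longlonglongrightarrow> (antiderivative g q - antiderivative g p) / (q - p)"
        using pq by (intro tendsto_intros isCont_tendsto_compose[OF cts[OF g]] a b) auto
      moreover have "eventually (\<lambda>n. mean (a n) (b n) g = (antiderivative g (b n) - antiderivative g (a n)) / (b n - a n)) sequentially"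
        using lt by eventually_elim (simp add: e)
      ultimately show ?thesis using e[of p q] pq by (simp add: tendsto_cong)
    qed
    have cn: "cn \<longlonglongrightarrow> c" unfolding cn_def c_def by (rule lim_mean[OF f])
    have step: "eventually (\<lambda>n. mean (a n) (b n) (\<lambda>x. \<bar>f x - c\<bar>) - \<bar>cn n - c\<bar> \<le> mean (a n) (b n) (\<lambda>x. \<bar>f x - cn n\<bar>)) sequentially"
      using lt
    proof eventually_elim
      case (elim n)
      have "integral {a n..b n} (\<lambda>x. \<bar>f x - c\<bar>) \<le> integral {a n..b n} (\<lambda>x. \<bar>f x - cn n\<bar> + \<bar>cn n - c\<bar>)"
        using fca by (intro integral_le integrable_add integrable_const_ivl) (auto simp: absolutely_integrable_on_def)
      also have "\<dots> = integral {a n..b n} (\<lambda>x. \<bar>f x - cn n\<bar>) + \<bar>cn n - c\<bar> * (b n - a n)"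
        using fca elim by (subst integral_add) (auto simp: absolutely_integrable_on_def)
      finally have "integral {a n..b n} (\<lambda>x. \<bar>f x - c\<bar>) / (b n - a n) \<le>
          (integral {a n..b n} (\<lambda>x. \<bar>f x - cn n\<bar>) + \<bar>cn n - c\<bar> * (b n - a n)) / (b n - a n)"
        by (rule divide_right_mono) (use elim in simp)
      also have "\<dots> = integral {a n..b n} (\<lambda>x. \<bar>f x - cn n\<bar>) / (b n - a n) + \<bar>cn n - c\<bar>"
        using elim by (simp add: add_divide_distrib)
      finally show ?case by (simp add: mean_eq[OF fca])
    qed
    have "(\<lambda>n. ennreal (mean (a n) (b n) (\<lambda>x. \<bar>f x - c\<bar>) - \<bar>cn n - c\<bar>)) \<longlonglongrightarrow> ennreal (mean p q (\<lambda>x. \<bar>f x - c\<bar>) - \<bar>c - c\<bar>)"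
      by (intro tendsto_intros lim_mean[OF fca] cn)
    moreover have "eventually (\<lambda>n. ennreal (mean (a n) (b n) (\<lambda>x. \<bar>f x - c\<bar>) - \<bar>cn n - c\<bar>) \<le> ?R) sequentially"
      using lt step
    proof eventually_elim
      case (elim n)
      have "ennreal (mean (a n) (b n) (\<lambda>x. \<bar>f x - c\<bar>) - \<bar>cn n - c\<bar>) \<le> ennreal (mean (a n) (b n) (\<lambda>x. \<bar>f x - mean (a n) (b n) f\<bar>))"
        using elim(2) unfolding cn_def by (rule ennreal_leI)
      also have "\<dots> \<le> ?R" by (rule SUP_upper2[of "(a n, b n)"]) (use a b elim in auto)
      finally show ?case .
    qed
    ultimately have "ennreal (mean p q (\<lambda>x. \<bar>f x - c\<bar>) - \<bar>c - c\<bar>) \<le> ?R"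
      by (rule tendsto_upperbound) simp
    then show "ennreal (mean p q (\<lambda>x. \<bar>f x - mean p q f\<bar>)) \<le> ?R" by (simp add: c_def)
  qed
qed

lemma lborel_set_integral:
  fixes h :: "real \<Rightarrow> real"
  assumes "h \<in> borel_measurable borel"
  shows "(LINT x:{p..q}|lebesgue. h x) = (LINT x|lborel. (if p \<le> x \<and> x \<le> q then h x else 0))"
proof -
  have e: "indicat_real {p..q} x *\<^sub>R h x = (if p \<le> x \<and> x \<le> q then h x else 0)" for x by simp
  have "(\<lambda>x. if p \<le> x \<and> x \<le> q then h x else 0) \<in> borel_measurable lborel" using assms by measurable
  then show ?thesis unfolding set_lebesgue_integral_def e by (rule integral_completion)
qed

lemma parametric_integral_measurable:
  fixes F :: "'a \<Rightarrow> real \<Rightarrow> real"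
  assumes "(\<lambda>(s, x). F s x) \<in> borel_measurable (M \<Otimes>\<^sub>M borel)"
  shows "(\<lambda>s. LINT x|lborel. F s x) \<in> borel_measurable M"
proof -
  have "sets (M \<Otimes>\<^sub>M borel) = sets (M \<Otimes>\<^sub>M lborel)" by (intro sets_pair_measure_cong) auto
  then have "(\<lambda>(s, x). F s x) \<in> borel_measurable (M \<Otimes>\<^sub>M lborel)"
    using assms by (simp cong: measurable_cong_sets)
  then show ?thesis by (rule lborel.borel_measurable_lebesgue_integral)
qed

text \<open>A Lebesgue measurable function on the plane may have nonmeasurable slices. A Borel
  version has only measurable ones, and by Fubini it agrees with \<open>h\<close> almost everywhere
  on almost every slice.\<close>

lemma borel_version:
  fixes h :: "real \<times> real \<Rightarrow> real"
  assumes "h \<in> borel_measurable (lebesgue_on ({0..T} \<times> UNIV))"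
  obtains g where "g \<in> borel_measurable (borel \<Otimes>\<^sub>M borel)"
    "AE t in lebesgue. t \<in> {0..T} \<longrightarrow> (AE x in lebesgue. h (t, x) = g (t, x))"
proof -
  have "closed ({0..T} \<times> (UNIV :: real set))" by (intro closed_Times) auto
  then have "{0..T} \<times> (UNIV :: real set) \<in> sets lebesgue" by auto
  with assms have "(\<lambda>z. if z \<in> {0..T} \<times> UNIV then h z else 0) \<in> borel_measurable lebesgue"
    by (rule borel_measurable_if_I)
  then have "\<exists>g\<in>borel_measurable lborel. AE z in lborel. (if z \<in> {0..T} \<times> UNIV then h z else 0) = g z"
    by (rule completion_ex_borel_measurable_real)
  then obtain g where g: "g \<in> borel_measurable lborel" "AE z in lborel. (if z \<in> {0..T} \<times> UNIV then h z else 0) = g z"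
    by (rule bexE)
  have "AE z in lborel \<Otimes>\<^sub>M lborel. (if z \<in> {0..T} \<times> UNIV then h z else 0) = g z"
    using g(2) by (simp only: lborel_prod)
  then have "AE t in lborel. AE x in lborel. (if (t, x) \<in> {0..T} \<times> UNIV then h (t, x) else 0) = g (t, x)"
    by (rule lborel_pair.AE_pair)
  then have "AE t in lebesgue. AE x in lborel. (if (t, x) \<in> {0..T} \<times> UNIV then h (t, x) else 0) = g (t, x)"
    by (rule AE_completion)
  then have "AE t in lebesgue. t \<in> {0..T} \<longrightarrow> (AE x in lebesgue. h (t, x) = g (t, x))"
  proof eventually_elim
    case (elim t)
    show ?case
    proof
      assume "t \<in> {0..T}"
      then show "AE x in lebesgue. h (t, x) = g (t, x)" using AE_completion[OF elim] by simp
    qed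
  qed
  moreover have "g \<in> borel_measurable (borel \<Otimes>\<^sub>M borel)"
    using g(1) by (simp add: borel_prod)
  ultimately show ?thesis using that by blast
qed

lemma absolutely_integrable_of_nn_integral:
  fixes g :: "real \<Rightarrow> real"
  assumes g: "g \<in> borel_measurable borel" "\<And>t. 0 \<le> g t"
    and le: "AE t in lebesgue. t \<in> {0..T} \<longrightarrow> ennreal (g t) \<le> G t"
    and fin: "(\<integral>\<^sup>+t\<in>{0..T}. G t \<partial>lebesgue) < \<infinity>"
  shows "g absolutely_integrable_on {0..T}"
proof -
  have gm: "(\<lambda>t. indicat_real {0..T} t *\<^sub>R g t) \<in> borel_measurable lebesgue"
    using g(1) by (intro measurable_completion) measurable
  have "(\<integral>\<^sup>+t. ennreal (norm (indicat_real {0..T} t *\<^sub>R g t)) \<partial>lebesgue) \<le> (\<integral>\<^sup>+t\<in>{0..T}. G t \<partial>lebesgue)"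
    by (rule nn_integral_mono_AE) (use le in eventually_elim, use g(2) in \<open>auto split: split_indicator\<close>)
  then show ?thesis unfolding set_integrable_def using gm fin
    by (intro integrableI_bounded) (auto intro: le_less_trans)
qed

lemma nn_integral_abs_eq:
  fixes h :: "real \<Rightarrow> real"
  assumes "h absolutely_integrable_on {p..q}"
  shows "(\<integral>\<^sup>+x\<in>{p..q}. ennreal \<bar>h x\<bar> \<partial>lebesgue) = ennreal (integral {p..q} (\<lambda>x. \<bar>h x\<bar>))"
proof -
  have a: "(\<lambda>x. \<bar>h x\<bar>) absolutely_integrable_on {p..q}" using assms by (simp add: absolutely_integrable_on_def)
  have "(\<integral>\<^sup>+x\<in>{p..q}. ennreal \<bar>h x\<bar> \<partial>lebesgue) = (\<integral>\<^sup>+x. ennreal (indicat_real {p..q} x *\<^sub>R \<bar>h x\<bar>) \<partial>lebesgue)"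
    by (intro nn_integral_cong) (auto split: split_indicator)
  also have "\<dots> = ennreal (LINT x:{p..q}|lebesgue. \<bar>h x\<bar>)"
    unfolding set_lebesgue_integral_def using a by (intro nn_integral_eq_integral) (auto simp: set_integrable_def)
  finally show ?thesis using set_lebesgue_integral_eq_integral(2)[OF a] by simp
qed

section \<open>Existence, uniqueness and regularity of the flow\<close>

lemma antiderivative_zero: "antiderivative g 0 = 0"
  by (simp add: antiderivative_def)

lemma abs_antiderivative_le:
  assumes g: "\<And>p q. g absolutely_integrable_on {p..q}" and y: "y \<in> {-1..1}"
  shows "\<bar>antiderivative g y\<bar> \<le> integral {-1..1} (\<lambda>x. \<bar>g x\<bar>)"
proof -
  have i: "g integrable_on {p..q}" "(\<lambda>x. \<bar>g x\<bar>) integrable_on {p..q}" for p q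
    using g[of p q] by (simp_all add: absolutely_integrable_on_def)
  have b: "\<bar>integral {p..q} g\<bar> \<le> integral {-1..1} (\<lambda>x. \<bar>g x\<bar>)" if "-1 \<le> p" "q \<le> 1" for p q
  proof -
    have "\<bar>integral {p..q} g\<bar> \<le> integral {p..q} (\<lambda>x. \<bar>g x\<bar>)"
      using integral_norm_bound_integral[OF i(1) i(2), of p q] by simp
    also have "\<dots> \<le> integral {-1..1} (\<lambda>x. \<bar>g x\<bar>)" using that i(2) by (intro integral_subset_le) auto
    finally show ?thesis .
  qed
  show ?thesis
  proof (cases "0 \<le> y")
    case True
    then have "antiderivative g y = integral {0..y} g"
      using antiderivative_diff[OF g True] by (simp add: antiderivative_zero)
    then show ?thesis using b[of 0 y] y by simp
  next
    case False
    then have "antiderivative g y = - integral {y..0} g"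
      using antiderivative_diff[OF g, of y 0] by (simp add: antiderivative_zero)
    then show ?thesis using b[of y 0] y by simp
  qed
qed

lemma antiderivative_borel:
  assumes "h \<in> borel_measurable borel" "\<And>p q. h absolutely_integrable_on {p..q}"
  shows "antiderivative h x = (LINT y|lborel. (if 0 \<le> y \<and> y \<le> x then h y else 0)) - (LINT y|lborel. (if x \<le> y \<and> y \<le> 0 then h y else 0))"
  unfolding antiderivative_def using assms
  by (simp add: set_lebesgue_integral_eq_integral(2)[symmetric] lborel_set_integral)

text \<open>Turns hypotheses on equivalence classes, valid for almost every time, into the
  everywhere valid and jointly Borel data of \<open>bmo_field\<close>.\<close>

lemma bmo_field_of_velocity:
  assumes T: "0 < T" and b: "b \<in> L1_L1loc T"
    and bB: "AE t in lebesgue_on {0..T}. has_distributional_deriv (b t) (B t)" and B: "B \<in> L1_BMO T"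
  obtains v f N a where "bmo_field T v f N a" "AE t in lebesgue. t \<in> {0..T} \<longrightarrow> cont_rep (b t) = v t"
    "\<And>t. t \<in> {0..T} \<Longrightarrow> integral {0..t} N = bmo_integral B t"
proof -
  have bm: "(\<lambda>(t, x). b t x) \<in> borel_measurable (lebesgue_on ({0..T} \<times> UNIV))"
    and b_fin: "(\<integral>\<^sup>+t\<in>{0..T}. (\<integral>\<^sup>+x\<in>{-1..1}. ennreal \<bar>b t x\<bar> \<partial>lebesgue) \<partial>lebesgue) < \<infinity>"
    using b compact_Icc[of "-1" "1::real"] unfolding L1_L1loc_def by blast+
  have Bm: "(\<lambda>(t, x). B t x) \<in> borel_measurable (lebesgue_on ({0..T} \<times> UNIV))"
    and B_bmo: "AE t in lebesgue_on {0..T}. B t \<in> BMO" and B_fin: "(\<integral>\<^sup>+t\<in>{0..T}. bmo_star_norm (B t) \<partial>lebesgue) < \<infinity>"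
    using B unfolding L1_BMO_def by auto
  obtain b' where b'm: "b' \<in> borel_measurable (borel \<Otimes>\<^sub>M borel)"
    and b': "AE t in lebesgue. t \<in> {0..T} \<longrightarrow> (AE x in lebesgue. (case (t, x) of (t, x) \<Rightarrow> b t x) = b' (t, x))"
    by (rule borel_version[OF bm])
  obtain B' where B'm: "B' \<in> borel_measurable (borel \<Otimes>\<^sub>M borel)"
    and B': "AE t in lebesgue. t \<in> {0..T} \<longrightarrow> (AE x in lebesgue. (case (t, x) of (t, x) \<Rightarrow> B t x) = B' (t, x))"
    by (rule borel_version[OF Bm])
  define good where "good = (\<lambda>t. has_distributional_deriv (b t) (B t) \<and> B t \<in> BMO \<and>
    (AE x in lebesgue. b t x = b' (t, x)) \<and> (AE x in lebesgue. B t x = B' (t, x)))"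
  have on: "AE t in lebesgue. t \<in> {0..T} \<longrightarrow> P t" if "AE t in lebesgue_on {0..T}. P t" for P
    using that by (subst (asm) AE_restrict_space_iff) auto
  have "AE t in lebesgue. t \<in> {0..T} \<longrightarrow> good t"
    using on[OF bB] on[OF B_bmo] b' B' by eventually_elim (simp add: good_def)
  then have "AE t in lborel. t \<in> {0..T} \<longrightarrow> good t" by (simp only: AE_completion_iff)
  then obtain Z where Z: "{t \<in> space lborel. \<not> (t \<in> {0..T} \<longrightarrow> good t)} \<subseteq> Z" "emeasure lborel Z = 0" "Z \<in> sets lborel"
    by (rule AE_E)
  \<comment> \<open>The exceptional times are enclosed in a Borel null set, and the fields are set
    to 0 outside \<open>E\<close>; this keeps them jointly Borel and makes every bound hold at every
    time.\<close>
  define E where "E = {0..T} - Z"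
  have E_sets [measurable]: "E \<in> sets borel" using Z(3) by (auto simp: E_def)
  have good: "good t" if "t \<in> E" for t using Z(1) that by (auto simp: E_def)
  have "AE t in lborel. t \<notin> Z" using Z(2,3) by (intro AE_not_in) (auto simp: null_sets_def)
  then have "AE t in lebesgue. t \<notin> Z" by (rule AE_completion)
  then have AE_E: "AE t in lebesgue. t \<in> {0..T} \<longrightarrow> t \<in> E"
    by eventually_elim (simp add: E_def)
  define f where "f = (\<lambda>t x. if t \<in> E then B' (t, x) else 0)"
  define bb where "bb = (\<lambda>t x. if t \<in> E then b' (t, x) else 0)"
  have fm [measurable]: "(\<lambda>(t, x). f t x) \<in> borel_measurable (borel \<Otimes>\<^sub>M borel)"
    unfolding f_def split_def using B'm by measurable
  have bbm [measurable]: "(\<lambda>(t, x). bb t x) \<in> borel_measurable (borel \<Otimes>\<^sub>M borel)"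
    unfolding bb_def split_def using b'm by measurable
  have ftm [measurable]: "f t \<in> borel_measurable borel" and bbtm [measurable]: "bb t \<in> borel_measurable borel" for t
    using measurable_Pair2[OF fm, of t] measurable_Pair2[OF bbm, of t] by auto
  have f_AE: "AE x in lebesgue. B t x = f t x" and bb_AE: "AE x in lebesgue. b t x = bb t x" if "t \<in> E" for t
    using good[OF that] that by (simp_all add: good_def f_def bb_def)
  have Bt: "B t absolutely_integrable_on {p..q}" and bt: "b t absolutely_integrable_on {p..q}" if "t \<in> E" for t p q
    using good[OF that] by (auto simp: good_def has_distributional_deriv_def locally_integrable_iff)
  have Bt_fin: "bmo_norm (B t) < \<infinity>" if "t \<in> E" for t using good[OF that] by (simp add: good_def BMO_def)
  have zero_int: "(\<lambda>x::real. 0::real) absolutely_integrable_on {p..q}" for p q by (rule absolutely_integrable_const_Icc)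
  have f_off: "f t = (\<lambda>x. 0)" and bb_off: "bb t = (\<lambda>x. 0)" if "t \<notin> E" for t using that by (auto simp: f_def bb_def)
  have fi: "f t absolutely_integrable_on {p..q}" for t p q
  proof (cases "t \<in> E")
    case True
    have "AE x in lebesgue. x \<in> {p..q} \<longrightarrow> B t x = f t x" using f_AE[OF True] by eventually_elim simp
    then show ?thesis using Bt[OF True] by (rule AE_eq_on_imp(1))
  qed (simp add: f_off zero_int)
  have bbi: "bb t absolutely_integrable_on {p..q}" for t p q
  proof (cases "t \<in> E")
    case True
    have "AE x in lebesgue. x \<in> {p..q} \<longrightarrow> b t x = bb t x" using bb_AE[OF True] by eventually_elim simp
    then show ?thesis using bt[OF True] by (rule AE_eq_on_imp(1))
  qed (simp add: bb_off zero_int)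
  define al where "al = (\<lambda>t. antiderivative (f t))"
  have al_eq: "al t x = (LINT y|lborel. (if 0 \<le> y \<and> y \<le> x then f t y else 0)) - (LINT y|lborel. (if x \<le> y \<and> y \<le> 0 then f t y else 0))" for t x
    unfolding al_def by (rule antiderivative_borel[OF ftm fi])
  have alm: "(\<lambda>(t, x). al t x) \<in> borel_measurable (borel \<Otimes>\<^sub>M borel)"
  proof -
    have f3: "(\<lambda>z. f (fst (fst z)) (snd z)) \<in> borel_measurable ((borel \<Otimes>\<^sub>M borel) \<Otimes>\<^sub>M borel)"
    proof -
      have "(\<lambda>z. (fst (fst z), snd z)) \<in> (borel \<Otimes>\<^sub>M borel) \<Otimes>\<^sub>M borel \<rightarrow>\<^sub>M borel \<Otimes>\<^sub>M borel" by measurable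
      from measurable_compose[OF this fm] show ?thesis by simp
    qed
    have "(\<lambda>s. LINT y|lborel. (if 0 \<le> y \<and> y \<le> snd s then f (fst s) y else 0)) \<in> borel_measurable (borel \<Otimes>\<^sub>M borel)"
      "(\<lambda>s. LINT y|lborel. (if snd s \<le> y \<and> y \<le> 0 then f (fst s) y else 0)) \<in> borel_measurable (borel \<Otimes>\<^sub>M borel)"
      by (rule parametric_integral_measurable, unfold split_def, use f3 in measurable)+
    then show ?thesis unfolding al_eq split_def by (rule borel_measurable_diff)
  qed
  \<comment> \<open>For almost every \<open>t\<close> the integrand is constant, and \<open>c t\<close> is that constant.\<close>
  define c where "c = (\<lambda>t. LINT y|lborel. (if 0 \<le> y \<and> y \<le> 1 then bb t y - al t y else 0))"
  have cm: "c \<in> borel_measurable borel"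
    unfolding c_def
  proof (rule parametric_integral_measurable)
    have "(\<lambda>z. bb (fst z) (snd z)) \<in> borel_measurable (borel \<Otimes>\<^sub>M borel)" "(\<lambda>z. al (fst z) (snd z)) \<in> borel_measurable (borel \<Otimes>\<^sub>M borel)"
      using bbm alm by (simp_all add: split_def)
    then show "(\<lambda>(t, y). if 0 \<le> y \<and> y \<le> 1 then bb t y - al t y else 0) \<in> borel_measurable (borel \<Otimes>\<^sub>M borel)"
      unfolding split_def by measurable
  qed
  define v where "v = (\<lambda>t x. c t + al t x)"
  have al_cont: "continuous_on S (al t)" for S t unfolding al_def by (rule continuous_antiderivative[OF fi])
  have ali: "al t absolutely_integrable_on {p..q}" for t p q by (rule absolutely_integrable_continuous_real[OF al_cont])
  have dmeas: "(\<lambda>y. bb t y - al t y) \<in> borel_measurable borel" for t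
    using borel_measurable_continuous_onI[OF al_cont[of UNIV t]] by measurable
  have di: "(\<lambda>y. bb t y - al t y) absolutely_integrable_on {p..q}" for t p q by (intro set_integral_diff bbi ali)
  have c_eq: "c t = integral {0..1} (\<lambda>y. bb t y - al t y)" for t
    unfolding c_def lborel_set_integral[OF dmeas, symmetric] by (rule set_lebesgue_integral_eq_integral(2)[OF di])
  have rep: "cont_rep (b t) = v t" if t: "t \<in> E" for t
  proof -
    obtain k where k: "AE x in lebesgue. b t x = k + antiderivative (B t) x"
      using distributional_deriv_representation[of "b t" "B t"] good[OF t] by (auto simp: good_def)
    have "integral {p..q} (B t) = integral {p..q} (f t)" for p q
      by (rule AE_eq_on_imp(2)) (use f_AE[OF t] in eventually_elim, simp)
    then have anti: "antiderivative (B t) = al t" by (auto simp: al_def antiderivative_def)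
    have "AE y in lebesgue. y \<in> {0..1} \<longrightarrow> bb t y - al t y = k"
      using k bb_AE[OF t] by eventually_elim (simp add: anti)
    then have "c t = integral {0..1::real} (\<lambda>y. k)" unfolding c_eq by (rule AE_eq_on_imp(2))
    then have "c t = k" by simp
    then have "AE x in lebesgue. b t x = v t x" using k by (simp add: v_def anti)
    moreover have "continuous_on UNIV (v t)" unfolding v_def by (intro continuous_intros al_cont)
    ultimately show ?thesis by (intro cont_rep_eq)
  qed
  define N where "N = (\<lambda>t. enn2real (bmo_norm (f t)))"
  define a1 where "a1 = (\<lambda>t. integral {-1..1} (\<lambda>x. \<bar>f t x\<bar>))"
  define a2 where "a2 = (\<lambda>t. integral {-1..1} (\<lambda>x. \<bar>bb t x\<bar>))"
  have absi: "(\<lambda>x. \<bar>h x\<bar>) absolutely_integrable_on {p..q}" if "h absolutely_integrable_on {p..q}" for h :: "real \<Rightarrow> real" and p q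
    using that by (simp add: absolutely_integrable_on_def)
  have bmo_f: "bmo_norm (f t) = ennreal (N t)" for t
  proof (cases "t \<in> E")
    case True
    have "bmo_norm (f t) = bmo_norm (B t)" using bmo_norm_cong_AE[OF f_AE[OF True] Bt[OF True]] by simp
    then show ?thesis using Bt_fin[OF True] by (simp add: N_def)
  next
    case False
    have "bmo_norm (\<lambda>x. 0) \<le> 0" unfolding bmo_norm_def by (rule SUP_least) (auto simp: mean_def)
    then show ?thesis using False by (simp add: N_def f_off)
  qed
  have bmo_B: "bmo_norm (B t) = ennreal (N t)" if "t \<in> E" for t
    using bmo_norm_cong_AE[OF f_AE[OF that] Bt[OF that]] bmo_f by simp
  have mean_param: "(\<lambda>t. mean p q (F t)) \<in> borel_measurable borel"
    if F: "(\<lambda>(t, x). F t x) \<in> borel_measurable (borel \<Otimes>\<^sub>M borel)" for F :: "real \<Rightarrow> real \<Rightarrow> real" and p q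
  proof -
    have Ft: "F t \<in> borel_measurable borel" for t using measurable_Pair2[OF F, of t] by simp
    have F': "(\<lambda>z. F (fst z) (snd z)) \<in> borel_measurable (borel \<Otimes>\<^sub>M borel)" using F by (simp add: split_def)
    have "(\<lambda>t. LINT x|lborel. (if p \<le> x \<and> x \<le> q then F t x else 0)) \<in> borel_measurable borel"
      by (rule parametric_integral_measurable) (unfold split_def, use F' in measurable)
    then show ?thesis unfolding mean_def lborel_set_integral[OF Ft] by measurable
  qed
  have int_mean: "integral {-1..1} h = 2 * mean (-1) 1 h" if "h absolutely_integrable_on {-1..1}" for h
    using mean_eq[OF that] by simp
  have Nm: "N \<in> borel_measurable borel"
  proof -
    let ?Q = "{(p, q). p \<in> \<rat> \<and> q \<in> \<rat> \<and> p < (q::real)}"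
    have "?Q \<subseteq> \<rat> \<times> \<rat>" by auto
    then have count: "countable ?Q" by (rule countable_subset) (intro countable_SIGMA countable_rat)
    have "(\<lambda>t. SUP (p, q) \<in> ?Q. ennreal (mean p q (\<lambda>x. \<bar>f t x - mean p q (f t)\<bar>))) \<in> borel_measurable borel"
    proof (rule borel_measurable_SUP[OF count])
      fix z assume "z \<in> ?Q"
      obtain p q where z: "z = (p, q)" by (cases z)
      have m: "(\<lambda>t. mean p q (f t)) \<in> borel_measurable borel" by (rule mean_param[OF fm])
      have f': "(\<lambda>z. f (fst z) (snd z)) \<in> borel_measurable (borel \<Otimes>\<^sub>M borel)" using fm by (simp add: split_def)
      have "(\<lambda>(t, x). \<bar>f t x - mean p q (f t)\<bar>) \<in> borel_measurable (borel \<Otimes>\<^sub>M borel)"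
        unfolding split_def using f' measurable_compose[OF measurable_fst m] by measurable
      from mean_param[OF this]
      have "(\<lambda>t. mean p q (\<lambda>x. \<bar>f t x - mean p q (f t)\<bar>)) \<in> borel_measurable borel" .
      then show "(\<lambda>t. case z of (p, q) \<Rightarrow> ennreal (mean p q (\<lambda>x. \<bar>f t x - mean p q (f t)\<bar>))) \<in> borel_measurable borel"
        unfolding z by simp
    qed
    then show ?thesis unfolding N_def bmo_norm_rational[OF fi] by measurable
  qed
  have a1m: "a1 \<in> borel_measurable borel"
  proof -
    have "(\<lambda>(t, x). \<bar>f t x\<bar>) \<in> borel_measurable (borel \<Otimes>\<^sub>M borel)" using fm by (auto simp: split_def)
    from mean_param[OF this, of "-1" 1] show ?thesis
      unfolding a1_def int_mean[OF absi[OF fi]] by measurable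
  qed
  have a2m: "a2 \<in> borel_measurable borel"
  proof -
    have "(\<lambda>(t, x). \<bar>bb t x\<bar>) \<in> borel_measurable (borel \<Otimes>\<^sub>M borel)" using bbm by (auto simp: split_def)
    from mean_param[OF this, of "-1" 1] show ?thesis
      unfolding a2_def int_mean[OF absi[OF bbi]] by measurable
  qed
  have a1_le: "ennreal (a1 t) \<le> bmo_star_norm (B t)" if "t \<in> E" for t
  proof -
    have "ennreal (a1 t) = (\<integral>\<^sup>+x\<in>{-1..1}. ennreal \<bar>f t x\<bar> \<partial>lebesgue)"
      unfolding a1_def by (rule nn_integral_abs_eq[OF fi, symmetric])
    also have "\<dots> = (\<integral>\<^sup>+x\<in>{-1..1}. ennreal \<bar>B t x\<bar> \<partial>lebesgue)"
      by (rule nn_integral_cong_AE) (use f_AE[OF that] in eventually_elim, simp)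
    also have "\<dots> \<le> bmo_star_norm (B t)" unfolding bmo_star_norm_def by simp
    finally show ?thesis .
  qed
  have a2_le: "ennreal (a2 t) \<le> (\<integral>\<^sup>+x\<in>{-1..1}. ennreal \<bar>b t x\<bar> \<partial>lebesgue)" if "t \<in> E" for t
  proof -
    have "ennreal (a2 t) = (\<integral>\<^sup>+x\<in>{-1..1}. ennreal \<bar>bb t x\<bar> \<partial>lebesgue)"
      unfolding a2_def by (rule nn_integral_abs_eq[OF bbi, symmetric])
    also have "\<dots> = (\<integral>\<^sup>+x\<in>{-1..1}. ennreal \<bar>b t x\<bar> \<partial>lebesgue)"
      by (rule nn_integral_cong_AE) (use bb_AE[OF that] in eventually_elim, simp)
    finally show ?thesis by simp
  qed
  have a1_nonneg: "0 \<le> a1 t" and a2_nonneg: "0 \<le> a2 t" for t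
    unfolding a1_def a2_def using absi[OF fi] absi[OF bbi]
    by (auto intro!: integral_nonneg simp: absolutely_integrable_on_def)
  have N_nonneg: "0 \<le> N t" for t by (simp add: N_def)
  have N_int: "N absolutely_integrable_on {0..T}"
  proof (rule absolutely_integrable_of_nn_integral[OF Nm N_nonneg _ B_fin])
    show "AE t in lebesgue. t \<in> {0..T} \<longrightarrow> ennreal (N t) \<le> bmo_star_norm (B t)"
      using AE_E
    proof eventually_elim
      case (elim t)
      show ?case
      proof
        assume "t \<in> {0..T}"
        then have "t \<in> E" using elim by simp
        then show "ennreal (N t) \<le> bmo_star_norm (B t)" unfolding bmo_star_norm_def by (simp add: bmo_B)
      qed
    qed
  qed
  have a1_int: "a1 absolutely_integrable_on {0..T}"
    by (rule absolutely_integrable_of_nn_integral[OF a1m a1_nonneg _ B_fin])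
      (use AE_E in eventually_elim, use a1_le in blast)
  have a2_int: "a2 absolutely_integrable_on {0..T}"
    by (rule absolutely_integrable_of_nn_integral[OF a2m a2_nonneg _ b_fin])
      (use AE_E in eventually_elim, use a2_le in blast)
  have v_diff: "v t q - v t p = integral {p..q} (f t)" if "p \<le> q" for t p q
    unfolding v_def al_def using antiderivative_diff[OF fi that, of t] by simp
  \<comment> \<open>The value \<open>v t 0 = c t\<close> is at most \<open>a1 t + a2 t\<close>,
    since \<open>c t\<close> is the mean of \<open>bb t - al t\<close> over \<open>{0..1}\<close>;
    the increment over \<open>{-1..1}\<close> is at most \<open>2 * a1 t\<close>.\<close>
  have field: "bmo_field T v f N (\<lambda>t. 2 * a1 t + a2 t)"
  proof
    show "0 \<le> T" using T by simp
    have "(\<lambda>z. c (fst z) + al (fst z) (snd z)) \<in> borel_measurable (borel \<Otimes>\<^sub>M borel)"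
      using measurable_compose[OF measurable_fst cm] alm unfolding split_def by (rule borel_measurable_add)
    then show "(\<lambda>(t, x). v t x) \<in> borel_measurable borel" by (simp add: v_def split_def borel_prod)
    show "f t absolutely_integrable_on {p..q}" for t p q by (rule fi)
    show "v t q - v t p = integral {p..q} (f t)" if "p \<le> q" for t p q by (rule v_diff[OF that])
    show "0 \<le> N t" for t by (rule N_nonneg)
    show "integral {p..q} (\<lambda>x. \<bar>f t x - (v t q - v t p) / (q - p)\<bar>) \<le> N t * (q - p)" if pq: "p < q" for t p q
    proof -
      have m: "(v t q - v t p) / (q - p) = mean p q (f t)"
        using v_diff[of p q t] pq by (simp add: mean_eq[OF fi])
      have "ennreal (mean p q (\<lambda>x. \<bar>f t x - mean p q (f t)\<bar>)) \<le> bmo_norm (f t)"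
        unfolding bmo_norm_def by (rule SUP_upper2[of "(p, q)"]) (use pq in auto)
      then have "mean p q (\<lambda>x. \<bar>f t x - mean p q (f t)\<bar>) \<le> N t"
        unfolding bmo_f using N_nonneg[of t] by simp
      moreover have "(\<lambda>x. f t x - mean p q (f t)) absolutely_integrable_on {p..q}"
        by (intro set_integral_diff fi absolutely_integrable_const_Icc)
      ultimately show ?thesis using pq by (simp add: m mean_eq[OF absi] pos_divide_le_eq)
    qed
    show "N absolutely_integrable_on {0..T}" by (rule N_int)
    show "(\<lambda>t. 2 * a1 t + a2 t) absolutely_integrable_on {0..T}"
      by (intro set_integral_add set_integrable_mult_right a1_int a2_int)
    show "\<bar>v t 1 - v t (-1)\<bar> \<le> 2 * a1 t + a2 t" for t
    proof -
      have "\<bar>al t 1\<bar> \<le> a1 t" "\<bar>al t (-1)\<bar> \<le> a1 t"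
        unfolding al_def a1_def by (rule abs_antiderivative_le[OF fi], simp)+
      then show ?thesis using a2_nonneg[of t] by (simp add: v_def)
    qed
    show "\<bar>v t 0\<bar> \<le> 2 * a1 t + a2 t" for t
    proof -
      have "\<bar>c t\<bar> \<le> integral {0..1} (\<lambda>y. \<bar>bb t y\<bar> + a1 t)"
        unfolding c_eq real_norm_def[symmetric]
      proof (rule integral_norm_bound_integral)
        show "(\<lambda>y. bb t y - al t y) integrable_on {0..1}" using di absolutely_integrable_on_def by blast
        show "(\<lambda>y. norm (bb t y) + a1 t) integrable_on {0..1}"
          using bbi[of 0 1 t] by (intro integrable_add integrable_const_ivl) (simp add: absolutely_integrable_on_def)
        fix y :: real assume y: "y \<in> {0..1}"
        have "\<bar>al t y\<bar> \<le> a1 t" unfolding al_def a1_def by (rule abs_antiderivative_le[OF fi]) (use y in auto)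
        then show "norm (bb t y - al t y) \<le> norm (bb t y) + a1 t" by simp
      qed
      also have "\<dots> = integral {0..1} (\<lambda>y. \<bar>bb t y\<bar>) + a1 t"
        using bbi[of 0 1 t] by (subst integral_add) (auto simp: absolutely_integrable_on_def)
      also have "integral {0..1} (\<lambda>y. \<bar>bb t y\<bar>) \<le> a2 t"
        unfolding a2_def using bbi[of 0 1 t] bbi[of "-1" 1 t]
        by (intro integral_subset_le) (auto simp: absolutely_integrable_on_def)
      finally show ?thesis using a1_nonneg[of t] by (simp add: v_def al_def antiderivative_zero)
    qed
  qed
  have rep_AE: "AE t in lebesgue. t \<in> {0..T} \<longrightarrow> cont_rep (b t) = v t"
    using AE_E by eventually_elim (use rep in blast)
  have beta: "integral {0..t} N = bmo_integral B t" if t: "t \<in> {0..T}" for t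
  proof -
    have "N absolutely_integrable_on {0..t}" using absolutely_integrable_on_subinterval[OF N_int, of 0 t] t by auto
    from nn_integral_abs_eq[OF this]
    have "(\<integral>\<^sup>+s\<in>{0..t}. ennreal (N s) \<partial>lebesgue) = ennreal (integral {0..t} N)" using N_nonneg by simp
    moreover have "(\<integral>\<^sup>+s\<in>{0..t}. bmo_norm (B s) \<partial>lebesgue) = (\<integral>\<^sup>+s\<in>{0..t}. ennreal (N s) \<partial>lebesgue)"
    proof (rule nn_integral_cong_AE)
      show "AE s in lebesgue. bmo_norm (B s) * indicator {0..t} s = ennreal (N s) * indicator {0..t} s"
        using AE_E by eventually_elim (use t bmo_B in \<open>auto split: split_indicator\<close>)
    qed
    moreover have "0 \<le> integral {0..t} N"
      using absolutely_integrable_on_subinterval[OF N_int, of 0 t] t N_nonneg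
      by (intro integral_nonneg) (auto simp: absolutely_integrable_on_def)
    ultimately show ?thesis by (simp add: bmo_integral_def)
  qed
  show ?thesis using that[OF field rep_AE beta] .
qed

theorem theorem1p1:
  "\<exists>C1 c :: real. 0 < C1 \<and> 0 < c \<and>
    (\<forall>(T :: real) (b :: real \<Rightarrow> real \<Rightarrow> real) (B :: real \<Rightarrow> real \<Rightarrow> real).
       0 < T \<longrightarrow> b \<in> L1_L1loc T \<longrightarrow>
       (AE t in lebesgue_on {0..T}. has_distributional_deriv (b t) (B t)) \<longrightarrow>
       B \<in> L1_BMO T \<longrightarrow>
       (\<exists>\<phi>. is_flow T b \<phi> \<and>
            (\<forall>\<phi>'. is_flow T b \<phi>' \<longrightarrow> (\<forall>t\<in>{0..T}. \<forall>x. \<phi>' t x = \<phi> t x)) \<and>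
            (\<forall>t\<in>{0..T}. \<exists>g. has_distributional_deriv (\<phi> t) g \<and>
               Ainf_weight (\<lambda>x. \<bar>g x\<bar>) \<and>
               (\<lambda>x. ln \<bar>g x\<bar>) \<in> BMO \<and>
               bmo_norm (\<lambda>x. ln \<bar>g x\<bar>)
                 \<le> ennreal (C1 * bmo_integral B t * exp (c * bmo_integral B t)))))"
proof (rule exI[of _ 90], rule exI[of _ 9], intro conjI allI impI)
  fix T :: real and b B :: "real \<Rightarrow> real \<Rightarrow> real"
  assume T: "0 < T" and b: "b \<in> L1_L1loc T"
    and bB: "AE t in lebesgue_on {0..T}. has_distributional_deriv (b t) (B t)" and B: "B \<in> L1_BMO T"
  obtain v f N a where field: "bmo_field T v f N a"
    and rep: "AE t in lebesgue. t \<in> {0..T} \<longrightarrow> cont_rep (b t) = v t"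
    and beta: "\<And>t. t \<in> {0..T} \<Longrightarrow> integral {0..t} N = bmo_integral B t"
    by (rule bmo_field_of_velocity[OF T b bB B], rule that, assumption+)
  interpret bmo_field T v f N a by (rule field)
  \<comment> \<open>The integrated equation sees the velocity only at almost every time, and there
    its continuous representative is \<open>v t\<close>.\<close>
  have flow_iff: "is_flow T b \<psi> \<longleftrightarrow> (\<forall>x. \<psi> 0 x = x \<and> solution (\<lambda>t. \<psi> t x))" for \<psi>
  proof -
    have ae: "AE t in lebesgue. t \<in> {0..s} \<longrightarrow> cont_rep (b t) (\<psi> t x) = v t (\<psi> t x)" if "s \<le> T" for s x
      using rep by eventually_elim (use that in auto)
    have ae': "AE t in lebesgue. t \<in> {0..s} \<longrightarrow> v t (\<psi> t x) = cont_rep (b t) (\<psi> t x)" if "s \<le> T" for s x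
      using rep by eventually_elim (use that in auto)
    have i: "(\<lambda>t. cont_rep (b t) (\<psi> t x)) absolutely_integrable_on {0..s} \<longleftrightarrow> (\<lambda>t. v t (\<psi> t x)) absolutely_integrable_on {0..s}"
      if "s \<le> T" for s x
      using AE_eq_on_imp(1)[OF ae[OF that]] AE_eq_on_imp(1)[OF ae'[OF that]] by blast
    have e: "(LINT r:{0..s}|lebesgue. cont_rep (b r) (\<psi> r x)) = integral {0..s} (\<lambda>r. v r (\<psi> r x))"
      if vi: "(\<lambda>t. v t (\<psi> t x)) absolutely_integrable_on {0..T}" and s: "s \<in> {0..T}" for s x
    proof -
      have "(\<lambda>t. v t (\<psi> t x)) absolutely_integrable_on {0..s}" using integrable_sub(1)[OF vi, of 0 s] s T by simp
      then have "(\<lambda>t. cont_rep (b t) (\<psi> t x)) absolutely_integrable_on {0..s}" using i[of s x] s by simp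
      then have "(LINT r:{0..s}|lebesgue. cont_rep (b r) (\<psi> r x)) = integral {0..s} (\<lambda>r. cont_rep (b r) (\<psi> r x))"
        by (rule set_lebesgue_integral_eq_integral(2))
      also have "\<dots> = integral {0..s} (\<lambda>r. v r (\<psi> r x))" using AE_eq_on_imp(2)[OF ae[of s x]] s by simp
      finally show ?thesis .
    qed
    show ?thesis
      unfolding is_flow_def solution_def
    proof (intro iff_allI)
      fix x
      show "(\<psi> 0 x = x \<and> (\<lambda>t. cont_rep (b t) (\<psi> t x)) absolutely_integrable_on {0..T} \<and>
          (\<forall>t\<in>{0..T}. \<psi> t x = x + (LINT r:{0..t}|lebesgue. cont_rep (b r) (\<psi> r x)))) =
        (\<psi> 0 x = x \<and> (\<lambda>s. v s (\<psi> s x)) absolutely_integrable_on {0..T} \<and>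
          (\<forall>t\<in>{0..T}. \<psi> t x = \<psi> 0 x + integral {0..t} (\<lambda>s. v s (\<psi> s x))))"
        using i[of T x] e[of x] by (smt (verit, best) order_refl)
    qed
  qed
  show "\<exists>\<phi>. is_flow T b \<phi> \<and>
      (\<forall>\<phi>'. is_flow T b \<phi>' \<longrightarrow> (\<forall>t\<in>{0..T}. \<forall>x. \<phi>' t x = \<phi> t x)) \<and>
      (\<forall>t\<in>{0..T}. \<exists>g. has_distributional_deriv (\<phi> t) g \<and> Ainf_weight (\<lambda>x. \<bar>g x\<bar>) \<and>
         (\<lambda>x. ln \<bar>g x\<bar>) \<in> BMO \<and>
         bmo_norm (\<lambda>x. ln \<bar>g x\<bar>) \<le> ennreal (90 * bmo_integral B t * exp (9 * bmo_integral B t)))"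
  proof (intro exI[of _ flow] conjI allI impI ballI)
    show "is_flow T b flow" unfolding flow_iff using flow_solution by blast
    fix \<psi> t x assume \<psi>: "is_flow T b \<psi>" and t: "t \<in> {0..T}"
    have "solution (\<lambda>t. \<psi> t x)" "\<psi> 0 x = x" using \<psi> unfolding flow_iff by blast+
    then show "\<psi> t x = flow t x"
      using solution_unique[of "\<lambda>t. \<psi> t x" "\<lambda>t. flow t x" 0 t] flow_solution t T by simp
  next
    fix t assume t: "t \<in> {0..T}"
    show "\<exists>g. has_distributional_deriv (flow t) g \<and> Ainf_weight (\<lambda>x. \<bar>g x\<bar>) \<and> (\<lambda>x. ln \<bar>g x\<bar>) \<in> BMO \<and>
        bmo_norm (\<lambda>x. ln \<bar>g x\<bar>) \<le> ennreal (90 * bmo_integral B t * exp (9 * bmo_integral B t))"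
      using flow_weight[OF t] unfolding beta_def beta[OF t] .
  qed
qed simp_all

end
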